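(* Let $T$ be a complete first-order theory and let $a$, $b$ be two ultraimaginaries. The following are equivalent: (1) $\mathrm{bdd}^u(a)\cap\mathrm{bdd}^u(b)=\mathrm{bdd}^u(\emptyset)$. (2) For any $a'\equiv^{lstp}a$ there are $n<\omega$ and a sequence $(a_ib_i:i\le n)$ such that $a_0=a$, $b_0=b$, $a_n=a'$, and for each $i<n$ $$\mathrm{bdd}^u(a_i)\,b_{i+1}\equiv\mathrm{bdd}^u(a_i)\,b_i\quad\text{and}\quad a_{i+1}\,\mathrm{bdd}^u(b_{i+1})\equiv a_i\,\mathrm{bdd}^u(b_{i+1}).$$ If $a$ or $b$ is quasi-finitary, these are also equivalent to $\mathrm{bdd}^{qfu}(a)\cap\mathrm{bdd}^{qfu}(b)=\mathrm{bdd}^{qfu}(\emptyset)$.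
   Context: Work in a monster model of $T$. Tuples and parameter sets are hyperimaginary unless stated otherwise. An ultraimaginary is the class $a_E$ of a tuple $a$ modulo an $\emptyset$-invariant equivalence relation $E$; tuples of ultraimaginaries are again ultraimaginary. An ultraimaginary $a_E$ is definable over an ultraimaginary $b_F$ if every automorphism of the monster model stabilising the $F$-class of $b$ stabilises the $E$-class of $a$; it is bounded over $b_F$ if the orbit of $a$ under the group of automorphisms stabilising the $F$-class of $b$ is contained in boundedly many $E$-classes. A representative of $e$ is any hyperimaginary over which $e$ is definable. Two ultraimaginaries have the same type (written $\equiv$), respectively the same Lascar strong type (written $\equiv^{lstp}$), if they have representatives which do; equivalently, if they are conjugate under an automorphism, respectively a Lascar strong automorphism. In particular $\mathrm{bdd}^u(a_i)b_{i+1}\equiv\mathrm{bdd}^u(a_i)b_i$ means that some automorphism fixes every element of $\mathrm{bdd}^u(a_i)$ and maps $b_i$ to $b_{i+1}$. An ultraimaginary is quasi-finitary if it is bounded over some finite real tuple. $\mathrm{bdd}^u(e)$ is the set of all ultraimaginaries bounded over $e$, and $\mathrm{bdd}^{qfu}(e)$ is the set of all quasi-finitary ones among them. *)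

theory Defs
  imports "HOL-Algebra.Generated_Groups" "HOL-Algebra.Bij"
begin

unbundle cardinal_syntax

section \<open>First-order logic\<close>

record ('f, 'r) lang =
  Funs :: "'f set"
  Rels :: "'r set"
  farity :: "'f \<Rightarrow> nat"
  rarity :: "'r \<Rightarrow> nat"

datatype 'f tm = Var nat | App 'f "'f tm list"

datatype ('f, 'r) fm =
    Eq "'f tm" "'f tm"
  | Rel 'r "'f tm list"
  | Neg "('f, 'r) fm"
  | Conj "('f, 'r) fm" "('f, 'r) fm"
  | Ex nat "('f, 'r) fm"

record ('f, 'r, 'm) struct =
  Dom :: "'m set"
  FunI :: "'f \<Rightarrow> 'm list \<Rightarrow> 'm"
  RelI :: "'r \<Rightarrow> 'm list \<Rightarrow> bool"

fun wf_tm :: "('f, 'r) lang \<Rightarrow> 'f tm \<Rightarrow> bool" where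
  "wf_tm L (Var n) = True"
| "wf_tm L (App f ts) = (f \<in> Funs L \<and> length ts = farity L f \<and> (\<forall>t\<in>set ts. wf_tm L t))"

fun wf_fm :: "('f, 'r) lang \<Rightarrow> ('f, 'r) fm \<Rightarrow> bool" where
  "wf_fm L (Eq s t) = (wf_tm L s \<and> wf_tm L t)"
| "wf_fm L (Rel r ts) = (r \<in> Rels L \<and> length ts = rarity L r \<and> (\<forall>t\<in>set ts. wf_tm L t))"
| "wf_fm L (Neg \<phi>) = wf_fm L \<phi>"
| "wf_fm L (Conj \<phi> \<psi>) = (wf_fm L \<phi> \<and> wf_fm L \<psi>)"
| "wf_fm L (Ex n \<phi>) = wf_fm L \<phi>"

fun fv_tm :: "'f tm \<Rightarrow> nat set" where
  "fv_tm (Var n) = {n}"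
| "fv_tm (App f ts) = (\<Union>t\<in>set ts. fv_tm t)"

fun fv :: "('f, 'r) fm \<Rightarrow> nat set" where
  "fv (Eq s t) = fv_tm s \<union> fv_tm t"
| "fv (Rel r ts) = (\<Union>t\<in>set ts. fv_tm t)"
| "fv (Neg \<phi>) = fv \<phi>"
| "fv (Conj \<phi> \<psi>) = fv \<phi> \<union> fv \<psi>"
| "fv (Ex n \<phi>) = fv \<phi> - {n}"

fun tm_val :: "('f, 'r, 'm) struct \<Rightarrow> (nat \<Rightarrow> 'm) \<Rightarrow> 'f tm \<Rightarrow> 'm" where
  "tm_val M v (Var n) = v n"
| "tm_val M v (App f ts) = FunI M f (map (tm_val M v) ts)"

fun sat :: "('f, 'r, 'm) struct \<Rightarrow> (nat \<Rightarrow> 'm) \<Rightarrow> ('f, 'r) fm \<Rightarrow> bool" where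
  "sat M v (Eq s t) = (tm_val M v s = tm_val M v t)"
| "sat M v (Rel r ts) = RelI M r (map (tm_val M v) ts)"
| "sat M v (Neg \<phi>) = (\<not> sat M v \<phi>)"
| "sat M v (Conj \<phi> \<psi>) = (sat M v \<phi> \<and> sat M v \<psi>)"
| "sat M v (Ex n \<phi>) = (\<exists>d\<in>Dom M. sat M (v(n := d)) \<phi>)"

definition is_struct :: "('f, 'r) lang \<Rightarrow> ('f, 'r, 'm) struct \<Rightarrow> bool" where
  "is_struct L M \<longleftrightarrow> Dom M \<noteq> {} \<and>
     (\<forall>f\<in>Funs L. \<forall>xs. length xs = farity L f \<and> set xs \<subseteq> Dom M \<longrightarrow> FunI M f xs \<in> Dom M)"

definition models :: "('f, 'r) lang \<Rightarrow> ('f, 'r, 'm) struct \<Rightarrow> ('f, 'r) fm set \<Rightarrow> bool" where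
  "models L M T \<longleftrightarrow> is_struct L M \<and> (\<forall>\<phi>\<in>T. \<forall>v. range v \<subseteq> Dom M \<longrightarrow> sat M v \<phi>)"

definition sentence :: "('f, 'r) lang \<Rightarrow> ('f, 'r) fm \<Rightarrow> bool" where
  "sentence L \<phi> \<longleftrightarrow> wf_fm L \<phi> \<and> fv \<phi> = {}"

text \<open>
  One cannot quantify over structures of all types inside a formula. Consistency and entailment
  are therefore expressed by structures whose elements are taken from the type
  \<^typ>\<open>('f, 'r) fm\<close>. That type is infinite and at least as large as the language, so by the
  downward Loewenheim-Skolem theorem nothing is lost.
\<close>

definition consistent :: "('f, 'r) lang \<Rightarrow> ('f, 'r) fm set \<Rightarrow> bool" where
  "consistent L T \<longleftrightarrow> (\<exists>N :: ('f, 'r, ('f, 'r) fm) struct. models L N T)"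

definition entails :: "('f, 'r) lang \<Rightarrow> ('f, 'r) fm set \<Rightarrow> ('f, 'r) fm \<Rightarrow> bool" where
  "entails L T \<phi> \<longleftrightarrow> (\<forall>N :: ('f, 'r, ('f, 'r) fm) struct. models L N T \<longrightarrow> models L N {\<phi>})"

definition complete_theory :: "('f, 'r) lang \<Rightarrow> ('f, 'r) fm set \<Rightarrow> bool" where
  "complete_theory L T \<longleftrightarrow> (\<forall>\<phi>\<in>T. sentence L \<phi>) \<and> consistent L T \<and>
     (\<forall>\<phi>. sentence L \<phi> \<longrightarrow> entails L T \<phi> \<or> entails L T (Neg \<phi>))"

definition elementary_submodel ::
    "('f, 'r) lang \<Rightarrow> ('f, 'r, 'm) struct \<Rightarrow> 'm set \<Rightarrow> bool" where
  "elementary_submodel L M N \<longleftrightarrow> N \<subseteq> Dom M \<and> is_struct L (M\<lparr>Dom := N\<rparr>) \<and>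
     (\<forall>\<phi> v. wf_fm L \<phi> \<and> range v \<subseteq> N \<longrightarrow> (sat (M\<lparr>Dom := N\<rparr>) v \<phi> \<longleftrightarrow> sat M v \<phi>))"

definition auts :: "('f, 'r) lang \<Rightarrow> ('f, 'r, 'm) struct \<Rightarrow> ('m \<Rightarrow> 'm) set" where
  "auts L M = {\<sigma> \<in> Bij (Dom M).
     (\<forall>f\<in>Funs L. \<forall>xs. length xs = farity L f \<and> set xs \<subseteq> Dom M \<longrightarrow>
        \<sigma> (FunI M f xs) = FunI M f (map \<sigma> xs)) \<and>
     (\<forall>r\<in>Rels L. \<forall>xs. length xs = rarity L r \<and> set xs \<subseteq> Dom M \<longrightarrow>
        (RelI M r (map \<sigma> xs) \<longleftrightarrow> RelI M r xs))}"


section \<open>Monster models\<close>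

text \<open>
  A pair \<open>(\<phi>, v)\<close> stands for the formula \<open>\<phi>\<close> whose free variables other than \<open>0\<close> have been
  replaced by the parameters given by \<open>v\<close>; the variable \<open>0\<close> is the variable of the type.
\<close>

definition saturated ::
    "('f, 'r) lang \<Rightarrow> 'k rel \<Rightarrow> ('f, 'r, 'm) struct \<Rightarrow> bool" where
  "saturated L \<kappa> M \<longleftrightarrow>
     (\<forall>A p. A \<subseteq> Dom M \<and> |A| <o \<kappa> \<and>
        p \<subseteq> {(\<phi>, v). wf_fm L \<phi> \<and> v ` (fv \<phi> - {0}) \<subseteq> A} \<and>
        (\<forall>q. q \<subseteq> p \<and> finite q \<longrightarrow> (\<exists>d\<in>Dom M. \<forall>(\<phi>, v)\<in>q. sat M (v(0 := d)) \<phi>)) \<longrightarrow>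
        (\<exists>d\<in>Dom M. \<forall>(\<phi>, v)\<in>p. sat M (v(0 := d)) \<phi>))"

definition elementary_map ::
    "('f, 'r) lang \<Rightarrow> ('f, 'r, 'm) struct \<Rightarrow> 'm set \<Rightarrow> ('m \<Rightarrow> 'm) \<Rightarrow> bool" where
  "elementary_map L M A h \<longleftrightarrow> A \<subseteq> Dom M \<and> h ` A \<subseteq> Dom M \<and>
     (\<forall>\<phi> v. wf_fm L \<phi> \<and> v ` fv \<phi> \<subseteq> A \<longrightarrow> (sat M (h \<circ> v) \<phi> \<longleftrightarrow> sat M v \<phi>))"

definition strongly_homogeneous ::
    "('f, 'r) lang \<Rightarrow> 'k rel \<Rightarrow> ('f, 'r, 'm) struct \<Rightarrow> bool" where
  "strongly_homogeneous L \<kappa> M \<longleftrightarrow>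
     (\<forall>A h. |A| <o \<kappa> \<and> elementary_map L M A h \<longrightarrow> (\<exists>\<sigma>\<in>auts L M. \<forall>x\<in>A. \<sigma> x = h x))"

text \<open>Every cardinal below \<open>\<kappa> :: 'k rel\<close> is the cardinality of a set of elements of \<open>'k\<close>.\<close>

definition strong_limit :: "'k rel \<Rightarrow> bool" where
  "strong_limit \<kappa> \<longleftrightarrow> Card_order \<kappa> \<and> natLeq <o \<kappa> \<and>
     (\<forall>X :: 'k set. |X| <o \<kappa> \<longrightarrow> |Pow X| <o \<kappa>)"

text \<open>
  The cardinal \<open>\<kappa>\<close> fixes the meaning of ``small'' and of ``bounded'': both mean of cardinality
  less than \<open>\<kappa>\<close>.
\<close>

definition monster_model ::
    "('f, 'r) lang \<Rightarrow> ('f, 'r) fm set \<Rightarrow> 'k rel \<Rightarrow> ('f, 'r, 'm) struct \<Rightarrow> bool" where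
  "monster_model L T \<kappa> M \<longleftrightarrow> strong_limit \<kappa> \<and> |Funs L| <o \<kappa> \<and> |Rels L| <o \<kappa> \<and>
     models L M T \<and> saturated L \<kappa> M \<and> strongly_homogeneous L \<kappa> M"

definition lascar_auts ::
    "('f, 'r) lang \<Rightarrow> 'k rel \<Rightarrow> ('f, 'r, 'm) struct \<Rightarrow> ('m \<Rightarrow> 'm) set" where
  "lascar_auts L \<kappa> M = generate (BijGroup (Dom M))
     {\<sigma> \<in> auts L M. \<exists>N. elementary_submodel L M N \<and> |N| <o \<kappa> \<and> (\<forall>x\<in>N. \<sigma> x = x)}"


section \<open>Ultraimaginaries\<close>

text \<open>
  A real tuple is a partial function from \<open>'k\<close> to \<open>'m\<close>, whose domain is its index set; the small
  subsets of \<open>'k\<close> provide index sets of every cardinality below \<open>\<kappa>\<close>. An ultraimaginary is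
  represented by the set of real tuples forming the equivalence class. Classes of hyperimaginary
  tuples are covered: the hyperimaginary tuples of a given sort are the classes of real tuples
  modulo an invariant equivalence relation, along which an invariant equivalence relation on the
  hyperimaginaries can be pulled back to the real tuples.
\<close>

definition tuples :: "('f, 'r, 'm) struct \<Rightarrow> 'k set \<Rightarrow> ('k \<rightharpoonup> 'm) set" where
  "tuples M I = {x. dom x = I \<and> ran x \<subseteq> Dom M}"

definition act_tuple :: "('m \<Rightarrow> 'm) \<Rightarrow> ('k \<rightharpoonup> 'm) \<Rightarrow> ('k \<rightharpoonup> 'm)" where
  "act_tuple \<sigma> x = map_option \<sigma> \<circ> x"

definition invariant_equiv ::
    "('f, 'r) lang \<Rightarrow> ('f, 'r, 'm) struct \<Rightarrow> 'k set \<Rightarrow> ('k \<rightharpoonup> 'm) rel \<Rightarrow> bool" where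
  "invariant_equiv L M I E \<longleftrightarrow> equiv (tuples M I) E \<and>
     (\<forall>\<sigma>\<in>auts L M. \<forall>(x, y)\<in>E. (act_tuple \<sigma> x, act_tuple \<sigma> y) \<in> E)"

definition ultraimaginaries ::
    "('f, 'r) lang \<Rightarrow> 'k rel \<Rightarrow> ('f, 'r, 'm) struct \<Rightarrow> ('k \<rightharpoonup> 'm) set set" where
  "ultraimaginaries L \<kappa> M =
     {e. \<exists>I E. |I| <o \<kappa> \<and> invariant_equiv L M I E \<and> e \<in> tuples M I // E}"

definition act :: "('m \<Rightarrow> 'm) \<Rightarrow> ('k \<rightharpoonup> 'm) set \<Rightarrow> ('k \<rightharpoonup> 'm) set" where
  "act \<sigma> e = act_tuple \<sigma> ` e"

definition fixing_auts ::
    "('f, 'r) lang \<Rightarrow> ('f, 'r, 'm) struct \<Rightarrow> ('k \<rightharpoonup> 'm) set set \<Rightarrow> ('m \<Rightarrow> 'm) set" where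
  "fixing_auts L M B = {\<sigma> \<in> auts L M. \<forall>e\<in>B. act \<sigma> e = e}"

text \<open>
  If \<open>e\<close> is the class of \<open>a\<close> modulo \<open>E\<close>, then \<open>act \<sigma> e\<close> is the class of the image of \<open>a\<close>
  under \<open>\<sigma>\<close>, so that the set below is the set of \<open>E\<close>-classes meeting the orbit of \<open>a\<close>.
\<close>

definition bounded_over :: "('f, 'r) lang \<Rightarrow> 'k rel \<Rightarrow> ('f, 'r, 'm) struct \<Rightarrow>
    ('k \<rightharpoonup> 'm) set set \<Rightarrow> ('k \<rightharpoonup> 'm) set \<Rightarrow> bool" where
  "bounded_over L \<kappa> M B e \<longleftrightarrow> |(\<lambda>\<sigma>. act \<sigma> e) ` fixing_auts L M B| <o \<kappa>"

definition bddu :: "('f, 'r) lang \<Rightarrow> 'k rel \<Rightarrow> ('f, 'r, 'm) struct \<Rightarrow>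
    ('k \<rightharpoonup> 'm) set set \<Rightarrow> ('k \<rightharpoonup> 'm) set set" where
  "bddu L \<kappa> M B = {e \<in> ultraimaginaries L \<kappa> M. bounded_over L \<kappa> M B e}"

text \<open>The real tuple \<open>t\<close> is the ultraimaginary \<open>{t}\<close>, its class modulo equality.\<close>

definition quasi_finitary ::
    "('f, 'r) lang \<Rightarrow> 'k rel \<Rightarrow> ('f, 'r, 'm) struct \<Rightarrow> ('k \<rightharpoonup> 'm) set \<Rightarrow> bool" where
  "quasi_finitary L \<kappa> M e \<longleftrightarrow>
     (\<exists>I t. finite I \<and> t \<in> tuples M I \<and> bounded_over L \<kappa> M {{t}} e)"

definition bddqfu :: "('f, 'r) lang \<Rightarrow> 'k rel \<Rightarrow> ('f, 'r, 'm) struct \<Rightarrow>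
    ('k \<rightharpoonup> 'm) set set \<Rightarrow> ('k \<rightharpoonup> 'm) set set" where
  "bddqfu L \<kappa> M B = {e \<in> bddu L \<kappa> M B. quasi_finitary L \<kappa> M e}"

text \<open>
  Ultraimaginaries have the same (Lascar strong) type iff they are conjugate under a (Lascar
  strong) automorphism; \<open>same_type_over L M B c d\<close> says that \<open>B c\<close> and \<open>B d\<close> have the same type,
  where \<open>B\<close> is enumerated identically on both sides.
\<close>

definition same_type_over :: "('f, 'r) lang \<Rightarrow> ('f, 'r, 'm) struct \<Rightarrow>
    ('k \<rightharpoonup> 'm) set set \<Rightarrow> ('k \<rightharpoonup> 'm) set \<Rightarrow> ('k \<rightharpoonup> 'm) set \<Rightarrow> bool" where
  "same_type_over L M B c d \<longleftrightarrow> (\<exists>\<sigma>\<in>fixing_auts L M B. act \<sigma> c = d)"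

definition same_lstp :: "('f, 'r) lang \<Rightarrow> 'k rel \<Rightarrow> ('f, 'r, 'm) struct \<Rightarrow>
    ('k \<rightharpoonup> 'm) set \<Rightarrow> ('k \<rightharpoonup> 'm) set \<Rightarrow> bool" where
  "same_lstp L \<kappa> M c d \<longleftrightarrow> (\<exists>\<sigma>\<in>lascar_auts L \<kappa> M. act \<sigma> c = d)"

end

theory Submission
  imports Defs
begin

text \<open>
  Write \<open>H c\<close> for the group of automorphisms fixing every ultraimaginary bounded over \<open>c\<close>, and
  \<open>K\<close> for the group generated by \<open>H a\<close> and \<open>H b\<close>. Since \<open>H (g c)\<close> is the conjugate of \<open>H c\<close> by
  \<open>g\<close>, the elements reached from \<open>a\<close> by the chains of (2) are exactly the conjugates of \<open>a\<close> under \<open>K\<close>.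

  By the coheir argument, an ultraimaginary bounded over \<open>c\<close> is fixed by the pointwise stabiliser of
  every small model over which \<open>c\<close> is definable. Hence \<open>K\<close> contains such a stabiliser, and therefore
  is itself the stabiliser of an ultraimaginary \<open>e\<close>. Counting types shows that \<open>e\<close> is bounded over
  both \<open>a\<close> and \<open>b\<close>. Under (1) it is bounded, so that the Lascar group fixes \<open>e\<close>, that is, is
  contained in \<open>K\<close>; this is (2).

  Conversely, if \<open>e\<close> is bounded over \<open>a\<close> and over \<open>b\<close>, then \<open>K\<close> fixes \<open>e\<close>, and (2) writes every Lascar
  strong automorphism as the product of one fixing \<open>a\<close> and one fixing \<open>e\<close>. So the orbit of \<open>e\<close> under the
  Lascar group is small, and counting types once more \<open>e\<close> is bounded.

  If \<open>a\<close> is quasi-finitary, then so is everything bounded over it.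
\<close>

section \<open>Small sets of formulas\<close>

text \<open>An ultraimaginary may come from any invariant equivalence relation, without a
  definability condition. This is what lets a single ultraimaginary have as stabiliser any group of
  automorphisms containing the stabiliser of a small set; the relation built from \<open>K\<close>
  has no reason to be type-definable.

  Types are counted in one form only: the automorphism group is a union of few double cosets of
  \<open>Stab N\<close>, because the double coset of g depends only on the type of N together with
  its image under g, and \<kappa> is a strong limit. To bound an orbit, the left factor is moved
  past the representative r by conjugation. Over b, where r can be shown to fix b, the conjugate
  stays in \<open>H b\<close>; over the empty set it stays in the Lascar group.

  As \<kappa> may be singular, a union of few small sets need not be small. Orbits are therefore
  covered by the image of one small set or of a product of two.

  Saturation is given for one element and for formulas with numbered variables, whereas the coheir
  argument needs tuples of any small length. Bridging this gap is the purpose of the predicates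
  called \<open>definable\<close>.\<close>

lemma card_of_lists_infinite_ordLeq:
  assumes "infinite A"
  shows "|lists A| \<le>o |A|"
proof -
  have "|A \<times> A| =o |A|" by (rule card_of_Times_same_infinite[OF assms])
  then obtain p where p: "inj_on p (A \<times> A)" "p ` (A \<times> A) \<subseteq> A"
    using card_of_ordLeq[of "A \<times> A" A] ordIso_imp_ordLeq by blast
  obtain a0 where a0: "a0 \<in> A" using assms by (metis ex_in_conv finite.emptyI)
  \<comment> \<open>Iterated pairing is injective only among lists of equal length, which is why the
    length is recorded separately afterwards.\<close>
  define enc where "enc xs = foldr (\<lambda>x c. p (x, c)) xs a0" for xs
  have enc_in: "enc xs \<in> A" if "xs \<in> lists A" for xs
    using that p(2) a0 by (induction xs) (auto simp: enc_def)
  have enc_inj: "xs = ys"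
    if "length xs = length ys" "xs \<in> lists A" "ys \<in> lists A" "enc xs = enc ys" for xs ys
    using that
  proof (induction xs ys rule: list_induct2)
    case (Cons x xs y ys)
    have "p (x, enc xs) = p (y, enc ys)" using Cons.prems by (simp add: enc_def)
    moreover have "(x, enc xs) \<in> A \<times> A" "(y, enc ys) \<in> A \<times> A"
      using Cons.prems enc_in by auto
    ultimately have "x = y" "enc xs = enc ys" using p(1) by (auto dest: inj_onD)
    then show ?case using Cons by simp
  qed simp
  have "|lists A| \<le>o |(UNIV :: nat set) \<times> A|"
    by (rule card_of_ordLeqI[where f = "\<lambda>xs. (length xs, enc xs)"])
      (auto intro!: inj_onI enc_inj simp: enc_in)
  also have "|(UNIV :: nat set) \<times> A| \<le>o |A \<times> A|"
    using assms infinite_iff_card_of_nat[of A] by (auto intro: card_of_Times_mono1)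
  also have "|A \<times> A| =o |A|" by (rule card_of_Times_same_infinite[OF assms])
  finally show ?thesis .
qed

section \<open>Cardinal arithmetic below \<kappa>\<close>

locale uncountable_cardinal =
  fixes \<kappa> :: "'k rel"
  assumes Card_order: "Card_order \<kappa>" and uncountable: "natLeq <o \<kappa>"
begin

abbreviation small :: "'x set \<Rightarrow> bool" where
  "small X \<equiv> |X| <o \<kappa>"

lemma infinite_Field: "infinite (Field \<kappa>)"
  using uncountable infinite_iff_natLeq_ordLeq[of "Field \<kappa>"] card_of_Field_ordIso[OF Card_order]
  by (meson ordIso_symmetric ordLeq_ordIso_trans ordLess_imp_ordLeq)

lemma small_leq: "|X| \<le>o |Y| \<Longrightarrow> small Y \<Longrightarrow> small X"
  by (rule ordLeq_ordLess_trans)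

lemma small_subset: "X \<subseteq> Y \<Longrightarrow> small Y \<Longrightarrow> small X"
  by (rule small_leq[OF card_of_mono1])

lemma small_image: "small X \<Longrightarrow> small (f ` X)"
  by (rule small_leq[OF card_of_image])

lemma small_Un: "small X \<Longrightarrow> small Y \<Longrightarrow> small (X \<union> Y)"
  by (rule card_of_Un_ordLess_infinite_Field[OF infinite_Field Card_order])

lemma small_nat: "small (UNIV :: nat set)"
  using card_of_nat uncountable ordIso_ordLess_trans by blast

lemma small_finite: "finite X \<Longrightarrow> small X"
  using finite_imp_inj_to_nat_seg[of X] card_of_ordLeq[of X "UNIV :: nat set"] small_nat small_leq
  by blast

lemma small_Times:
  assumes "small X" "small Y" shows "small (X \<times> Y)"
proof -
  \<comment> \<open>The copy of the natural numbers makes \<open>Z\<close> infinite even if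
    \<open>X\<close> and \<open>Y\<close> are finite, so that the square law for infinite cardinals
    applies; uncountability of \<kappa> keeps \<open>Z\<close> small.\<close>
  define Z where "Z = (Inl ` Inl ` X \<union> Inl ` Inr ` Y) \<union> range (Inr :: nat \<Rightarrow> _)"
  have Z: "small Z" unfolding Z_def by (intro small_Un small_image assms small_nat)
  have "infinite Z" unfolding Z_def by (simp add: finite_image_iff)
  have "|X \<times> Y| \<le>o |Z \<times> Z|"
    by (rule card_of_ordLeqI[where f = "\<lambda>(x, y). (Inl (Inl x), Inl (Inr y))"])
      (auto simp: inj_on_def Z_def)
  also have "|Z \<times> Z| =o |Z|" by (rule card_of_Times_same_infinite[OF \<open>infinite Z\<close>])
  finally show ?thesis using Z by (rule small_leq)
qed

lemma small_lists:
  assumes "small X" shows "small (lists X)"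
proof -
  define Z where "Z = Inl ` X \<union> range (Inr :: nat \<Rightarrow> _)"
  have Z: "small Z" unfolding Z_def by (intro small_Un small_image assms small_nat)
  have "infinite Z" unfolding Z_def by (simp add: finite_image_iff)
  have "|lists X| \<le>o |lists Z|"
    by (rule card_of_ordLeqI[where f = "map Inl"]) (auto intro!: inj_on_mapI simp: Z_def)
  also have "|lists Z| \<le>o |Z|" by (rule card_of_lists_infinite_ordLeq[OF \<open>infinite Z\<close>])
  finally show ?thesis using Z by (rule small_leq)
qed

text \<open>This copies small sets into the type of \<kappa>, where index sets of tuples live and to
  which the power set clause of \<open>strong_limit\<close> refers.\<close>

lemma small_inj_into_Field:
  assumes "small X" obtains f where "inj_on f X" "f ` X \<subseteq> Field \<kappa>"
proof -
  have "|X| \<le>o |Field \<kappa>|"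
    using assms card_of_Field_ordIso[OF Card_order] ordIso_symmetric ordLess_imp_ordLeq
      ordLeq_ordIso_trans by blast
  then show thesis using card_of_ordLeq[of X "Field \<kappa>"] that by blast
qed

end

lemma strong_limit_uncountable: "strong_limit \<kappa> \<Longrightarrow> uncountable_cardinal \<kappa>"
  by (simp add: strong_limit_def uncountable_cardinal_def)

lemma strong_limit_small_Pow:
  assumes "strong_limit \<kappa>" "|X| <o \<kappa>" shows "|Pow X| <o \<kappa>"
proof -
  interpret uncountable_cardinal \<kappa> by (rule strong_limit_uncountable[OF assms(1)])
  obtain f where f: "inj_on f X" "f ` X \<subseteq> Field \<kappa>"
    using small_inj_into_Field[OF assms(2)] .
  have "|Pow X| \<le>o |Pow (f ` X)|"
    by (rule card_of_ordLeqI[where f = "image f"]) (use f in \<open>auto simp: inj_on_image_Pow\<close>)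
  moreover have "small (Pow (f ` X))"
    using assms small_image[OF assms(2), of f] by (simp add: strong_limit_def)
  ultimately show ?thesis by (rule small_leq)
qed

section \<open>Counting terms and formulas\<close>

fun ser_tm :: "'f tm \<Rightarrow> (nat + 'f \<times> nat) list" where
  "ser_tm (Var n) = [Inl n]"
| "ser_tm (App f ts) = Inr (f, length ts) # concat (map ser_tm ts)"

fun syms_tm :: "'f tm \<Rightarrow> 'f set" where
  "syms_tm (Var n) = {}"
| "syms_tm (App f ts) = insert f (\<Union>t\<in>set ts. syms_tm t)"

text \<open>The serialisation is prefix-free because it records the number of arguments.\<close>

lemma ser_tm_append_inj: "ser_tm s @ xs = ser_tm t @ ys \<Longrightarrow> s = t \<and> xs = ys"
proof (induction s arbitrary: t xs ys)
  case (Var n)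
  then show ?case by (cases t) auto
next
  case (App f ss)
  from App.prems obtain ts where t: "t = App f ts" "length ss = length ts" by (cases t) auto
  have eq: "concat (map ser_tm ss) @ xs = concat (map ser_tm ts) @ ys" using App.prems t by simp
  \<comment> \<open>The induction runs over lists of equally many terms; keeping \<open>us\<close>
    inside \<open>ss\<close> makes the hypothesis on subterms applicable to each of its
    elements.\<close>
  have "us = vs \<and> xs = ys"
    if "length us = length vs" "set us \<subseteq> set ss"
      "concat (map ser_tm us) @ xs = concat (map ser_tm vs) @ ys" for us vs
    using that
  proof (induction us vs rule: list_induct2)
    case (Cons u us v vs)
    have "u = v \<and> concat (map ser_tm us) @ xs = concat (map ser_tm vs) @ ys"
      by (rule App.IH) (use Cons.prems in auto)
    then show ?case using Cons by auto
  qed simp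
  from this[OF t(2) _ eq] show ?case using t by simp
qed

lemma inj_ser_tm: "inj ser_tm"
  using ser_tm_append_inj[of _ "[]" _ "[]"] by (auto intro: injI)

lemma ser_tm_syms: "syms_tm t \<subseteq> F \<Longrightarrow> set (ser_tm t) \<subseteq> range Inl \<union> Inr ` (F \<times> UNIV)"
proof (induction t)
  case (App f ts)
  have "set (ser_tm t) \<subseteq> range Inl \<union> Inr ` (F \<times> UNIV)" if "t \<in> set ts" for t
    by (rule App.IH) (use that App.prems in auto)
  then show ?case using App.prems by auto
qed auto

lemma (in uncountable_cardinal) small_terms:
  assumes "small F" shows "small {t. syms_tm t \<subseteq> F}"
proof -
  let ?Z = "range (Inl :: nat \<Rightarrow> _) \<union> Inr ` (F \<times> (UNIV :: nat set))"
  have "small (lists ?Z)"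
    by (intro small_lists small_Un small_image small_Times small_nat assms)
  moreover have "|{t. syms_tm t \<subseteq> F}| \<le>o |lists ?Z|"
    by (rule card_of_ordLeqI[where f = ser_tm])
      (use inj_on_subset[OF inj_ser_tm subset_UNIV] ser_tm_syms[of _ F] in \<open>auto simp only: lists_eq_set\<close>)
  ultimately show ?thesis by (rule small_leq[rotated])
qed

text \<open>Coding formulas as terms over the logical and nonlogical symbols reduces counting them to counting terms.\<close>

fun tm_code :: "'f tm \<Rightarrow> (nat + 'f + 'r) tm" where
  "tm_code (Var n) = Var n"
| "tm_code (App f ts) = App (Inr (Inl f)) (map tm_code ts)"

fun fm_code :: "('f, 'r) fm \<Rightarrow> (nat + 'f + 'r) tm" where
  "fm_code (Eq s t) = App (Inl 0) [tm_code s, tm_code t]"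
| "fm_code (Rel r ts) = App (Inr (Inr r)) (map tm_code ts)"
| "fm_code (Neg \<phi>) = App (Inl 1) [fm_code \<phi>]"
| "fm_code (Conj \<phi> \<psi>) = App (Inl 2) [fm_code \<phi>, fm_code \<psi>]"
| "fm_code (Ex n \<phi>) = App (Inl 3) [Var n, fm_code \<phi>]"

lemma tm_code_inj: "tm_code s = tm_code t \<Longrightarrow> s = t"
proof (induction s arbitrary: t)
  case (Var n)
  then show ?case by (cases t) auto
next
  case (App f ss)
  from App.prems show ?case
    by (cases t) (auto intro: list.inj_map_strong[OF App.IH])
qed

lemma fm_code_inj: "fm_code \<phi> = fm_code \<psi> \<Longrightarrow> \<phi> = \<psi>"
proof (induction \<phi> arbitrary: \<psi>)
  case (Rel r ts)
  then show ?case by (cases \<psi>) (auto intro: list.inj_map_strong[OF tm_code_inj])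
next
  case (Eq s t)
  then show ?case by (cases \<psi>) (auto dest: tm_code_inj)
next
  case (Neg \<phi>)
  then show ?case by (cases \<psi>) auto
next
  case (Conj \<phi>1 \<phi>2)
  then show ?case by (cases \<psi>) auto
next
  case (Ex n \<phi>)
  then show ?case by (cases \<psi>) auto
qed

lemma syms_tm_code: "wf_tm L t \<Longrightarrow> syms_tm (tm_code t) \<subseteq> Inr ` Inl ` Funs L"
  by (induction t) auto

lemma syms_fm_code:
  "wf_fm L \<phi> \<Longrightarrow> syms_tm (fm_code \<phi>) \<subseteq> range Inl \<union> Inr ` (Inl ` Funs L \<union> Inr ` Rels L)"
proof (induction \<phi>)
  case (Eq s t)
  then show ?case using syms_tm_code[of L s] syms_tm_code[of L t] by auto
next
  case (Rel r ts)
  have "(\<Union>t\<in>set ts. syms_tm (tm_code t)) \<subseteq> Inr ` Inl ` Funs L"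
    by (rule UN_least, rule syms_tm_code) (use Rel in simp)
  then show ?case using Rel.prems by auto
qed auto

lemma (in uncountable_cardinal) small_formulas:
  assumes "small (Funs L)" "small (Rels L)" shows "small {\<phi>. wf_fm L \<phi>}"
proof -
  let ?F = "range (Inl :: nat \<Rightarrow> _) \<union> Inr ` (Inl ` Funs L \<union> Inr ` Rels L)"
  have "small {t. syms_tm t \<subseteq> ?F}"
    by (intro small_terms small_Un small_image small_nat assms)
  moreover have "|{\<phi>. wf_fm L \<phi>}| \<le>o |{t. syms_tm t \<subseteq> ?F}|"
    by (rule card_of_ordLeqI[where f = fm_code])
      (auto intro!: inj_onI fm_code_inj dest: syms_fm_code)
  ultimately show ?thesis by (rule small_leq[rotated])
qed

section \<open>Definable predicates and saturation\<close>

fun ren_tm :: "(nat \<Rightarrow> nat) \<Rightarrow> 'f tm \<Rightarrow> 'f tm" where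
  "ren_tm \<pi> (Var n) = Var (\<pi> n)"
| "ren_tm \<pi> (App f ts) = App f (map (ren_tm \<pi>) ts)"

fun ren :: "(nat \<Rightarrow> nat) \<Rightarrow> ('f, 'r) fm \<Rightarrow> ('f, 'r) fm" where
  "ren \<pi> (Eq s t) = Eq (ren_tm \<pi> s) (ren_tm \<pi> t)"
| "ren \<pi> (Rel r ts) = Rel r (map (ren_tm \<pi>) ts)"
| "ren \<pi> (Neg \<phi>) = Neg (ren \<pi> \<phi>)"
| "ren \<pi> (Conj \<phi> \<psi>) = Conj (ren \<pi> \<phi>) (ren \<pi> \<psi>)"
| "ren \<pi> (Ex n \<phi>) = Ex (\<pi> n) (ren \<pi> \<phi>)"

lemma tm_val_ren [simp]: "tm_val M v (ren_tm \<pi> t) = tm_val M (v \<circ> \<pi>) t"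
  by (induction t) (auto simp: comp_def cong: map_cong)

text \<open>Bound variables are renamed as well, so injectivity is what keeps an update at a bound
  variable from affecting any other variable.\<close>

lemma sat_ren [simp]: "inj \<pi> \<Longrightarrow> sat M v (ren \<pi> \<phi>) \<longleftrightarrow> sat M (v \<circ> \<pi>) \<phi>"
proof (induction \<phi> arbitrary: v)
  case (Ex n \<phi>)
  have "v(\<pi> n := d) \<circ> \<pi> = (v \<circ> \<pi>)(n := d)" for d
    using Ex.prems by (auto simp: fun_eq_iff inj_eq)
  then show ?case by (simp only: ren.simps sat.simps Ex.IH[OF Ex.prems])
qed (auto simp: comp_def)

lemma wf_ren_tm [simp]: "wf_tm L (ren_tm \<pi> t) = wf_tm L t"
  by (induction t) auto

lemma wf_ren [simp]: "wf_fm L (ren \<pi> \<phi>) = wf_fm L \<phi>"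
  by (induction \<phi>) auto

lemma fv_ren_tm [simp]: "fv_tm (ren_tm \<pi> t) = \<pi> ` fv_tm t"
  by (induction t) auto

lemma fv_ren [simp]: "inj \<pi> \<Longrightarrow> fv (ren \<pi> \<phi>) = \<pi> ` fv \<phi>"
  by (induction \<phi>) (auto simp: inj_eq)

lemma finite_fv_tm [simp]: "finite (fv_tm t)"
  by (induction t) auto

lemma finite_fv [simp]: "finite (fv \<phi>)"
  by (induction \<phi>) auto

lemma tm_val_cong: "(\<And>n. n \<in> fv_tm t \<Longrightarrow> v n = v' n) \<Longrightarrow> tm_val M v t = tm_val M v' t"
proof (induction t)
  case (App f ts)
  then have "map (tm_val M v) ts = map (tm_val M v') ts" by (intro map_cong) auto
  then show ?case by (metis tm_val.simps(2))
qed simp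

lemma sat_cong: "(\<And>n. n \<in> fv \<phi> \<Longrightarrow> v n = v' n) \<Longrightarrow> sat M v \<phi> \<longleftrightarrow> sat M v' \<phi>"
proof (induction \<phi> arbitrary: v v')
  case (Eq s t)
  then show ?case using tm_val_cong[of s v v' M] tm_val_cong[of t v v' M] by simp
next
  case (Rel r ts)
  then have "map (tm_val M v) ts = map (tm_val M v') ts" by (intro map_cong tm_val_cong) auto
  then show ?case by (metis sat.simps(2))
next
  case (Neg \<phi>)
  then have "sat M v \<phi> \<longleftrightarrow> sat M v' \<phi>" by (metis fv.simps(3))
  then show ?case by simp
next
  case (Conj \<phi> \<psi>)
  have "sat M v \<phi> \<longleftrightarrow> sat M v' \<phi>" by (rule Conj.IH) (use Conj.prems in simp)
  moreover have "sat M v \<psi> \<longleftrightarrow> sat M v' \<psi>" by (rule Conj.IH) (use Conj.prems in simp)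
  ultimately show ?case by simp
next
  case (Ex n \<phi>)
  have "sat M (v(n := d)) \<phi> \<longleftrightarrow> sat M (v'(n := d)) \<phi>" for d
    by (rule Ex.IH) (use Ex.prems in simp)
  then show ?case by simp
qed

text \<open>Substitution of variable \<open>0\<close> for the variables in \<open>ns\<close>, without any risk of capture.\<close>

definition identify :: "nat list \<Rightarrow> ('f, 'r) fm \<Rightarrow> ('f, 'r) fm" where
  "identify ns \<phi> = foldr (\<lambda>n \<psi>. Ex n (Conj (Eq (Var 0) (Var n)) \<psi>)) ns \<phi>"

text \<open>Each quantifier is pinned down by its equation with variable 0. Hence 0 must not itself
  be quantified, and its value must lie in the domain over which the quantifiers range.\<close>

lemma sat_identify:
  assumes "0 \<notin> set ns" "v 0 \<in> Dom M"
  shows "sat M v (identify ns \<phi>) \<longleftrightarrow> sat M (\<lambda>n. if n \<in> set ns then v 0 else v n) \<phi>"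
  using assms
proof (induction ns arbitrary: v)
  case (Cons n ns)
  have "sat M v (identify (n # ns) \<phi>) \<longleftrightarrow> sat M (v(n := v 0)) (identify ns \<phi>)"
    using Cons.prems by (auto simp: identify_def)
  also have "\<dots> \<longleftrightarrow> sat M (\<lambda>m. if m \<in> set (n # ns) then v 0 else v m) \<phi>"
    using Cons by (subst Cons.IH) (auto intro!: sat_cong)
  finally show ?case .
qed (simp add: identify_def)

lemma fv_identify: "fv (identify ns \<phi>) \<subseteq> insert 0 (fv \<phi> - set ns)"
  by (induction ns) (auto simp: identify_def)

lemma wf_identify [simp]: "wf_fm L (identify ns \<phi>) = wf_fm L \<phi>"
  by (induction ns) (auto simp: identify_def)

text \<open>Quantifiers and types refer to a single numbered variable, but \<open>w\<close> may name
  \<open>i\<close> by several variables or by none. Shifting all variables by one frees the number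
  0, which then replaces every variable named \<open>i\<close>.\<close>

lemma collect_variable:
  fixes w :: "nat \<Rightarrow> 'v"
  assumes "wf_fm L \<phi>"
  obtains \<phi>' and w' :: "nat \<Rightarrow> 'v" where "wf_fm L \<phi>'" "w' 0 = i" "w' ` (fv \<phi>' - {0}) \<subseteq> w ` fv \<phi> - {i}"
    "\<And>f. f i \<in> Dom M \<Longrightarrow> sat M (f \<circ> w') \<phi>' \<longleftrightarrow> sat M (f \<circ> w) \<phi>"
proof -
  obtain ns where ns: "set ns = Suc ` {n \<in> fv \<phi>. w n = i}"
    using finite_list[of "Suc ` {n \<in> fv \<phi>. w n = i}"] by auto
  have "sat M (f \<circ> case_nat i w) (identify ns (ren Suc \<phi>)) \<longleftrightarrow> sat M (f \<circ> w) \<phi>"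
    if "f i \<in> Dom M" for f
    using that ns by (subst sat_identify) (auto intro!: sat_cong)
  moreover have "case_nat i w ` (fv (identify ns (ren Suc \<phi>)) - {0}) \<subseteq> w ` fv \<phi> - {i}"
    using fv_identify[of ns "ren Suc \<phi>"] ns by fastforce
  ultimately show thesis using assms by (intro that[of "identify ns (ren Suc \<phi>)" "case_nat i w"]) auto
qed

text \<open>
  Truth of a formula under an assignment of an arbitrary type of variables; the variables in
  \<open>V\<close> are those allowed to occur.
\<close>

definition definable ::
    "('f, 'r) lang \<Rightarrow> ('f, 'r, 'm) struct \<Rightarrow> 'v set \<Rightarrow> (('v \<Rightarrow> 'm) \<Rightarrow> bool) set" where
  "definable L M V = {\<lambda>f. sat M (f \<circ> w) \<phi> | \<phi> w. wf_fm L \<phi> \<and> w ` fv \<phi> \<subseteq> V}"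

lemma definableI: "wf_fm L \<phi> \<Longrightarrow> w ` fv \<phi> \<subseteq> V \<Longrightarrow> (\<lambda>f. sat M (f \<circ> w) \<phi>) \<in> definable L M V"
  unfolding definable_def by blast

lemma definableE:
  assumes "P \<in> definable L M V"
  obtains \<phi> w where "wf_fm L \<phi>" "w ` fv \<phi> \<subseteq> V" "\<And>f. P f \<longleftrightarrow> sat M (f \<circ> w) \<phi>"
  using assms unfolding definable_def by blast

lemma definable_mono: "P \<in> definable L M V \<Longrightarrow> V \<subseteq> W \<Longrightarrow> P \<in> definable L M W"
  unfolding definable_def by blast

lemma definable_cong:
  assumes "P \<in> definable L M V" "\<And>v. v \<in> V \<Longrightarrow> f v = g v"
  shows "P f \<longleftrightarrow> P g"
proof -
  obtain \<phi> w where \<phi>: "w ` fv \<phi> \<subseteq> V" "\<And>f. P f \<longleftrightarrow> sat M (f \<circ> w) \<phi>"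
    using assms(1) by (elim definableE) blast
  show ?thesis unfolding \<phi> using \<phi>(1) assms(2) by (intro sat_cong) auto
qed

lemma definable_finite_support:
  assumes "P \<in> definable L M V"
  obtains V0 where "finite V0" "V0 \<subseteq> V" "P \<in> definable L M V0"
proof -
  obtain \<phi> w where "wf_fm L \<phi>" "w ` fv \<phi> \<subseteq> V" "P = (\<lambda>f. sat M (f \<circ> w) \<phi>)"
    using assms unfolding definable_def by blast
  then show thesis by (intro that[of "w ` fv \<phi>"]) (auto intro: definableI)
qed

lemma definable_not:
  assumes "P \<in> definable L M V" shows "(\<lambda>f. \<not> P f) \<in> definable L M V"
proof -
  obtain \<phi> w where \<phi>: "wf_fm L \<phi>" "w ` fv \<phi> \<subseteq> V" "\<And>f. P f \<longleftrightarrow> sat M (f \<circ> w) \<phi>"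
    using assms by (elim definableE) blast
  show ?thesis unfolding \<phi>(3) using definableI[of L "Neg \<phi>" w V M] \<phi>(1,2) by simp
qed

lemma definable_conj:
  assumes "P \<in> definable L M V" "Q \<in> definable L M V"
  shows "(\<lambda>f. P f \<and> Q f) \<in> definable L M V"
proof -
  obtain \<phi> w where \<phi>: "wf_fm L \<phi>" "w ` fv \<phi> \<subseteq> V" "\<And>f. P f \<longleftrightarrow> sat M (f \<circ> w) \<phi>"
    using assms(1) by (elim definableE) blast
  obtain \<psi> u where \<psi>: "wf_fm L \<psi>" "u ` fv \<psi> \<subseteq> V" "\<And>f. Q f \<longleftrightarrow> sat M (f \<circ> u) \<psi>"
    using assms(2) by (elim definableE) blast
  \<comment> \<open>The two formulas may use one variable for different things; even and odd numbers
    keep them apart.\<close>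
  define wu where "wu n = (if even n then w (n div 2) else u (n div 2))" for n
  have inj: "inj (\<lambda>n. 2 * n :: nat)" "inj (\<lambda>n. Suc (2 * n))" by (auto intro: injI)
  let ?\<chi> = "Conj (ren (\<lambda>n. 2 * n) \<phi>) (ren (\<lambda>n. Suc (2 * n)) \<psi>)"
  have "(\<lambda>f. sat M (f \<circ> wu) ?\<chi>) \<in> definable L M V"
    using \<phi> \<psi> inj by (intro definableI) (auto simp: wu_def)
  also have "(\<lambda>f. sat M (f \<circ> wu) ?\<chi>) = (\<lambda>f. P f \<and> Q f)"
    using inj by (auto simp: wu_def comp_def \<phi>(3) \<psi>(3))
  finally show ?thesis .
qed

text \<open>There is no formula constant for truth, and the closed formula used instead asserts that
  the domain is inhabited.\<close>

lemma definable_True: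
  assumes "Dom M \<noteq> {}" shows "(\<lambda>f. True) \<in> definable L M V"
  using definableI[of L "Ex 0 (Eq (Var 0) (Var 0))" undefined V M] assms by (auto simp: ex_in_conv)

lemma definable_Ball:
  assumes "Dom M \<noteq> {}" "finite F" "F \<subseteq> definable L M V"
  shows "(\<lambda>f. \<forall>P\<in>F. P f) \<in> definable L M V"
  using assms(2,3)
proof (induction F)
  case (insert P F)
  then show ?case using definable_conj[of P L M V "\<lambda>f. \<forall>P\<in>F. P f"] by simp
qed (simp add: definable_True[OF assms(1)])

text \<open>The map \<open>h\<close> may merge variables or send them to names of parameters; it is
  the device by which variables become parameters later on.\<close>

lemma definable_subst:
  assumes "P \<in> definable L M V" shows "(\<lambda>f. P (f \<circ> h)) \<in> definable L M (h ` V)"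
proof -
  obtain \<phi> w where \<phi>: "wf_fm L \<phi>" "w ` fv \<phi> \<subseteq> V" "\<And>f. P f \<longleftrightarrow> sat M (f \<circ> w) \<phi>"
    using assms by (elim definableE) blast
  show ?thesis unfolding \<phi>(3) comp_assoc using \<phi>(1,2) by (intro definableI) auto
qed

lemma definable_eq: "(\<lambda>f. f i = f j) \<in> definable L M {i, j}"
  using definableI[of L "Eq (Var 0) (Var 1)" "case_nat i (\<lambda>_. j)" "{i, j}" M] by simp

lemma definable_Bex:
  assumes "P \<in> definable L M V"
  shows "(\<lambda>f. \<exists>d\<in>Dom M. P (f(i := d))) \<in> definable L M (V - {i})"
proof -
  obtain \<phi> w where \<phi>: "wf_fm L \<phi>" "w ` fv \<phi> \<subseteq> V" "\<And>f. P f \<longleftrightarrow> sat M (f \<circ> w) \<phi>"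
    using assms by (elim definableE) blast
  obtain \<phi>' w' where \<phi>': "wf_fm L \<phi>'" "w' 0 = i" "w' ` (fv \<phi>' - {0}) \<subseteq> w ` fv \<phi> - {i}"
    "\<And>f. f i \<in> Dom M \<Longrightarrow> sat M (f \<circ> w') \<phi>' \<longleftrightarrow> sat M (f \<circ> w) \<phi>"
    using collect_variable[OF \<phi>(1)] by metis
  have "P (f(i := d)) \<longleftrightarrow> sat M ((f \<circ> w')(0 := d)) \<phi>'" if "d \<in> Dom M" for f d
  proof -
    have "P (f(i := d)) \<longleftrightarrow> sat M (f(i := d) \<circ> w') \<phi>'"
      using \<phi>(3) \<phi>'(4)[of "f(i := d)"] that by simp
    also have "\<dots> \<longleftrightarrow> sat M ((f \<circ> w')(0 := d)) \<phi>'"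
      using \<phi>'(2,3) by (intro sat_cong) auto
    finally show ?thesis .
  qed
  then have "(\<lambda>f. \<exists>d\<in>Dom M. P (f(i := d))) = (\<lambda>f. sat M (f \<circ> w') (Ex 0 \<phi>'))" by auto
  then show ?thesis using definableI[of L "Ex 0 \<phi>'" w' "V - {i}" M] \<phi>'(1,3) \<phi>(2) by auto
qed

lemma definable_Ex_finite:
  assumes "finite X" "P \<in> definable L M V"
  shows "(\<lambda>f. \<exists>h. h ` X \<subseteq> Dom M \<and> P (override_on f h X)) \<in> definable L M (V - X)"
  using assms
proof (induction X arbitrary: P V)
  case (insert x X)
  have "(\<exists>h. h ` X \<subseteq> Dom M \<and> (\<exists>d\<in>Dom M. P ((override_on f h X)(x := d)))) \<longleftrightarrow>
      (\<exists>h. h ` insert x X \<subseteq> Dom M \<and> P (override_on f h (insert x X)))" for f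
  proof safe
    fix h d assume h: "h ` X \<subseteq> Dom M" "d \<in> Dom M" "P ((override_on f h X)(x := d))"
    have "(override_on f h X)(x := d) = override_on f (h(x := d)) (insert x X)"
      by (auto simp: override_on_def)
    moreover have "(h(x := d)) ` insert x X \<subseteq> Dom M" using h by auto
    ultimately show "\<exists>h. h ` insert x X \<subseteq> Dom M \<and> P (override_on f h (insert x X))"
      using h(3) by metis
  next
    fix h assume h: "h ` insert x X \<subseteq> Dom M" "P (override_on f h (insert x X))"
    have "(override_on f h X)(x := h x) = override_on f h (insert x X)"
      by (auto simp: override_on_def)
    then show "\<exists>h. h ` X \<subseteq> Dom M \<and> (\<exists>d\<in>Dom M. P ((override_on f h X)(x := d)))"
      using h by (metis image_subset_iff insert_iff)
  qed
  moreover have "V - {x} - X = V - insert x X" by auto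
  ultimately show ?case using insert.IH[OF definable_Bex[OF insert.prems, of x]] by (simp only:)
qed (simp add: override_on_def)

text \<open>Saturation in terms of predicates instead of numbered formulas: \<open>None\<close> is
  the variable of the type and \<open>Some m\<close> names the parameter m.\<close>

lemma saturated_definable:
  assumes "saturated L \<kappa> M" "A \<subseteq> Dom M" "|A| <o \<kappa>"
    and p: "p \<subseteq> definable L M (insert None (Some ` A))"
    and fin: "\<And>q. finite q \<Longrightarrow> q \<subseteq> p \<Longrightarrow> \<exists>d\<in>Dom M. \<forall>P\<in>q. P (case_option d id)"
  shows "\<exists>d\<in>Dom M. \<forall>P\<in>p. P (case_option d id)"
proof -
  have "\<exists>\<phi> v. wf_fm L \<phi> \<and> v ` (fv \<phi> - {0}) \<subseteq> A \<and>
      (\<forall>d\<in>Dom M. sat M (v(0 := d)) \<phi> \<longleftrightarrow> P (case_option d id))" if P: "P \<in> p" for P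
  proof -
    obtain \<phi> w where \<phi>: "wf_fm L \<phi>" "w ` fv \<phi> \<subseteq> insert None (Some ` A)"
      "\<And>f. P f \<longleftrightarrow> sat M (f \<circ> w) \<phi>"
      using subsetD[OF p P] by (elim definableE) metis
    obtain \<phi>' w' where \<phi>': "wf_fm L \<phi>'" "w' 0 = None" "w' ` (fv \<phi>' - {0}) \<subseteq> w ` fv \<phi> - {None}"
      "\<And>f. f None \<in> Dom M \<Longrightarrow> sat M (f \<circ> w') \<phi>' \<longleftrightarrow> sat M (f \<circ> w) \<phi>"
      using collect_variable[OF \<phi>(1)] by metis
    have sub: "w' ` (fv \<phi>' - {0}) \<subseteq> Some ` A" using \<phi>(2) \<phi>'(3) by blast
    have "sat M ((the \<circ> w')(0 := d)) \<phi>' \<longleftrightarrow> P (case_option d id)" if "d \<in> Dom M" for d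
    proof -
      have "P (case_option d id) \<longleftrightarrow> sat M (case_option d id \<circ> w') \<phi>'"
        using \<phi>(3) \<phi>'(4)[of "case_option d id"] that by simp
      also have "\<dots> \<longleftrightarrow> sat M ((the \<circ> w')(0 := d)) \<phi>'"
        using \<phi>'(2) sub by (intro sat_cong) (auto split: option.split)
      finally show ?thesis by simp
    qed
    moreover have "(the \<circ> w') ` (fv \<phi>' - {0}) \<subseteq> A" using sub by fastforce
    ultimately show ?thesis using \<phi>'(1) by blast
  qed
  then obtain \<Phi> V where \<Phi>: "\<And>P. P \<in> p \<Longrightarrow> wf_fm L (\<Phi> P)" "\<And>P. P \<in> p \<Longrightarrow> V P ` (fv (\<Phi> P) - {0}) \<subseteq> A"
    "\<And>P d. P \<in> p \<Longrightarrow> d \<in> Dom M \<Longrightarrow> sat M ((V P)(0 := d)) (\<Phi> P) \<longleftrightarrow> P (case_option d id)"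
    by metis
  let ?p = "(\<lambda>P. (\<Phi> P, V P)) ` p"
  have finp: "\<exists>d\<in>Dom M. \<forall>(\<phi>, v)\<in>q. sat M (v(0 := d)) \<phi>" if q: "q \<subseteq> ?p" "finite q" for q
  proof -
    obtain q' where q': "q' \<subseteq> p" "finite q'" "q = (\<lambda>P. (\<Phi> P, V P)) ` q'"
      using finite_subset_image[OF q(2,1)] by blast
    then show ?thesis using fin[of q'] \<Phi>(3) by (auto simp: subset_iff)
  qed
  have "?p \<subseteq> {(\<phi>, v). wf_fm L \<phi> \<and> v ` (fv \<phi> - {0}) \<subseteq> A}" using \<Phi>(1,2) by auto
  then have "\<exists>d\<in>Dom M. \<forall>(\<phi>, v)\<in>?p. sat M (v(0 := d)) \<phi>"
    by (intro assms(1)[unfolded saturated_def, THEN spec, THEN spec, THEN mp, of A ?p]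
        conjI allI impI assms(2,3)) (use finp in simp_all)
  then show ?thesis using \<Phi>(3) by auto
qed

text \<open>The tuple is found one coordinate at a time by Zorn's lemma. A partial choice stays
  extendible because the formula saying that the remaining coordinates can be completed has only one
  variable, and saturation realises all such formulas at once. Here \<open>Inl m\<close> names a
  parameter and \<open>Inr i\<close> is a variable.\<close>

lemma saturated_tuple:
  fixes I :: "'k set" and M :: "('f, 'r, 'm) struct"
  assumes "uncountable_cardinal \<kappa>" "saturated L \<kappa> M" "Dom M \<noteq> {}"
    and B: "B \<subseteq> Dom M" "|B| <o \<kappa>" "|I| <o \<kappa>"
    and \<Gamma>: "\<Gamma> \<subseteq> definable L M (Inl ` B \<union> Inr ` I)"
    and fin: "\<And>F. finite F \<Longrightarrow> F \<subseteq> \<Gamma> \<Longrightarrow> \<exists>g. g ` I \<subseteq> Dom M \<and> (\<forall>P\<in>F. P (case_sum id g))"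
  shows "\<exists>g. g ` I \<subseteq> Dom M \<and> (\<forall>P\<in>\<Gamma>. P (case_sum id g))"
proof -
  interpret uncountable_cardinal \<kappa> by fact
  define extends where "extends s F g \<longleftrightarrow>
    g ` I \<subseteq> Dom M \<and> (\<forall>(j, m)\<in>s. g j = m) \<and> (\<forall>P\<in>F. P (case_sum id g))" for s F g
  have extendsD: "extends s F g \<Longrightarrow> g ` I \<subseteq> Dom M" "extends s F g \<Longrightarrow> (j, m) \<in> s \<Longrightarrow> g j = m"
    "extends s F g \<Longrightarrow> P \<in> F \<Longrightarrow> P (case_sum id g)" for s F g j m P
    by (simp add: extends_def, auto simp: extends_def)
  have extendsI: "g ` I \<subseteq> Dom M \<Longrightarrow> (\<And>j m. (j, m) \<in> s \<Longrightarrow> g j = m) \<Longrightarrow>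
      (\<And>P. P \<in> F \<Longrightarrow> P (case_sum id g)) \<Longrightarrow> extends s F g" for s F g
    by (auto simp: extends_def)
  \<comment> \<open>Only finite parts of \<open>r\<close> and of the type are tested, so that the
    property passes to unions of chains.\<close>
  define good where "good r \<longleftrightarrow>
    (\<forall>F s. finite F \<and> F \<subseteq> \<Gamma> \<and> finite s \<and> s \<subseteq> r \<longrightarrow> (\<exists>g. extends s F g))" for r
  let ?A = "{r. r \<subseteq> I \<times> Dom M \<and> good r}"
  have "\<exists>r\<in>?A. \<forall>r'\<in>?A. r \<subseteq> r' \<longrightarrow> r' = r"
  proof (rule subset_Zorn_nonempty)
    have "{} \<in> ?A" using fin by (auto simp: good_def extends_def)
    then show "?A \<noteq> {}" by blast
  next
    fix C assume C: "C \<noteq> {}" "subset.chain ?A C"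
    have "good (\<Union>C)"
      unfolding good_def
    proof (intro allI impI, elim conjE)
      fix F s assume F: "finite F" "F \<subseteq> \<Gamma>" "finite s" "s \<subseteq> \<Union>C"
      obtain r where "r \<in> C" "s \<subseteq> r"
        using finite_subset_Union_chain[OF F(3,4) C] .
      moreover have "good r" using C(2) \<open>r \<in> C\<close> by (auto simp: subset.chain_def)
      ultimately show "\<exists>g. extends s F g" using F unfolding good_def by blast
    qed
    then show "\<Union>C \<in> ?A" using C(2) by (auto simp: subset.chain_def)
  qed
  then obtain r where "r \<in> ?A" and mx: "\<forall>r'\<in>?A. r \<subseteq> r' \<longrightarrow> r' = r" by (rule bexE)
  then have r: "r \<subseteq> I \<times> Dom M" "good r" by simp_all
  have max: "r' = r" if "r' \<subseteq> I \<times> Dom M" "good r'" "r \<subseteq> r'" for r' using mx that by simp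
  \<comment> \<open>Two values at one index form a finite part of \<open>r\<close>, which has a
    common extension by goodness.\<close>
  have fun_r: "m = m'" if "(j, m) \<in> r" "(j, m') \<in> r" for j m m'
  proof -
    have "\<exists>g. extends {(j, m), (j, m')} {} g"
      by (rule r(2)[unfolded good_def, rule_format]) (use that in auto)
    then show ?thesis by (auto simp: extends_def)
  qed
  have total: "i \<in> fst ` r" if "i \<in> I" for i
  proof (rule ccontr)
    assume i: "i \<notin> fst ` r"
    \<comment> \<open>The values chosen so far become parameters. They are few because
      \<open>r\<close> is the graph of a partial function on \<open>I\<close>.\<close>
    define A where "A = B \<union> snd ` r"
    have "small (snd ` r)"
    proof -
      have "r \<subseteq> (\<lambda>j. (j, THE m. (j, m) \<in> r)) ` I"
      proof
        fix x assume x: "x \<in> r"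
        obtain j m where jm: "x = (j, m)" by (cases x)
        have "(THE m. (j, m) \<in> r) = m" by (rule the_equality) (use fun_r x jm in blast)+
        then show "x \<in> (\<lambda>j. (j, THE m. (j, m) \<in> r)) ` I" using r(1) x jm by auto
      qed
      then show ?thesis by (intro small_image small_subset[OF _ small_image[OF B(3)]])
    qed
    then have A: "small A" "A \<subseteq> Dom M" using B r(1) by (auto simp: A_def intro: small_Un)
    let ?D = "definable L M (insert None (Some ` A))"
    define meaning where "meaning Q F s \<longleftrightarrow>
      (\<forall>d\<in>Dom M. Q (case_option d id) \<longleftrightarrow> (\<exists>g. extends s F g \<and> g i = d))" for Q F s
    \<comment> \<open>That d is a possible value at \<open>i\<close>, given \<open>F\<close> and
      \<open>s\<close>, is a first-order condition on d: finitely many variables occur in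
      \<open>F\<close>, those in \<open>X\<close> are quantified, and those fixed by
      \<open>s\<close> are replaced by their values.\<close>
    have ex_Q: "\<exists>Q\<in>?D. meaning Q F s" if F: "finite F" "F \<subseteq> \<Gamma>" "finite s" "s \<subseteq> r" for F s
    proof -
      define R :: "('m + 'k \<Rightarrow> 'm) \<Rightarrow> bool" where "R f \<longleftrightarrow> (\<forall>P\<in>F. P f)" for f
      have "R \<in> definable L M (Inl ` B \<union> Inr ` I)"
        unfolding R_def by (rule definable_Ball[OF assms(3) F(1) subset_trans[OF F(2) \<Gamma>]])
      then obtain V where V: "finite V" "V \<subseteq> Inl ` B \<union> Inr ` I" "R \<in> definable L M V"
        by (rule definable_finite_support)
      define X :: "('m + 'k) set" where "X = {Inr j |j. Inr j \<in> V \<and> j \<notin> fst ` s \<and> j \<noteq> i}"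
      have X: "finite X" using finite_subset[OF _ V(1), of X] by (auto simp: X_def)
      let ?P1 = "\<lambda>f. \<exists>h. h ` X \<subseteq> Dom M \<and> R (override_on f h X)"
      define val where "val j = (THE m. (j, m) \<in> s)" for j
      have val: "(j, m) \<in> s \<Longrightarrow> val j = m" for j m
        unfolding val_def by (rule the_equality) (use fun_r F(4) in blast)+
      have val_in: "val j \<in> Dom M" "j \<noteq> i" "val j \<in> snd ` r" if j: "j \<in> fst ` s" for j
      proof -
        obtain m where "(j, m) \<in> s" using j by auto
        then have "(j, val j) \<in> r" using val F(4) by auto
        then show "val j \<in> Dom M" "val j \<in> snd ` r" using r(1) by (blast, metis image_eqI snd_conv)
        show "j \<noteq> i" using \<open>(j, val j) \<in> r\<close> i by (metis image_eqI fst_conv)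
      qed
      \<comment> \<open>Coordinate \<open>i\<close> becomes the variable of the type and the
        coordinates in the domain of \<open>s\<close> become parameters; what happens to the
        quantified ones is immaterial.\<close>
      define \<rho> where "\<rho> = case_sum Some (\<lambda>j. if j = i then None else Some (val j))"
      have "(\<lambda>f. ?P1 (f \<circ> \<rho>)) \<in> definable L M (\<rho> ` (V - X))"
        by (rule definable_subst[OF definable_Ex_finite[OF X V(3)]])
      moreover have "\<rho> ` (V - X) \<subseteq> insert None (Some ` A)"
      proof
        fix y assume "y \<in> \<rho> ` (V - X)"
        then obtain v where v: "v \<in> V" "v \<notin> X" "y = \<rho> v" by blast
        show "y \<in> insert None (Some ` A)"
        proof (cases v)
          case (Inl b)
          then show ?thesis using v V(2) by (auto simp: \<rho>_def A_def)
        next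
          case (Inr j)
          then have "j = i \<or> j \<in> fst ` s" using v by (auto simp: X_def)
          then show ?thesis using v(3) Inr val_in(3)[of j] by (cases "j = i") (simp_all add: \<rho>_def A_def)
        qed
      qed
      ultimately have Q: "(\<lambda>f. ?P1 (f \<circ> \<rho>)) \<in> ?D" by (rule definable_mono)
      have "meaning (\<lambda>f. ?P1 (f \<circ> \<rho>)) F s"
        unfolding meaning_def
      proof (intro ballI iffI)
        fix d assume d: "d \<in> Dom M" and ex: "?P1 (case_option d id \<circ> \<rho>)"
        from ex obtain h where h: "h ` X \<subseteq> Dom M \<and> R (override_on (case_option d id \<circ> \<rho>) h X)" by (rule exE)
        \<comment> \<open>Outside the finite support any element of the domain will do, and
          \<open>d\<close> is one.\<close>
        define g where "g j = (if j = i then d else if j \<in> fst ` s then val j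
          else if Inr j \<in> X then h (Inr j) else d)" for j
        have "extends s F g"
          unfolding extends_def
        proof (intro conjI)
          have "g j \<in> Dom M" for j using d h val_in(1) by (auto simp: g_def)
          then show "g ` I \<subseteq> Dom M" by blast
          have "g j = m" if "(j, m) \<in> s" for j m
          proof -
            have "j \<in> fst ` s" using that by force
            then show ?thesis using val[OF that] val_in(2) by (simp add: g_def)
          qed
          then show "\<forall>(j, m)\<in>s. g j = m" by blast
          have "R (case_sum id g) \<longleftrightarrow> R (override_on (case_option d id \<circ> \<rho>) h X)"
            by (rule definable_cong[OF V(3)])
              (auto simp: override_on_def \<rho>_def g_def X_def split: sum.split)
          then have "R (case_sum id g)" using h by blast
          then show "\<forall>P\<in>F. P (case_sum id g)" by (simp only: R_def)
        qed
        moreover have "g i = d" by (simp add: g_def)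
        ultimately show "\<exists>g. extends s F g \<and> g i = d" by blast
      next
        fix d assume "\<exists>g. extends s F g \<and> g i = d"
        then obtain g where g: "extends s F g" "g i = d" by blast
        have "R (case_sum id g) \<longleftrightarrow> R (override_on (case_option d id \<circ> \<rho>) (case_sum id g) X)"
        proof (rule definable_cong[OF V(3)])
          fix v assume v: "v \<in> V"
          show "case_sum id g v = override_on (case_option d id \<circ> \<rho>) (case_sum id g) X v"
          proof (cases v)
            case (Inr j)
            have "g j = val j" if "j \<in> fst ` s"
              using that val g(1) by (auto simp: extends_def)
            then show ?thesis using Inr v g(2) val_in(2)[of j]
              by (cases "j \<in> fst ` s"; simp add: override_on_def \<rho>_def X_def)
          qed (auto simp: override_on_def \<rho>_def X_def)
        qed
        moreover have "R (case_sum id g)" using g(1) unfolding extends_def R_def by blast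
        ultimately have "R (override_on (case_option d id \<circ> \<rho>) (case_sum id g) X)" by blast
        moreover have "case_sum id g v \<in> Dom M" if v: "v \<in> X" for v
        proof -
          obtain j where "v = Inr j" "Inr j \<in> V" using v by (auto simp: X_def)
          moreover from this have "j \<in> I" using V(2) by blast
          ultimately show ?thesis using g(1) by (auto simp: extends_def)
        qed
        ultimately show "?P1 (case_option d id \<circ> \<rho>)" by (intro exI[of _ "case_sum id g"] conjI image_subsetI)
      qed
      with Q show ?thesis by blast
    qed
    let ?p = "{Q \<in> ?D. \<exists>F s. finite F \<and> F \<subseteq> \<Gamma> \<and> finite s \<and> s \<subseteq> r \<and> meaning Q F s}"
    have "\<exists>d\<in>Dom M. \<forall>Q\<in>?p. Q (case_option d id)"
    proof (rule saturated_definable[OF assms(2) A(2,1)])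
      fix q assume q: "finite q" "q \<subseteq> ?p"
      then have "\<forall>Q\<in>q. \<exists>F s. finite F \<and> F \<subseteq> \<Gamma> \<and> finite s \<and> s \<subseteq> r \<and> meaning Q F s" by blast
      then obtain F s where Fs: "\<And>Q. Q \<in> q \<Longrightarrow> finite (F Q) \<and> F Q \<subseteq> \<Gamma> \<and> finite (s Q) \<and> s Q \<subseteq> r \<and> meaning Q (F Q) (s Q)"
        by metis
      have "finite (\<Union>Q\<in>q. F Q)" "finite (\<Union>Q\<in>q. s Q)" using Fs q(1) by simp_all
      moreover have "(\<Union>Q\<in>q. F Q) \<subseteq> \<Gamma>" "(\<Union>Q\<in>q. s Q) \<subseteq> r" using Fs by blast+
      ultimately have "\<exists>g. extends (\<Union>Q\<in>q. s Q) (\<Union>Q\<in>q. F Q) g"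
        using r(2) unfolding good_def by simp
      then obtain g where g: "extends (\<Union>Q\<in>q. s Q) (\<Union>Q\<in>q. F Q) g" by blast
      then have "g i \<in> Dom M" using \<open>i \<in> I\<close> by (auto simp: extends_def)
      moreover have "Q (case_option (g i) id)" if "Q \<in> q" for Q
      proof -
        have "extends (s Q) (F Q) g" using g that by (force simp: extends_def)
        moreover have "meaning Q (F Q) (s Q)" using Fs[OF that] by simp
        ultimately show ?thesis using \<open>g i \<in> Dom M\<close> by (auto simp: meaning_def)
      qed
      ultimately show "\<exists>d\<in>Dom M. \<forall>Q\<in>q. Q (case_option d id)" by (intro bexI[of _ "g i"] ballI)
    qed simp
    then obtain d where d: "d \<in> Dom M" and all: "\<forall>Q\<in>?p. Q (case_option d id)" by (rule bexE)
    \<comment> \<open>As \<open>d\<close> satisfies the condition belonging to each \<open>F\<close>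
      and \<open>s\<close>, a completion with value \<open>d\<close> at \<open>i\<close> always
      exists; this contradicts maximality of \<open>r\<close>.\<close>
    have "good (insert (i, d) r)"
      unfolding good_def
    proof (intro allI impI, elim conjE)
      fix F s assume F: "finite F" "F \<subseteq> \<Gamma>" "finite s" "s \<subseteq> insert (i, d) r"
      then have s: "finite (s - {(i, d)})" "s - {(i, d)} \<subseteq> r" by auto
      obtain Q where Q: "Q \<in> ?D" "meaning Q F (s - {(i, d)})" using ex_Q[OF F(1,2) s] by (rule bexE)
      have "Q \<in> ?p"
        using Q F(1,2) s by (intro CollectI conjI exI[of _ F] exI[of _ "s - {(i, d)}"])
      with all have "Q (case_option d id)" by (rule bspec)
      then have "\<exists>g. extends (s - {(i, d)}) F g \<and> g i = d"
        using d Q(2) by (simp add: meaning_def)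
      then obtain g where g: "extends (s - {(i, d)}) F g" "g i = d" by blast
      have "g j = m" if "(j, m) \<in> s" for j m
      proof (cases "(j, m) = (i, d)")
        case True
        then show ?thesis using g(2) by simp
      next
        case False
        then have "(j, m) \<in> s - {(i, d)}" using that by simp
        then show ?thesis by (rule extendsD(2)[OF g(1)])
      qed
      then have "extends s F g" using extendsD(1,3)[OF g(1)] by (intro extendsI)
      then show "\<exists>g. extends s F g" by (rule exI[of "extends s F"])
    qed
    then have "insert (i, d) r = r" using r(1) d \<open>i \<in> I\<close> by (intro max) auto
    then have "(i, d) \<in> r" by blast
    then show False using i by (metis image_eqI fst_conv)
  qed
  define g where "g j = (THE m. (j, m) \<in> r)" for j
  have g: "(j, m) \<in> r \<Longrightarrow> g j = m" for j m unfolding g_def by (rule the_equality) (use fun_r in blast)+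
  have g_in: "(j, g j) \<in> r" if j: "j \<in> I" for j
  proof -
    obtain m where "(j, m) \<in> r" using total[OF j] by auto
    then show ?thesis using g by simp
  qed
  then have "g ` I \<subseteq> Dom M" using r(1) by blast
  moreover have "P (case_sum id g)" if P: "P \<in> \<Gamma>" for P
  proof -
    obtain V where V: "finite V" "V \<subseteq> Inl ` B \<union> Inr ` I" "P \<in> definable L M V"
      by (rule definable_finite_support[OF subsetD[OF \<Gamma> P]])
    let ?s = "{(j, g j) |j. Inr j \<in> V}"
    have "?s = (\<lambda>j. (j, g j)) ` (Inr -` V)" by auto
    then have "finite ?s" using V(1) by (simp add: finite_vimageI)
    moreover have "?s \<subseteq> r" using V(2) g_in by auto
    ultimately have "\<exists>g'. extends ?s {P} g'" using r(2) P unfolding good_def by simp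
    then obtain g' where g': "extends ?s {P} g'" ..
    have "P (case_sum id g) \<longleftrightarrow> P (case_sum id g')"
    proof (rule definable_cong[OF V(3)])
      fix v assume "v \<in> V"
      then show "case_sum id g v = case_sum id g' v"
        using g' by (cases v) (auto simp: extends_def)
    qed
    then show ?thesis using g' by (simp add: extends_def)
  qed
  ultimately show ?thesis by blast
qed

section \<open>Elementary submodels and coheirs\<close>

lemma tm_val_in_Dom:
  "is_struct L M \<Longrightarrow> wf_tm L t \<Longrightarrow> v ` fv_tm t \<subseteq> Dom M \<Longrightarrow> tm_val M v t \<in> Dom M"
proof (induction t)
  case (App f ts)
  have "set (map (tm_val M v) ts) \<subseteq> Dom M"
  proof
    fix y assume "y \<in> set (map (tm_val M v) ts)"
    then obtain t where "t \<in> set ts" "y = tm_val M v t" by auto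
    then show "y \<in> Dom M" using App.IH[of t] App.prems by auto
  qed
  then show ?case using App.prems by (simp add: is_struct_def)
qed auto

text \<open>Two structures are kept apart so that this covers an automorphism of the whole model as
  well as its restriction to a submodel and the image of that submodel.\<close>

definition is_iso :: "('f, 'r) lang \<Rightarrow> ('m \<Rightarrow> 'n) \<Rightarrow> ('f, 'r, 'm) struct \<Rightarrow> ('f, 'r, 'n) struct \<Rightarrow> bool" where
  "is_iso L h A B \<longleftrightarrow> bij_betw h (Dom A) (Dom B) \<and>
     (\<forall>f\<in>Funs L. \<forall>xs. length xs = farity L f \<and> set xs \<subseteq> Dom A \<longrightarrow>
        h (FunI A f xs) = FunI B f (map h xs)) \<and>
     (\<forall>r\<in>Rels L. \<forall>xs. length xs = rarity L r \<and> set xs \<subseteq> Dom A \<longrightarrow>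
        (RelI B r (map h xs) \<longleftrightarrow> RelI A r xs))"

lemma tm_val_iso:
  assumes "is_iso L h A B" "is_struct L A"
  shows "wf_tm L t \<Longrightarrow> v ` fv_tm t \<subseteq> Dom A \<Longrightarrow> tm_val B (h \<circ> v) t = h (tm_val A v t)"
proof (induction t)
  case (App f ts)
  have ts: "wf_tm L t" "v ` fv_tm t \<subseteq> Dom A" if t: "t \<in> set ts" for t
    using App.prems t by auto
  have "tm_val B (h \<circ> v) t = (h \<circ> tm_val A v) t" if t: "t \<in> set ts" for t
    using App.IH[OF t ts[OF t]] by (simp add: comp_def)
  then have "map (tm_val B (h \<circ> v)) ts = map (h \<circ> tm_val A v) ts" by (rule map_cong[OF refl])
  moreover have "set (map (tm_val A v) ts) \<subseteq> Dom A"
    using tm_val_in_Dom[OF assms(2)] ts by auto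
  moreover have "f \<in> Funs L" "length (map (tm_val A v) ts) = farity L f" using App.prems by auto
  ultimately show ?case using assms(1) unfolding is_iso_def
    by (metis map_map tm_val.simps(2))
qed simp

lemma sat_iso:
  assumes h: "is_iso L h A B" and A: "is_struct L A"
  shows "wf_fm L \<phi> \<Longrightarrow> v ` fv \<phi> \<subseteq> Dom A \<Longrightarrow> sat B (h \<circ> v) \<phi> \<longleftrightarrow> sat A v \<phi>"
proof (induction \<phi> arbitrary: v)
  case (Eq s t)
  have "inj_on h (Dom A)" using h by (simp add: is_iso_def bij_betw_def)
  moreover have "tm_val A v s \<in> Dom A" "tm_val A v t \<in> Dom A"
    using Eq by (auto intro!: tm_val_in_Dom[OF A])
  moreover have "tm_val B (h \<circ> v) s = h (tm_val A v s)" "tm_val B (h \<circ> v) t = h (tm_val A v t)"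
    by (rule tm_val_iso[OF h A]; use Eq in auto)+
  ultimately show ?case by (simp only: sat.simps inj_on_eq_iff)
next
  case (Rel r ts)
  have ts: "wf_tm L t" "v ` fv_tm t \<subseteq> Dom A" if t: "t \<in> set ts" for t
    using Rel t by auto
  have "tm_val B (h \<circ> v) t = (h \<circ> tm_val A v) t" if t: "t \<in> set ts" for t
    using tm_val_iso[OF h A ts[OF t]] by (simp add: comp_def)
  then have "map (tm_val B (h \<circ> v)) ts = map (h \<circ> tm_val A v) ts" by (rule map_cong[OF refl])
  moreover have "set (map (tm_val A v) ts) \<subseteq> Dom A"
    using tm_val_in_Dom[OF A] ts by auto
  moreover have "r \<in> Rels L" "length (map (tm_val A v) ts) = rarity L r" using Rel by auto
  ultimately show ?case using h unfolding is_iso_def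
    by (metis map_map sat.simps(2))
next
  case (Conj \<phi> \<psi>)
  have "v ` fv \<phi> \<subseteq> Dom A" "v ` fv \<psi> \<subseteq> Dom A" using Conj.prems by auto
  then show ?case using Conj by simp
next
  case (Ex n \<phi>)
  have Dom_B: "Dom B = h ` Dom A" using h by (simp add: is_iso_def bij_betw_def)
  have "sat B ((h \<circ> v)(n := h d)) \<phi> \<longleftrightarrow> sat A (v(n := d)) \<phi>" if d: "d \<in> Dom A" for d
  proof -
    have "(h \<circ> v)(n := h d) = h \<circ> v(n := d)" by (simp add: fun_eq_iff)
    moreover have "v(n := d) ` fv \<phi> \<subseteq> Dom A" using Ex.prems d by auto
    ultimately show ?thesis using Ex.IH Ex.prems by (simp only: wf_fm.simps)
  qed
  then show ?case unfolding sat.simps Dom_B by blast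
qed simp

lemma elementary_submodel_Dom: "elementary_submodel L M N \<Longrightarrow> N \<subseteq> Dom M \<and> N \<noteq> {}"
  by (simp add: elementary_submodel_def is_struct_def)

lemma tarski_vaught:
  assumes N: "elementary_submodel L M N" and P: "P \<in> definable L M V"
    and g: "g ` (V - {x}) \<subseteq> N" and d: "d \<in> Dom M" "P (g(x := d))"
  shows "\<exists>d\<in>N. P (g(x := d))"
proof -
  obtain \<phi> w where \<phi>: "wf_fm L \<phi>" "w ` fv \<phi> \<subseteq> V" "\<And>f. P f \<longleftrightarrow> sat M (f \<circ> w) \<phi>"
    using P by (elim definableE) blast
  obtain \<phi>' w' where \<phi>': "wf_fm L \<phi>'" "w' 0 = x" "w' ` (fv \<phi>' - {0}) \<subseteq> w ` fv \<phi> - {x}"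
    "\<And>f. f x \<in> Dom M \<Longrightarrow> sat M (f \<circ> w') \<phi>' \<longleftrightarrow> sat M (f \<circ> w) \<phi>"
    using collect_variable[OF \<phi>(1)] by metis
  obtain n0 where n0: "n0 \<in> N" using elementary_submodel_Dom[OF N] by blast
  \<comment> \<open>Elementarity concerns assignments with all values in \<open>N\<close>, while
    \<open>g\<close> is controlled on the relevant variables only; \<open>n0\<close> fills the
    rest.\<close>
  define v where "v n = (if n \<in> fv \<phi>' - {0} then g (w' n) else n0)" for n
  have "v n \<in> N" for n
  proof (cases "n \<in> fv \<phi>' - {0}")
    case True
    then have "w' n \<in> V - {x}" using \<phi>'(3) \<phi>(2) by blast
    then show ?thesis using g True by (auto simp: v_def)
  next
    case False
    then show ?thesis using n0 by (auto simp: v_def)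
  qed
  then have v: "range v \<subseteq> N" by blast
  have eq: "sat M (v(0 := d)) \<phi>' \<longleftrightarrow> P (g(x := d))" if d: "d \<in> Dom M" for d
  proof -
    have "w' n \<noteq> x" if n: "n \<in> fv \<phi>'" "n \<noteq> 0" for n using \<phi>'(3) n by blast
    then have "sat M (v(0 := d)) \<phi>' \<longleftrightarrow> sat M (g(x := d) \<circ> w') \<phi>'"
      using \<phi>'(2) by (intro sat_cong) (auto simp: v_def)
    then show ?thesis using \<phi>'(4)[of "g(x := d)"] \<phi>(3) d by simp
  qed
  let ?N = "M\<lparr>Dom := N\<rparr>"
  have elem: "\<And>\<psi> u. wf_fm L \<psi> \<Longrightarrow> range u \<subseteq> N \<Longrightarrow> sat ?N u \<psi> \<longleftrightarrow> sat M u \<psi>"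
    using N by (simp add: elementary_submodel_def)
  have "sat M v (Ex 0 \<phi>')" using d eq by auto
  then have "sat ?N v (Ex 0 \<phi>')" using elem[of "Ex 0 \<phi>'" v] v \<phi>'(1) by simp
  then obtain d' where d': "d' \<in> N" "sat ?N (v(0 := d')) \<phi>'" by auto
  moreover have "range (v(0 := d')) \<subseteq> N" using v d'(1) by auto
  ultimately have "sat M (v(0 := d')) \<phi>'" using elem \<phi>'(1) by blast
  then have "P (g(x := d'))" using eq[of d'] d'(1) elementary_submodel_Dom[OF N] by blast
  then show ?thesis using d'(1) by blast
qed

text \<open>The coordinates in \<open>X\<close> are moved into \<open>N\<close> one by one: one is
  quantified away, the others are moved by induction, and a witness for it is then chosen in
  \<open>N\<close> by \<open>tarski_vaught\<close>.\<close>

lemma realize_in_submodel_finite: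
  assumes N: "elementary_submodel L M N"
  shows "finite X \<Longrightarrow> P \<in> definable L M V \<Longrightarrow> f ` V \<subseteq> Dom M \<Longrightarrow> f ` (V - X) \<subseteq> N \<Longrightarrow> P f \<Longrightarrow>
    \<exists>g. g ` V \<subseteq> N \<and> (\<forall>v\<in>V - X. g v = f v) \<and> P g"
proof (induction X arbitrary: P V rule: finite_induct)
  case empty
  then show ?case by auto
next
  case (insert x X)
  show ?case
  proof (cases "x \<in> V")
    case False
    then have "V - insert x X = V - X" by auto
    then show ?thesis using insert.IH[of P V] insert.prems by simp
  next
    case True
    let ?P = "\<lambda>f. \<exists>d\<in>Dom M. P (f(x := d))"
    have "?P \<in> definable L M (V - {x})" by (rule definable_Bex[OF insert.prems(1)])
    moreover have "f ` (V - {x}) \<subseteq> Dom M" "f ` (V - {x} - X) \<subseteq> N" using insert.prems by auto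
    moreover have "?P f" using insert.prems True by (intro bexI[of _ "f x"]) auto
    ultimately have "\<exists>g. g ` (V - {x}) \<subseteq> N \<and> (\<forall>v\<in>V - {x} - X. g v = f v) \<and> ?P g" by (rule insert.IH)
    then obtain g d where g: "g ` (V - {x}) \<subseteq> N" "\<forall>v\<in>V - {x} - X. g v = f v"
      and d: "d \<in> Dom M" "P (g(x := d))" by blast
    obtain d' where d': "d' \<in> N" "P (g(x := d'))"
      using tarski_vaught[OF N insert.prems(1) g(1) d] by (rule bexE)
    have "g(x := d') ` V \<subseteq> N" using g(1) d'(1) by auto
    moreover have "\<forall>v\<in>V - insert x X. (g(x := d')) v = f v" using g(2) by auto
    ultimately show ?thesis using d'(2) by (intro exI[of _ "g(x := d')"] conjI)
  qed
qed

text \<open>Only finitely many coordinates matter to \<open>P\<close>, so only finitely many values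
  outside \<open>N\<close> have to be replaced with care.\<close>

lemma realize_in_submodel:
  assumes N: "elementary_submodel L M N" and P: "P \<in> definable L M V" "f ` V \<subseteq> Dom M" "P f"
  shows "\<exists>g. g ` V \<subseteq> N \<and> (\<forall>v\<in>V. f v \<in> N \<longrightarrow> g v = f v) \<and> P g"
proof -
  obtain V0 where V0: "finite V0" "V0 \<subseteq> V" "P \<in> definable L M V0"
    by (rule definable_finite_support[OF P(1)])
  let ?X = "{v \<in> V0. f v \<notin> N}"
  have "\<exists>g. g ` V0 \<subseteq> N \<and> (\<forall>v\<in>V0 - ?X. g v = f v) \<and> P g"
    by (rule realize_in_submodel_finite[OF N]) (use V0 P in auto)
  then obtain g where g: "g ` V0 \<subseteq> N" "\<forall>v\<in>V0 - ?X. g v = f v" "P g" by (elim exE conjE)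
  obtain n0 where n0: "n0 \<in> N" using elementary_submodel_Dom[OF N] by blast
  define g' where "g' v = (if v \<in> V0 then g v else if f v \<in> N then f v else n0)" for v
  have "P g'" using definable_cong[OF V0(3), of g' g] g(3) by (simp add: g'_def)
  moreover have "g' ` V \<subseteq> N" using g(1) n0 by (auto simp: g'_def)
  moreover have "\<forall>v\<in>V. f v \<in> N \<longrightarrow> g' v = f v" using g(2) by (simp add: g'_def)
  ultimately show ?thesis by (intro exI[of _ g'] conjI)
qed

text \<open>
  A realisation over \<open>B\<close> of a coheir of the type of \<open>c\<close> over \<open>N\<close>. The partial type consisting of
  that type and of the negations of all formulas over \<open>B\<close> without solutions in \<open>N\<close> is finitely
  satisfiable in \<open>N\<close>.
\<close>

lemma coheir_realization:
  fixes M :: "('f, 'r, 'm) struct" and I :: "'k set"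
  assumes "uncountable_cardinal \<kappa>" "saturated L \<kappa> M"
    and N: "elementary_submodel L M N" and B: "N \<subseteq> B" "B \<subseteq> Dom M" "|B| <o \<kappa>" "|I| <o \<kappa>"
    and c: "c ` I \<subseteq> Dom M"
  obtains d where "d ` I \<subseteq> Dom M"
    "\<forall>P\<in>definable L M (Inl ` N \<union> Inr ` I). P (case_sum id c) \<longrightarrow> P (case_sum id d)"
    "\<forall>P\<in>definable L M (Inl ` B \<union> Inr ` I). P (case_sum id d) \<longrightarrow>
      (\<exists>n. n ` I \<subseteq> N \<and> P (case_sum id n))"
proof -
  let ?D = "\<lambda>A. definable L M (Inl ` A \<union> Inr ` I)"
  define \<Gamma>1 where "\<Gamma>1 = {P \<in> ?D N. P (case_sum id c)}"
  define \<Gamma>2 where "\<Gamma>2 = {P \<in> ?D B. \<forall>n. n ` I \<subseteq> N \<longrightarrow> P (case_sum id n)}"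
  have Dom: "Dom M \<noteq> {}" "N \<subseteq> Dom M" using elementary_submodel_Dom[OF N] by auto
  have fin: "\<exists>g. g ` I \<subseteq> Dom M \<and> (\<forall>P\<in>F. P (case_sum id g))" if F: "finite F" "F \<subseteq> \<Gamma>1 \<union> \<Gamma>2" for F
  proof -
    define R where "R f \<longleftrightarrow> (\<forall>P\<in>F \<inter> \<Gamma>1. P f)" for f
    have R: "R \<in> ?D N"
      unfolding R_def by (rule definable_Ball[OF Dom(1)]) (use F(1) in \<open>auto simp: \<Gamma>1_def\<close>)
    have "case_sum id c ` (Inl ` N \<union> Inr ` I) \<subseteq> Dom M" using c Dom(2) by auto
    moreover have "R (case_sum id c)" by (simp add: R_def \<Gamma>1_def)
    ultimately have "\<exists>g. g ` (Inl ` N \<union> Inr ` I) \<subseteq> N \<and>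
        (\<forall>v\<in>Inl ` N \<union> Inr ` I. case_sum id c v \<in> N \<longrightarrow> g v = case_sum id c v) \<and> R g"
      by (rule realize_in_submodel[OF N R])
    then obtain g where g: "g ` (Inl ` N \<union> Inr ` I) \<subseteq> N"
      "\<forall>v\<in>Inl ` N \<union> Inr ` I. case_sum id c v \<in> N \<longrightarrow> g v = case_sum id c v" "R g" by (elim exE conjE)
    \<comment> \<open>The names \<open>Inl m\<close> have values in \<open>N\<close>, which
      \<open>g\<close> leaves unchanged, so \<open>g\<close> still interprets parameters as
      themselves.\<close>
    have "case_sum id (g \<circ> Inr) v = g v" if v: "v \<in> Inl ` N \<union> Inr ` I" for v
      using v g(2) by auto
    then have "R (case_sum id (g \<circ> Inr))"
      using definable_cong[OF R, of "case_sum id (g \<circ> Inr)" g] g(3) by simp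
    then have R_g: "\<forall>P\<in>F \<inter> \<Gamma>1. P (case_sum id (g \<circ> Inr))" unfolding R_def .
    have sub: "(g \<circ> Inr) ` I \<subseteq> N" using g(1) by auto
    \<comment> \<open>The part from \<open>\<Gamma>1\<close> holds by choice of \<open>g\<close>;
      the part from \<open>\<Gamma>2\<close> comes for free, since its members hold of all tuples in
      \<open>N\<close>.\<close>
    have "P (case_sum id (g \<circ> Inr))" if P: "P \<in> F" for P
    proof (cases "P \<in> \<Gamma>1")
      case True
      then have "P \<in> F \<inter> \<Gamma>1" using P by simp
      then show ?thesis by (rule bspec[OF R_g, of P])
    next
      case False
      then have "P \<in> \<Gamma>2" using P F(2) by blast
      then have all: "\<forall>n. n ` I \<subseteq> N \<longrightarrow> P (case_sum id n)" by (simp add: \<Gamma>2_def)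
      show ?thesis by (rule all[THEN spec, of "g \<circ> Inr", THEN mp, OF sub])
    qed
    moreover have "(g \<circ> Inr) ` I \<subseteq> Dom M" using sub Dom(2) by blast
    ultimately show ?thesis by (intro exI[of _ "g \<circ> Inr"] conjI ballI)
  qed
  have "?D N \<subseteq> ?D B"
    by (rule subsetI, erule definable_mono) (use B(1) in auto)
  then have "\<Gamma>1 \<union> \<Gamma>2 \<subseteq> ?D B" by (auto simp: \<Gamma>1_def \<Gamma>2_def)
  then have "\<exists>d. d ` I \<subseteq> Dom M \<and> (\<forall>P\<in>\<Gamma>1 \<union> \<Gamma>2. P (case_sum id d))"
    by (rule saturated_tuple[OF assms(1,2) Dom(1) B(2-4)]) (rule fin)
  then obtain d where d: "d ` I \<subseteq> Dom M" and all: "\<forall>P\<in>\<Gamma>1 \<union> \<Gamma>2. P (case_sum id d)" by (elim exE conjE)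
  show thesis
  proof (rule that[OF d(1)]; intro ballI impI)
    fix P assume "P \<in> ?D N" "P (case_sum id c)"
    then have "P \<in> \<Gamma>1 \<union> \<Gamma>2" by (simp add: \<Gamma>1_def)
    then show "P (case_sum id d)" by (rule bspec[OF all, of P])
  next
    fix P assume P: "P \<in> ?D B" "P (case_sum id d)"
    show "\<exists>n. n ` I \<subseteq> N \<and> P (case_sum id n)"
    proof (rule ccontr)
      assume no: "\<not> (\<exists>n. n ` I \<subseteq> N \<and> P (case_sum id n))"
      have "(\<lambda>f. \<not> P f) \<in> \<Gamma>1 \<union> \<Gamma>2"
        unfolding \<Gamma>2_def by (intro UnI2 CollectI conjI definable_not[OF P(1)]) (use no in blast)
      then have "\<not> P (case_sum id d)" by (rule bspec[OF all, of "\<lambda>f. \<not> P f"])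
      then show False using P(2) by simp
    qed
  qed
qed

section \<open>Automorphisms of a monster model\<close>

lemma ran_act_tuple: "ran (act_tuple \<sigma> x) = \<sigma> ` ran x"
  by (force simp: act_tuple_def ran_def)

context group begin

lemma inv_mult_cancel:
  assumes "x \<in> carrier G" "y \<in> carrier G" "z \<in> carrier G"
  shows "(inv x \<otimes> y) \<otimes> (inv y \<otimes> z) = inv x \<otimes> z"
  using assms by (metis inv_closed l_one m_assoc m_closed r_inv)

lemma inv_inv_mult:
  assumes "x \<in> carrier G" "y \<in> carrier G"
  shows "inv (inv x \<otimes> y) = inv y \<otimes> x"
  using assms by (simp add: inv_mult_group)

lemma inv_mult_translate:
  assumes "s \<in> carrier G" "x \<in> carrier G" "y \<in> carrier G"
  shows "inv (s \<otimes> x) \<otimes> (s \<otimes> y) = inv x \<otimes> y"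
  using assms by (metis inv_mult_group inv_closed inv_inv inv_mult_cancel)

end

locale monster =
  fixes L :: "('f, 'r) lang" and T :: "('f, 'r) fm set"
    and \<kappa> :: "'k rel" and M :: "('f, 'r, 'm) struct"
  assumes monster: "monster_model L T \<kappa> M"
begin

abbreviation D :: "'m set" where "D \<equiv> Dom M"
abbreviation G :: "('m \<Rightarrow> 'm) set" where "G \<equiv> auts L M"
abbreviation BG :: "('m \<Rightarrow> 'm) monoid" where "BG \<equiv> BijGroup D"

lemma strong_limit: "strong_limit \<kappa>" and saturated: "saturated L \<kappa> M"
  and homogeneous: "strongly_homogeneous L \<kappa> M" and struct: "is_struct L M"
  using monster by (auto simp: monster_model_def models_def)

sublocale uncountable_cardinal \<kappa> by (rule strong_limit_uncountable[OF strong_limit])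

sublocale Bij: group BG by (rule group_BijGroup)

lemma D_nonempty: "D \<noteq> {}"
  using struct by (simp add: is_struct_def)

lemma small_formulas_L: "small {\<phi>. wf_fm L \<phi>}"
  using monster by (intro small_formulas) (auto simp: monster_model_def)

lemma carrier_BG: "carrier BG = Bij D"
  by (simp add: BijGroup_def)

lemma aut_Bij: "\<sigma> \<in> G \<Longrightarrow> \<sigma> \<in> carrier BG"
  by (simp add: auts_def BijGroup_def)

lemma aut_bij: "\<sigma> \<in> G \<Longrightarrow> bij_betw \<sigma> D D"
  by (simp add: auts_def Bij_def)

lemma aut_in: "\<sigma> \<in> G \<Longrightarrow> x \<in> D \<Longrightarrow> \<sigma> x \<in> D"
  using aut_bij by (auto simp: bij_betw_def)

lemma aut_iso: "\<sigma> \<in> G \<Longrightarrow> is_iso L \<sigma> M M"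
  by (auto simp: auts_def is_iso_def Bij_def)

lemma mult_apply: "\<sigma> \<in> G \<Longrightarrow> \<tau> \<in> G \<Longrightarrow> x \<in> D \<Longrightarrow> (\<sigma> \<otimes>\<^bsub>BG\<^esub> \<tau>) x = \<sigma> (\<tau> x)"
  by (simp add: BijGroup_def auts_def compose_def)

lemma one_apply: "x \<in> D \<Longrightarrow> \<one>\<^bsub>BG\<^esub> x = x"
  by (simp add: BijGroup_def)

lemma inv_apply: "\<sigma> \<in> G \<Longrightarrow> x \<in> D \<Longrightarrow> (inv\<^bsub>BG\<^esub> \<sigma>) (\<sigma> x) = x"
  using aut_in[of \<sigma> x] aut_bij[of \<sigma>]
  by (subst inv_BijGroup) (auto simp: auts_def bij_betw_def)

lemma apply_inv: "\<sigma> \<in> G \<Longrightarrow> x \<in> D \<Longrightarrow> \<sigma> ((inv\<^bsub>BG\<^esub> \<sigma>) x) = x"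
  using aut_bij[of \<sigma>]
  by (subst inv_BijGroup) (auto simp: auts_def bij_betw_def f_inv_into_f)

lemma inv_in: "\<sigma> \<in> G \<Longrightarrow> x \<in> D \<Longrightarrow> (inv\<^bsub>BG\<^esub> \<sigma>) x \<in> D"
  using aut_bij[of \<sigma>]
  by (subst inv_BijGroup) (auto simp: auts_def bij_betw_def inv_into_into)

lemma aut_Fun:
  "\<sigma> \<in> G \<Longrightarrow> f \<in> Funs L \<Longrightarrow> length xs = farity L f \<Longrightarrow> set xs \<subseteq> D \<Longrightarrow>
    \<sigma> (FunI M f xs) = FunI M f (map \<sigma> xs)"
  by (simp add: auts_def)

lemma aut_Rel:
  "\<sigma> \<in> G \<Longrightarrow> r \<in> Rels L \<Longrightarrow> length xs = rarity L r \<Longrightarrow> set xs \<subseteq> D \<Longrightarrow>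
    RelI M r (map \<sigma> xs) \<longleftrightarrow> RelI M r xs"
  by (simp add: auts_def)

lemma Fun_in: "f \<in> Funs L \<Longrightarrow> length xs = farity L f \<Longrightarrow> set xs \<subseteq> D \<Longrightarrow> FunI M f xs \<in> D"
  using struct by (simp add: is_struct_def)

lemma aut_one: "\<one>\<^bsub>BG\<^esub> \<in> G"
proof -
  have "map (\<lambda>x\<in>D. x) xs = xs" if "set xs \<subseteq> D" for xs
    using that by (induction xs) auto
  then show ?thesis using Fun_in by (auto simp: auts_def BijGroup_def id_Bij)
qed

lemma aut_mult:
  assumes "\<sigma> \<in> G" "\<tau> \<in> G" shows "\<sigma> \<otimes>\<^bsub>BG\<^esub> \<tau> \<in> G"
proof -
  have map: "map (\<sigma> \<otimes>\<^bsub>BG\<^esub> \<tau>) xs = map \<sigma> (map \<tau> xs)" if "set xs \<subseteq> D" for xs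
    using that assms by (auto simp: mult_apply)
  have map_in: "set (map \<tau> xs) \<subseteq> D" if "set xs \<subseteq> D" for xs
    using that aut_in[OF assms(2)] by auto
  have "(\<sigma> \<otimes>\<^bsub>BG\<^esub> \<tau>) (FunI M f xs) = FunI M f (map (\<sigma> \<otimes>\<^bsub>BG\<^esub> \<tau>) xs)"
    if "f \<in> Funs L" "length xs = farity L f" "set xs \<subseteq> D" for f xs
    unfolding map[OF that(3)] mult_apply[OF assms Fun_in[OF that]] aut_Fun[OF assms(2) that]
    using that map_in by (intro aut_Fun assms) auto
  moreover have "RelI M r (map (\<sigma> \<otimes>\<^bsub>BG\<^esub> \<tau>) xs) \<longleftrightarrow> RelI M r xs"
    if "r \<in> Rels L" "length xs = rarity L r" "set xs \<subseteq> D" for r xs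
    unfolding map[OF that(3)] using that aut_Rel[OF assms(2) that] map_in[OF that(3)]
    by (subst aut_Rel[OF assms(1)]) auto
  moreover have "\<sigma> \<otimes>\<^bsub>BG\<^esub> \<tau> \<in> Bij D"
    using Bij.m_closed[OF aut_Bij[OF assms(1)] aut_Bij[OF assms(2)]] by (simp add: BijGroup_def)
  ultimately show ?thesis by (simp add: auts_def)
qed

lemma aut_inv:
  assumes "\<sigma> \<in> G" shows "inv\<^bsub>BG\<^esub> \<sigma> \<in> G"
proof -
  let ?i = "inv\<^bsub>BG\<^esub> \<sigma>"
  have map: "map \<sigma> (map ?i xs) = xs" if "set xs \<subseteq> D" for xs
    using that assms by (induction xs) (auto simp: apply_inv)
  have map_in: "set (map ?i xs) \<subseteq> D" if "set xs \<subseteq> D" for xs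
    using that inv_in[OF assms] by auto
  have "?i (FunI M f xs) = FunI M f (map ?i xs)"
    if xs: "f \<in> Funs L" "length xs = farity L f" "set xs \<subseteq> D" for f xs
  proof -
    have "\<sigma> (FunI M f (map ?i xs)) = FunI M f xs"
      using xs map_in[OF xs(3)] by (subst aut_Fun[OF assms]) (simp_all only: map[OF xs(3)] length_map)
    then show ?thesis using inv_apply[OF assms Fun_in[of f "map ?i xs"]] xs map_in by simp
  qed
  moreover have "RelI M r (map ?i xs) \<longleftrightarrow> RelI M r xs"
    if xs: "r \<in> Rels L" "length xs = rarity L r" "set xs \<subseteq> D" for r xs
  proof -
    have "RelI M r (map \<sigma> (map ?i xs)) \<longleftrightarrow> RelI M r (map ?i xs)"
      by (rule aut_Rel[OF assms xs(1)]) (use xs(2) map_in[OF xs(3)] in simp_all)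
    then show ?thesis unfolding map[OF xs(3)] by (rule sym)
  qed
  moreover have "?i \<in> Bij D"
    using Bij.inv_closed[OF aut_Bij[OF assms]] by (simp only: carrier_BG)
  ultimately show ?thesis by (simp add: auts_def)
qed

lemma aut_inv_inv: "\<sigma> \<in> G \<Longrightarrow> inv\<^bsub>BG\<^esub> (inv\<^bsub>BG\<^esub> \<sigma>) = \<sigma>"
  by (rule Bij.inv_inv[OF aut_Bij])

lemma definable_aut:
  assumes "\<sigma> \<in> G" "P \<in> definable L M V" "f ` V \<subseteq> D"
  shows "P (\<lambda>v. \<sigma> (f v)) \<longleftrightarrow> P f"
proof -
  obtain \<phi> w where \<phi>: "wf_fm L \<phi>" "w ` fv \<phi> \<subseteq> V" "\<And>f. P f \<longleftrightarrow> sat M (f \<circ> w) \<phi>"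
    using assms(2) by (elim definableE) blast
  have "(f \<circ> w) ` fv \<phi> \<subseteq> D" using \<phi>(2) assms(3) by auto
  then have "sat M (\<sigma> \<circ> (f \<circ> w)) \<phi> \<longleftrightarrow> sat M (f \<circ> w) \<phi>"
    by (rule sat_iso[OF aut_iso[OF assms(1)] struct \<phi>(1)])
  then show ?thesis by (simp add: \<phi>(3) comp_def)
qed

text \<open>Homogeneity of the model concerns maps between sets, whereas \<open>x\<close> and
  \<open>y\<close> may repeat values. The map \<open>x v\<close> to \<open>y v\<close> is well
  defined because equalities between coordinates belong to the type, and one implication suffices
  because types are closed under negation.\<close>

lemma homogeneity:
  assumes V: "small V" "x ` V \<subseteq> D" "y ` V \<subseteq> D"
    and tp: "\<forall>P\<in>definable L M V. P x \<longrightarrow> P y"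
  obtains \<tau> where "\<tau> \<in> G" "\<forall>v\<in>V. \<tau> (x v) = y v"
proof -
  define h where "h = y \<circ> inv_into V x"
  have tp_iff: "P x \<longleftrightarrow> P y" if "P \<in> definable L M V" for P
    using bspec[OF tp that] bspec[OF tp definable_not[OF that]] by argo
  have h: "h (x v) = y v" if v: "v \<in> V" for v
  proof -
    let ?u = "inv_into V x (x v)"
    have u: "?u \<in> V" "x ?u = x v" using v by (auto simp: inv_into_into f_inv_into_f)
    have "(\<lambda>f. f ?u = f v) \<in> definable L M V"
      using u(1) v by (intro definable_mono[OF definable_eq]) auto
    then have "x ?u = x v \<longrightarrow> y ?u = y v" by (rule bspec[OF tp])
    then have "y ?u = y v" using u(2) by (rule mp)
    then show ?thesis by (simp add: h_def)
  qed
  have "elementary_map L M (x ` V) h"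
    unfolding elementary_map_def
  proof (intro conjI allI impI)
    show "x ` V \<subseteq> D" by (rule V(2))
    show "h ` x ` V \<subseteq> D" using V(3) h by auto
  next
    fix \<phi> :: "('f, 'r) fm" and v assume \<phi>: "wf_fm L \<phi> \<and> v ` fv \<phi> \<subseteq> x ` V"
    let ?w = "inv_into V x \<circ> v"
    have w: "?w n \<in> V" "x (?w n) = v n" if "n \<in> fv \<phi>" for n
      using \<phi> that by (auto simp: inv_into_into f_inv_into_f image_subset_iff)
    have "(\<lambda>f. sat M (f \<circ> ?w) \<phi>) \<in> definable L M V"
      using \<phi> w(1) by (intro definableI) auto
    then have "sat M (x \<circ> ?w) \<phi> \<longleftrightarrow> sat M (y \<circ> ?w) \<phi>" by (rule tp_iff)
    moreover have "sat M (x \<circ> ?w) \<phi> \<longleftrightarrow> sat M v \<phi>" using w(2) by (intro sat_cong) simp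
    ultimately show "sat M (h \<circ> v) \<phi> \<longleftrightarrow> sat M v \<phi>" by (simp add: h_def comp_assoc)
  qed
  moreover have "small (x ` V)" by (rule small_image[OF V(1)])
  ultimately obtain \<tau> where "\<tau> \<in> G" "\<forall>z\<in>x ` V. \<tau> z = h z"
    using homogeneous unfolding strongly_homogeneous_def by blast
  then show thesis using h by (intro that[of \<tau>]) auto
qed

definition Stab :: "'m set \<Rightarrow> ('m \<Rightarrow> 'm) set" where
  "Stab N = {\<sigma> \<in> G. \<forall>x\<in>N. \<sigma> x = x}"

lemma Stab_one: "N \<subseteq> D \<Longrightarrow> \<one>\<^bsub>BG\<^esub> \<in> Stab N"
  by (auto simp: Stab_def aut_one one_apply)

section \<open>Action on ultraimaginaries\<close>

lemma act_tuple_mult: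
  assumes "\<sigma> \<in> G" "\<tau> \<in> G" "ran x \<subseteq> D"
  shows "act_tuple (\<sigma> \<otimes>\<^bsub>BG\<^esub> \<tau>) x = act_tuple \<sigma> (act_tuple \<tau> x)"
proof
  fix i show "act_tuple (\<sigma> \<otimes>\<^bsub>BG\<^esub> \<tau>) x i = act_tuple \<sigma> (act_tuple \<tau> x) i"
  proof (cases "x i")
    case (Some m)
    then have "m \<in> D" using assms(3) by (auto intro: ranI)
    then show ?thesis using Some mult_apply[OF assms(1,2)] by (simp add: act_tuple_def)
  qed (simp add: act_tuple_def)
qed

lemma act_tuple_cong:
  assumes "\<And>m. m \<in> ran x \<Longrightarrow> \<sigma> m = \<tau> m" shows "act_tuple \<sigma> x = act_tuple \<tau> x"
proof
  fix i show "act_tuple \<sigma> x i = act_tuple \<tau> x i"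
    using assms by (cases "x i") (auto simp: act_tuple_def ranI)
qed

lemma act_tuple_id: "(\<And>m. m \<in> ran x \<Longrightarrow> \<sigma> m = m) \<Longrightarrow> act_tuple \<sigma> x = x"
  using act_tuple_cong[of x \<sigma> "\<lambda>m. m"] by (simp add: act_tuple_def option.map_ident fun_eq_iff)

lemma act_tuple_in: "\<sigma> \<in> G \<Longrightarrow> x \<in> tuples M I \<Longrightarrow> act_tuple \<sigma> x \<in> tuples M I"
  using ran_act_tuple[of \<sigma> x] aut_in by (auto simp: tuples_def act_tuple_def)

text \<open>The group laws for \<open>act\<close> are confined to these sets because composition in
  \<open>BijGroup\<close> is restricted to \<open>D\<close>.\<close>

abbreviation sets_of_tuples :: "('k \<rightharpoonup> 'm) set set" where
  "sets_of_tuples \<equiv> {e. \<forall>x\<in>e. ran x \<subseteq> D}"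

lemma act_mult:
  "\<sigma> \<in> G \<Longrightarrow> \<tau> \<in> G \<Longrightarrow> e \<in> sets_of_tuples \<Longrightarrow> act (\<sigma> \<otimes>\<^bsub>BG\<^esub> \<tau>) e = act \<sigma> (act \<tau> e)"
  by (auto simp: act_def image_image act_tuple_mult)

lemma act_sets_of_tuples: "\<sigma> \<in> G \<Longrightarrow> e \<in> sets_of_tuples \<Longrightarrow> act \<sigma> e \<in> sets_of_tuples"
  by (auto simp: act_def ran_act_tuple aut_in subset_iff)

lemma act_one: "e \<in> sets_of_tuples \<Longrightarrow> act \<one>\<^bsub>BG\<^esub> e = e"
proof -
  assume "e \<in> sets_of_tuples"
  then have "act_tuple \<one>\<^bsub>BG\<^esub> x = x" if "x \<in> e" for x
    using that one_apply by (intro act_tuple_id) auto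
  then show ?thesis by (simp add: act_def)
qed

lemma act_inv_act:
  assumes "\<sigma> \<in> G" "e \<in> sets_of_tuples" shows "act (inv\<^bsub>BG\<^esub> \<sigma>) (act \<sigma> e) = e"
proof -
  have "act (inv\<^bsub>BG\<^esub> \<sigma>) (act \<sigma> e) = act (inv\<^bsub>BG\<^esub> \<sigma> \<otimes>\<^bsub>BG\<^esub> \<sigma>) e"
    by (rule act_mult[OF aut_inv[OF assms(1)] assms, symmetric])
  also have "\<dots> = act \<one>\<^bsub>BG\<^esub> e"
    by (rule arg_cong[OF Bij.l_inv[OF aut_Bij[OF assms(1)]], of "\<lambda>\<tau>. act \<tau> e"])
  also have "\<dots> = e" by (rule act_one[OF assms(2)])
  finally show ?thesis .
qed

lemma act_act_inv:
  assumes "\<sigma> \<in> G" "e \<in> sets_of_tuples" shows "act \<sigma> (act (inv\<^bsub>BG\<^esub> \<sigma>) e) = e"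
  using act_inv_act[OF aut_inv[OF assms(1)] assms(2)] unfolding aut_inv_inv[OF assms(1)] .

lemma act_inject:
  assumes "\<sigma> \<in> G" "e \<in> sets_of_tuples" "e' \<in> sets_of_tuples" "act \<sigma> e = act \<sigma> e'"
  shows "e = e'"
proof -
  have "e = act (inv\<^bsub>BG\<^esub> \<sigma>) (act \<sigma> e)" by (rule act_inv_act[OF assms(1,2), symmetric])
  also have "\<dots> = e'" unfolding assms(4) by (rule act_inv_act[OF assms(1,3)])
  finally show ?thesis .
qed

abbreviation ultra :: "('k \<rightharpoonup> 'm) set set" where "ultra \<equiv> ultraimaginaries L \<kappa> M"

lemma invariant_equiv_act:
  assumes "invariant_equiv L M I E" "\<sigma> \<in> G" "(x, y) \<in> E"
  shows "(act_tuple \<sigma> x, act_tuple \<sigma> y) \<in> E"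
proof -
  have "\<forall>\<sigma>\<in>G. \<forall>(x, y)\<in>E. (act_tuple \<sigma> x, act_tuple \<sigma> y) \<in> E"
    using assms(1) unfolding invariant_equiv_def by (rule conjunct2)
  from bspec[OF bspec[OF this assms(2)] assms(3)] show ?thesis by simp
qed

lemma invariant_equiv_subset: "invariant_equiv L M I E \<Longrightarrow> E \<subseteq> tuples M I \<times> tuples M I"
  by (simp only: invariant_equiv_def equiv_type)

text \<open>Invariance gives one inclusion; the other, that the image is a whole class, needs
  invariance under the inverse automorphism.\<close>

lemma act_class:
  assumes E: "invariant_equiv L M I E" and \<sigma>: "\<sigma> \<in> G" and x: "x \<in> tuples M I"
  shows "act \<sigma> (E `` {x}) = E `` {act_tuple \<sigma> x}"
proof -
  have inv: "(act_tuple \<tau> y, act_tuple \<tau> z) \<in> E" if "\<tau> \<in> G" "(y, z) \<in> E" for \<tau> y z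
    by (rule invariant_equiv_act[OF E that])
  have sub: "E \<subseteq> tuples M I \<times> tuples M I" by (rule invariant_equiv_subset[OF E])
  have cancel: "act_tuple \<tau> (act_tuple \<tau>' y) = y"
    if "\<tau> \<in> G" "\<tau>' \<in> G" "\<tau> \<otimes>\<^bsub>BG\<^esub> \<tau>' = \<one>\<^bsub>BG\<^esub>" "y \<in> tuples M I" for \<tau> \<tau>' y
  proof -
    have y: "ran y \<subseteq> D" using that(4) by (simp add: tuples_def)
    have "act_tuple \<tau> (act_tuple \<tau>' y) = act_tuple \<one>\<^bsub>BG\<^esub> y"
      using act_tuple_mult[OF that(1,2) y] that(3) by simp
    also have "\<dots> = y" using y one_apply by (intro act_tuple_id) auto
    finally show ?thesis .
  qed
  have "z \<in> act \<sigma> (E `` {x})" if z: "(act_tuple \<sigma> x, z) \<in> E" for z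
  proof -
    let ?y = "act_tuple (inv\<^bsub>BG\<^esub> \<sigma>) z"
    have "z \<in> tuples M I" using z sub by blast
    then have "act_tuple \<sigma> ?y = z"
      by (intro cancel[OF \<sigma> aut_inv[OF \<sigma>]] Bij.r_inv[OF aut_Bij[OF \<sigma>]])
    have "act_tuple (inv\<^bsub>BG\<^esub> \<sigma>) (act_tuple \<sigma> x) = x"
      by (intro cancel[OF aut_inv[OF \<sigma>] \<sigma>] Bij.l_inv[OF aut_Bij[OF \<sigma>]] x)
    then have "(x, ?y) \<in> E" using inv[OF aut_inv[OF \<sigma>] z] by simp
    then have "?y \<in> E `` {x}" by simp
    with \<open>act_tuple \<sigma> ?y = z\<close> show ?thesis unfolding act_def by (intro image_eqI[of _ _ ?y]) simp_all
  qed
  moreover have "act \<sigma> (E `` {x}) \<subseteq> E `` {act_tuple \<sigma> x}"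
    unfolding act_def by (intro image_subsetI) (simp add: inv[OF \<sigma>])
  ultimately show ?thesis by blast
qed

lemma ultraE:
  assumes "e \<in> ultra"
  obtains I E c where "small I" "invariant_equiv L M I E" "c \<in> tuples M I" "e = E `` {c}"
  using assms unfolding ultraimaginaries_def by (auto elim!: quotientE)

lemma ultra_sets_of_tuples: "e \<in> ultra \<Longrightarrow> e \<in> sets_of_tuples"
proof (elim ultraE)
  fix I E c assume "invariant_equiv L M I E" "e = E `` {c}"
  then have "e \<subseteq> tuples M I" using invariant_equiv_subset by blast
  then show "e \<in> sets_of_tuples" by (auto simp: tuples_def)
qed

lemma act_ultra: "\<sigma> \<in> G \<Longrightarrow> e \<in> ultra \<Longrightarrow> act \<sigma> e \<in> ultra"
proof (elim ultraE)
  fix I E c assume *: "\<sigma> \<in> G" "small I" "invariant_equiv L M I E" "c \<in> tuples M I" "e = E `` {c}"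
  then have "act \<sigma> e = E `` {act_tuple \<sigma> c}" by (simp add: act_class)
  moreover have "E `` {act_tuple \<sigma> c} \<in> tuples M I // E"
    using * by (intro quotientI act_tuple_in)
  ultimately show "act \<sigma> e \<in> ultra" using *(2,3) unfolding ultraimaginaries_def
    by (intro CollectI exI[of _ I] exI[of _ E] conjI) simp_all
qed

lemma act_fixing_class:
  assumes "\<sigma> \<in> Stab (ran c)" "invariant_equiv L M I E" "c \<in> tuples M I"
  shows "act \<sigma> (E `` {c}) = E `` {c}"
proof -
  have "act_tuple \<sigma> c = c" using assms(1) by (intro act_tuple_id) (simp add: Stab_def)
  then show ?thesis using act_class[OF assms(2) _ assms(3)] assms(1) by (simp add: Stab_def)
qed

text \<open>
  The coheir argument behind the Lascar group: as \<open>d\<close> realises a coheir over representatives of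
  all conjugates of \<open>e\<close>, its class is one of these conjugates, and it bears the same relation to
  all of them.
\<close>

lemma bounded_orbit_fixed:
  assumes N: "elementary_submodel L M N" "small N" and e: "e \<in> ultra"
    and orbit: "small ((\<lambda>\<sigma>. act \<sigma> e) ` Stab N)" and \<sigma>: "\<sigma> \<in> Stab N"
  shows "act \<sigma> e = e"
proof -
  obtain I E c where I: "small I" and E: "invariant_equiv L M I E" and c: "c \<in> tuples M I"
    and e_c: "e = E `` {c}" by (rule ultraE[OF e])
  have N_D: "N \<subseteq> D" using elementary_submodel_Dom[OF N(1)] by blast
  define cc where "cc i = the (c i)" for i
  have c_i: "c i = (if i \<in> I then Some (cc i) else None)" for i
    using c by (auto simp: tuples_def cc_def dom_def)
  have cc: "cc ` I \<subseteq> D"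
  proof
    fix y assume "y \<in> cc ` I"
    then obtain i where "i \<in> I" "y = cc i" by blast
    then have "c i = Some y" by (simp add: c_i)
    then show "y \<in> D" using c ranI[of c i y] by (auto simp: tuples_def)
  qed
  define orb where "orb = (\<lambda>\<sigma>. act \<sigma> e) ` Stab N"
  define s where "s p = (SOME \<tau>. \<tau> \<in> Stab N \<and> act \<tau> e = p)" for p
  have s: "s p \<in> Stab N" "act (s p) e = p" if "p \<in> orb" for p
  proof -
    have "\<exists>\<tau>. \<tau> \<in> Stab N \<and> act \<tau> e = p" using that by (auto simp: orb_def)
    then have "s p \<in> Stab N \<and> act (s p) e = p" unfolding s_def by (rule someI_ex)
    then show "s p \<in> Stab N" "act (s p) e = p" by auto
  qed
  have Stab_G: "\<tau> \<in> G" if "\<tau> \<in> Stab N" for \<tau> using that by (simp add: Stab_def)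
  have Stab_N: "\<tau> m = m" if "\<tau> \<in> Stab N" "m \<in> N" for \<tau> m using that by (simp add: Stab_def)
  \<comment> \<open>Besides \<open>N\<close>, this set contains a representative \<open>s p\<close>
    applied to \<open>c\<close> for every conjugate \<open>p\<close> of \<open>e\<close>.\<close>
  define B where "B = N \<union> (\<lambda>(p, i). s p (cc i)) ` (orb \<times> I)"
  have orb: "small orb" unfolding orb_def by (rule orbit)
  have small_B: "small B"
    unfolding B_def by (rule small_Un[OF N(2) small_image[OF small_Times[OF orb I]]])
  have B_D: "B \<subseteq> D"
  proof -
    have "s p (cc i) \<in> D" if "p \<in> orb" "i \<in> I" for p i
      using aut_in[OF Stab_G[OF s(1)[OF that(1)]]] cc that(2) by blast
    then show ?thesis unfolding B_def using N_D by auto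
  qed
  have N_B: "N \<subseteq> B" unfolding B_def by simp
  obtain d where d: "d ` I \<subseteq> D"
    and d_tp: "\<forall>P\<in>definable L M (Inl ` N \<union> Inr ` I). P (case_sum id cc) \<longrightarrow> P (case_sum id d)"
    and d_fs: "\<forall>P\<in>definable L M (Inl ` B \<union> Inr ` I). P (case_sum id d) \<longrightarrow>
      (\<exists>n. n ` I \<subseteq> N \<and> P (case_sum id n))"
    by (rule coheir_realization[OF uncountable_cardinal_axioms saturated N(1) N_B B_D small_B I cc])
  have sm: "small (Inl ` N \<union> Inr ` I)" by (rule small_Un[OF small_image[OF N(2)] small_image[OF I]])
  have im1: "case_sum id cc ` (Inl ` N \<union> Inr ` I) \<subseteq> D" using N_D cc by auto
  have im2: "case_sum id d ` (Inl ` N \<union> Inr ` I) \<subseteq> D" using N_D d by auto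
  \<comment> \<open>As \<open>d\<close> has the type of \<open>c\<close> over \<open>N\<close>, it
    is an image of \<open>c\<close> under \<open>Stab N\<close>, so its class \<open>p0\<close> is
    among the conjugates represented in \<open>B\<close>.\<close>
  obtain \<tau>0 where \<tau>0: "\<tau>0 \<in> G" "\<forall>v\<in>Inl ` N \<union> Inr ` I. \<tau>0 (case_sum id cc v) = case_sum id d v"
    by (rule homogeneity[OF sm im1 im2 d_tp])
  have \<tau>0_cc: "\<tau>0 (cc i) = d i" if "i \<in> I" for i using bspec[OF \<tau>0(2), of "Inr i"] that by simp
  have \<tau>0_Stab: "\<tau>0 \<in> Stab N"
  proof -
    have "\<tau>0 m = m" if "m \<in> N" for m using bspec[OF \<tau>0(2), of "Inl m"] that by simp
    then show ?thesis using \<tau>0(1) by (simp add: Stab_def)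
  qed
  define dt where "dt = act_tuple \<tau>0 c"
  have dt: "dt \<in> tuples M I" unfolding dt_def by (rule act_tuple_in[OF \<tau>0(1) c])
  define p0 where "p0 = act \<tau>0 e"
  have p0: "p0 \<in> orb" using \<tau>0_Stab by (simp add: p0_def orb_def)
  have p0_dt: "p0 = E `` {dt}" unfolding p0_def e_c dt_def by (rule act_class[OF E \<tau>0(1) c])
  have class_s: "p = E `` {act_tuple (s p) c}" if "p \<in> orb" for p
    using s(2)[OF that] act_class[OF E Stab_G[OF s(1)[OF that]] c] by (simp add: e_c)
  have "p = p0" if p: "p \<in> orb" for p
  proof -
    let ?V = "Inl ` N \<union> Inr ` (Inl ` I \<union> Inr ` I) :: ('m + 'k + 'k) set"
    let ?x = "case_sum id (case_sum (\<lambda>i. s p0 (cc i)) d)"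
    let ?y = "case_sum id (case_sum (\<lambda>i. s p (cc i)) d)"
    \<comment> \<open>Otherwise a formula over \<open>B\<close> true of \<open>d\<close> separates
      the two representatives. By the coheir property it has a solution n in \<open>N\<close>. Both
      \<open>s p0\<close> and \<open>s p\<close> fix n, so each side takes the truth value of
      \<open>P\<close> at \<open>cc\<close> and n, a contradiction.\<close>
    have "P ?y" if P: "P \<in> definable L M ?V" "P ?x" for P
    proof (rule ccontr)
      assume not: "\<not> P ?y"
      define hx hy :: "'m + 'k + 'k \<Rightarrow> 'm + 'k"
        where "hx = case_sum Inl (case_sum (\<lambda>i. Inl (s p0 (cc i))) Inr)"
          and "hy = case_sum Inl (case_sum (\<lambda>i. Inl (s p (cc i))) Inr)"
      have hx: "case_sum id n \<circ> hx = case_sum id (case_sum (\<lambda>i. s p0 (cc i)) n)" for n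
        by (auto simp: hx_def fun_eq_iff split: sum.split)
      have hy: "case_sum id n \<circ> hy = case_sum id (case_sum (\<lambda>i. s p (cc i)) n)" for n
        by (auto simp: hy_def fun_eq_iff split: sum.split)
      have "hx ` ?V \<subseteq> Inl ` B \<union> Inr ` I" "hy ` ?V \<subseteq> Inl ` B \<union> Inr ` I"
        using p p0 by (auto simp: hx_def hy_def B_def)
      then have "(\<lambda>f. P (f \<circ> hx) \<and> \<not> P (f \<circ> hy)) \<in> definable L M (Inl ` B \<union> Inr ` I)"
        by (intro definable_conj definable_not definable_mono[OF definable_subst[OF P(1)]])
      moreover have "P (case_sum id d \<circ> hx) \<and> \<not> P (case_sum id d \<circ> hy)"
        unfolding hx hy using P(2) not by (rule conjI)
      ultimately have "\<exists>n. n ` I \<subseteq> N \<and> P (case_sum id n \<circ> hx) \<and> \<not> P (case_sum id n \<circ> hy)"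
        by (rule bspec[OF d_fs, THEN mp])
      then obtain n where n: "n ` I \<subseteq> N" "P (case_sum id n \<circ> hx)" "\<not> P (case_sum id n \<circ> hy)"
        by (elim exE conjE)
      let ?z = "case_sum id (case_sum cc n)"
      have "n ` I \<subseteq> D" using n(1) N_D by blast
      then have z: "?z ` ?V \<subseteq> D" using N_D cc by auto
      have "P (case_sum id n \<circ> hx) \<longleftrightarrow> P (\<lambda>v. s p0 (?z v))"
        using Stab_N[OF s(1)[OF p0]] n(1) by (intro definable_cong[OF P(1)]) (auto simp: hx)
      also have "\<dots> \<longleftrightarrow> P ?z" by (rule definable_aut[OF Stab_G[OF s(1)[OF p0]] P(1) z])
      also have "\<dots> \<longleftrightarrow> P (\<lambda>v. s p (?z v))"
        by (rule definable_aut[OF Stab_G[OF s(1)[OF p]] P(1) z, symmetric])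
      also have "\<dots> \<longleftrightarrow> P (case_sum id n \<circ> hy)"
        using Stab_N[OF s(1)[OF p]] n(1) by (intro definable_cong[OF P(1)]) (auto simp: hy)
      finally show False using n(2,3) by simp
    qed
    then have tp: "\<forall>P\<in>definable L M ?V. P ?x \<longrightarrow> P ?y" by (intro ballI impI)
    have V: "small ?V"
      by (rule small_Un[OF small_image[OF N(2)] small_image[OF small_Un[OF small_image[OF I] small_image[OF I]]]])
    have s_cc: "s q (cc i) \<in> D" if "q \<in> orb" "i \<in> I" for q i
      using aut_in[OF Stab_G[OF s(1)[OF that(1)]]] cc that(2) by blast
    have x: "?x ` ?V \<subseteq> D" and y: "?y ` ?V \<subseteq> D"
      using N_D d s_cc[OF p0] s_cc[OF p] by auto
    obtain \<tau> where \<tau>: "\<tau> \<in> G" "\<forall>v\<in>?V. \<tau> (?x v) = ?y v"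
      by (rule homogeneity[OF V x y tp])
    have \<tau>_cc: "\<tau> (s p0 (cc i)) = s p (cc i)" and \<tau>_d: "\<tau> (d i) = d i" if "i \<in> I" for i
      using bspec[OF \<tau>(2), of "Inr (Inl i)"] bspec[OF \<tau>(2), of "Inr (Inr i)"] that by simp_all
    \<comment> \<open>The automorphism takes the representative of \<open>p0\<close> to that of
      \<open>p\<close>, yet it fixes \<open>dt\<close>, another representative of \<open>p0\<close>.
      Hence the image of \<open>p0\<close> is both \<open>p\<close> and \<open>p0\<close>.\<close>
    have 1: "act_tuple \<tau> (act_tuple (s p0) c) = act_tuple (s p) c"
      using \<tau>_cc by (simp add: act_tuple_def fun_eq_iff c_i)
    have 2: "act_tuple \<tau> dt = dt"
      using \<tau>_d \<tau>0_cc by (simp add: act_tuple_def fun_eq_iff c_i dt_def)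
    have "act \<tau> p0 = E `` {act_tuple \<tau> dt}"
      unfolding p0_dt by (rule act_class[OF E \<tau>(1) dt])
    also have "\<dots> = p0" unfolding 2 by (rule p0_dt[symmetric])
    finally have "act \<tau> p0 = p0" .
    moreover have "act \<tau> (E `` {act_tuple (s p0) c}) = E `` {act_tuple \<tau> (act_tuple (s p0) c)}"
      by (rule act_class[OF E \<tau>(1) act_tuple_in[OF Stab_G[OF s(1)[OF p0]] c]])
    then have "act \<tau> p0 = p"
      unfolding class_s[OF p0, symmetric] 1 class_s[OF p, symmetric] .
    ultimately show ?thesis by simp
  qed
  moreover have "act \<sigma> e \<in> orb" using \<sigma> by (simp add: orb_def)
  moreover have "act \<one>\<^bsub>BG\<^esub> e \<in> orb" using Stab_one[OF N_D] by (simp add: orb_def)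
  then have "e \<in> orb" unfolding act_one[OF ultra_sets_of_tuples[OF e]] .
  ultimately show ?thesis by metis
qed

section \<open>Small elementary submodels\<close>

lemma small_elementary_submodel:
  assumes A: "small A" "A \<subseteq> D"
  obtains N where "elementary_submodel L M N" "small N" "A \<subseteq> N"
proof -
  obtain m0 where m0: "m0 \<in> D" using D_nonempty by blast
  \<comment> \<open>Parameters form a list because they will be the arguments of a function symbol.
    The default \<open>m0\<close> makes the function total when no witness exists.\<close>
  define wit where "wit n \<phi> xs = (let W = {d \<in> D. sat M ((\<lambda>i. xs ! i)(n := d)) \<phi>} in
    if W = {} then m0 else SOME d. d \<in> W)" for n \<phi> and xs :: "'m list"
  have wit_D: "wit n \<phi> xs \<in> D" for n \<phi> xs
    using m0 some_in_eq[of "{d \<in> D. sat M ((\<lambda>i. xs ! i)(n := d)) \<phi>}"] by (auto simp: wit_def Let_def)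
  have wit_sat: "sat M ((\<lambda>i. xs ! i)(n := wit n \<phi> xs)) \<phi>"
    if "d \<in> D" "sat M ((\<lambda>i. xs ! i)(n := d)) \<phi>" for n \<phi> xs d
  proof -
    have "{d \<in> D. sat M ((\<lambda>i. xs ! i)(n := d)) \<phi>} \<noteq> {}" using that by blast
    then show ?thesis using some_in_eq[of "{d \<in> D. sat M ((\<lambda>i. xs ! i)(n := d)) \<phi>}"]
      by (auto simp: wit_def Let_def)
  qed
  \<comment> \<open>\<open>N\<close> is the Skolem hull, where the pair of \<open>n\<close> and \<open>\<phi>\<close> is a symbol for a witness of \<open>Ex n \<phi>\<close>.\<close>
  define S :: "(nat \<times> ('f, 'r) fm + 'm, 'r, 'm) struct"
    where "S = \<lparr>Dom = D, FunI = case_sum (\<lambda>(n, \<phi>). wit n \<phi>) (\<lambda>m _. m), RelI = \<lambda>_ _. True\<rparr>"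
  define F where "F = Inl ` ((UNIV :: nat set) \<times> {\<phi>. wf_fm L \<phi>}) \<union> Inr ` A"
  define N where "N = tm_val S (\<lambda>_. m0) ` {t. syms_tm t \<subseteq> F}"
  have "small N"
    unfolding N_def F_def
    by (intro small_image small_terms small_Un small_Times small_nat small_formulas_L A)
  have A_N: "A \<subseteq> N"
  proof
    fix m assume "m \<in> A"
    then have "m = tm_val S (\<lambda>_. m0) (App (Inr m) [])" "syms_tm (App (Inr m) []) \<subseteq> F"
      by (auto simp: S_def F_def)
    then show "m \<in> N" unfolding N_def by blast
  qed
  \<comment> \<open>No induction is required: each symbol takes its values in \<open>D\<close>
    whatever its arguments are.\<close>
  have "tm_val S (\<lambda>_. m0) t \<in> D" if "syms_tm t \<subseteq> F" for t
    using that
  proof (cases t)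
    case (App f ts)
    then show ?thesis using that A(2) wit_D by (auto simp: F_def S_def)
  qed (simp add: m0)
  then have N_D: "N \<subseteq> D" by (auto simp: N_def)
  have m0_N: "m0 \<in> N"
    unfolding N_def by (rule image_eqI[of _ _ "Var 0"]) auto
  have wit_N: "wit n \<phi> xs \<in> N" if \<phi>: "wf_fm L \<phi>" and xs: "set xs \<subseteq> N" for n \<phi> xs
  proof -
    have "\<exists>ts. xs = map (tm_val S (\<lambda>_. m0)) ts \<and> (\<forall>t\<in>set ts. syms_tm t \<subseteq> F)"
      using xs
    proof (induction xs)
      case (Cons x xs)
      then obtain ts where ts: "xs = map (tm_val S (\<lambda>_. m0)) ts" "\<forall>t\<in>set ts. syms_tm t \<subseteq> F" by auto
      obtain t where t: "x = tm_val S (\<lambda>_. m0) t" "syms_tm t \<subseteq> F"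
        using Cons.prems by (auto simp: N_def)
      show ?case using ts t by (intro exI[of _ "t # ts"]) simp
    qed simp
    then obtain ts where ts: "xs = map (tm_val S (\<lambda>_. m0)) ts" "\<forall>t\<in>set ts. syms_tm t \<subseteq> F" by blast
    then have "wit n \<phi> xs = tm_val S (\<lambda>_. m0) (App (Inl (n, \<phi>)) ts)" by (simp add: S_def)
    moreover have "syms_tm (App (Inl (n, \<phi>)) ts) \<subseteq> F" using ts(2) \<phi> by (auto simp: F_def)
    ultimately show ?thesis unfolding N_def by blast
  qed
  \<comment> \<open>This is the Tarski-Vaught criterion for \<open>N\<close>. The list below is long
    enough to cover all free variables, with \<open>m0\<close> at the positions that do not
    matter.\<close>
  have closed: "\<exists>d\<in>N. sat M (v(n := d)) \<phi>"
    if \<phi>: "wf_fm L \<phi>" and v: "v ` (fv \<phi> - {n}) \<subseteq> N" and d: "d \<in> D" "sat M (v(n := d)) \<phi>" for \<phi> v n d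
  proof -
    define k where "k = Suc (Max (insert 0 (fv \<phi>)))"
    have k: "i < k" if "i \<in> fv \<phi>" for i
      using that by (simp add: k_def less_Suc_eq_le)
    define xs where "xs = map (\<lambda>i. if i \<in> fv \<phi> - {n} then v i else m0) [0..<k]"
    have xs: "xs ! i = v i" if "i \<in> fv \<phi>" "i \<noteq> n" for i
      using k[OF that(1)] that by (simp add: xs_def)
    have eq: "sat M ((\<lambda>i. xs ! i)(n := d)) \<phi> \<longleftrightarrow> sat M (v(n := d)) \<phi>" for d
      by (rule sat_cong) (simp add: xs)
    have "set xs \<subseteq> N" using v m0_N by (auto simp: xs_def)
    then have "wit n \<phi> xs \<in> N" by (rule wit_N[OF \<phi>])
    moreover have "sat M (v(n := wit n \<phi> xs)) \<phi>"
      using wit_sat[of d xs n \<phi>] d eq by blast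
    ultimately show ?thesis by blast
  qed
  have "is_struct L (M\<lparr>Dom := N\<rparr>)"
    unfolding is_struct_def
  proof (intro conjI ballI allI impI)
    fix f xs assume f: "f \<in> Funs L" and "length xs = farity L f \<and> set xs \<subseteq> Dom (M\<lparr>Dom := N\<rparr>)"
    then have xs: "length xs = farity L f" "set xs \<subseteq> N" by simp_all
    let ?k = "length xs"
    \<comment> \<open>Function symbols of \<open>L\<close> are absent from the Skolem language.
      Closure under \<open>f\<close> follows from the criterion, because the only witness for the
      last variable is the value of \<open>f\<close>.\<close>
    let ?\<phi> = "Eq (App f (map Var [0..<?k])) (Var ?k) :: ('f, 'r) fm"
    let ?v = "\<lambda>i. xs ! i"
    have vals: "map (tm_val M (?v(?k := d))) (map Var [0..<?k]) = xs" for d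
      by (intro nth_equalityI) auto
    have sat: "sat M (?v(?k := d)) ?\<phi> \<longleftrightarrow> FunI M f xs = d" for d
      using vals[of d] by (simp only: sat.simps tm_val.simps) simp
    have "\<exists>d\<in>N. sat M (?v(?k := d)) ?\<phi>"
    proof (rule closed)
      show "wf_fm L ?\<phi>" using f xs(1) by auto
      show "?v ` (fv ?\<phi> - {?k}) \<subseteq> N" using xs(2) by (auto simp: subset_iff)
      show "FunI M f xs \<in> D" using Fun_in f xs N_D by auto
      show "sat M (?v(?k := FunI M f xs)) ?\<phi>" by (simp only: sat)
    qed
    then show "FunI (M\<lparr>Dom := N\<rparr>) f xs \<in> Dom (M\<lparr>Dom := N\<rparr>)" unfolding sat by simp
  qed (use m0_N in auto)
  moreover have "sat (M\<lparr>Dom := N\<rparr>) v \<phi> \<longleftrightarrow> sat M v \<phi>" if "wf_fm L \<phi>" "range v \<subseteq> N" for \<phi> v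
  proof -
    have tm: "tm_val (M\<lparr>Dom := N\<rparr>) v t = tm_val M v t" for v t
    proof (induction t)
      case (App f ts)
      then have "map (tm_val (M\<lparr>Dom := N\<rparr>) v) ts = map (tm_val M v) ts" by simp
      then show ?case by (simp only: tm_val.simps) simp
    qed simp
    show ?thesis using that
    proof (induction \<phi> arbitrary: v)
      case (Rel r ts)
      have "map (tm_val (M\<lparr>Dom := N\<rparr>) v) ts = map (tm_val M v) ts" by (simp add: tm)
      then show ?case by (simp only: sat.simps) simp
    next
      case (Ex n \<phi>)
      have IH: "sat (M\<lparr>Dom := N\<rparr>) (v(n := d)) \<phi> \<longleftrightarrow> sat M (v(n := d)) \<phi>" if "d \<in> N" for d
        using Ex.prems that by (intro Ex.IH) auto
      have "v ` (fv \<phi> - {n}) \<subseteq> N" using Ex.prems(2) by blast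
      then have "(\<exists>d\<in>D. sat M (v(n := d)) \<phi>) \<longleftrightarrow> (\<exists>d\<in>N. sat M (v(n := d)) \<phi>)"
        using closed[of \<phi> v n] Ex.prems(1) N_D by auto
      then show ?case using IH by simp
    qed (simp_all add: tm)
  qed
  ultimately have "elementary_submodel L M N" using N_D by (auto simp: elementary_submodel_def)
  then show thesis using \<open>small N\<close> A_N by (intro that)
qed

text \<open>Conjugation turns the stabiliser of a model into the stabiliser of its image, so this is
  what keeps generators of the Lascar group in the group under conjugation.\<close>

lemma elementary_submodel_aut_image:
  assumes \<sigma>: "\<sigma> \<in> G" and N: "elementary_submodel L M N"
  shows "elementary_submodel L M (\<sigma> ` N)"
proof -
  let ?A = "M\<lparr>Dom := N\<rparr>" and ?B = "M\<lparr>Dom := \<sigma> ` N\<rparr>"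
  have N_D: "N \<subseteq> D" and A: "is_struct L ?A"
    and elem: "\<And>\<phi> v. wf_fm L \<phi> \<Longrightarrow> range v \<subseteq> N \<Longrightarrow> sat ?A v \<phi> \<longleftrightarrow> sat M v \<phi>"
    using N by (auto simp: elementary_submodel_def)
  have "bij_betw \<sigma> N (\<sigma> ` N)"
    using aut_bij[OF \<sigma>] N_D by (auto simp: bij_betw_def intro: inj_on_subset)
  moreover have "\<sigma> (FunI M f xs) = FunI M f (map \<sigma> xs)"
    if "f \<in> Funs L" "length xs = farity L f" "set xs \<subseteq> N" for f xs
    using aut_Fun[OF \<sigma> that(1,2)] that(3) N_D by blast
  moreover have "RelI M r (map \<sigma> xs) \<longleftrightarrow> RelI M r xs"
    if "r \<in> Rels L" "length xs = rarity L r" "set xs \<subseteq> N" for r xs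
    using aut_Rel[OF \<sigma> that(1,2)] that(3) N_D by blast
  ultimately have iso: "is_iso L \<sigma> ?A ?B" by (simp add: is_iso_def)
  have lift: "\<exists>u. range u \<subseteq> N \<and> v = \<sigma> \<circ> u" if v: "range v \<subseteq> \<sigma> ` N" for v :: "'x \<Rightarrow> 'm"
  proof -
    have "\<forall>x. \<exists>y. y \<in> N \<and> v x = \<sigma> y" using v by blast
    then obtain u where "\<forall>x. u x \<in> N \<and> v x = \<sigma> (u x)" by (rule choice[THEN exE])
    then show ?thesis by (intro exI[of _ u]) auto
  qed
  have "FunI M f ys \<in> \<sigma> ` N" if f: "f \<in> Funs L" and ys: "length ys = farity L f" "set ys \<subseteq> \<sigma> ` N" for f ys
  proof -
    define xs where "xs = map (inv_into N \<sigma>) ys"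
    have xs: "set xs \<subseteq> N" using ys(2) by (auto simp: xs_def inv_into_into subset_iff)
    have "map \<sigma> xs = ys"
      unfolding xs_def map_map by (rule map_idI) (use ys(2) in \<open>auto simp: f_inv_into_f\<close>)
    moreover have "length xs = farity L f" using ys(1) by (simp add: xs_def)
    moreover have "FunI M f xs \<in> N" using A f xs \<open>length xs = farity L f\<close> by (simp add: is_struct_def)
    ultimately show ?thesis using aut_Fun[OF \<sigma> f, of xs] xs N_D by (metis image_eqI subset_trans)
  qed
  moreover have "N \<noteq> {}" using A by (simp add: is_struct_def)
  ultimately have "is_struct L ?B" by (simp add: is_struct_def)
  moreover have "\<sigma> ` N \<subseteq> D" using N_D aut_in[OF \<sigma>] by blast
  moreover have "sat ?B v \<phi> \<longleftrightarrow> sat M v \<phi>" if \<phi>: "wf_fm L \<phi>" and v: "range v \<subseteq> \<sigma> ` N" for \<phi> v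
  proof -
    obtain u where u: "range u \<subseteq> N" "v = \<sigma> \<circ> u" using lift[OF v] by (elim exE conjE)
    have "sat ?B (\<sigma> \<circ> u) \<phi> \<longleftrightarrow> sat ?A u \<phi>"
      by (rule sat_iso[OF iso A \<phi>]) (use u(1) in auto)
    also have "\<dots> \<longleftrightarrow> sat M u \<phi>" by (rule elem[OF \<phi> u(1)])
    also have "\<dots> \<longleftrightarrow> sat M (\<sigma> \<circ> u) \<phi>"
      by (rule sat_iso[OF aut_iso[OF \<sigma>] struct \<phi>, symmetric]) (use u(1) N_D in auto)
    finally show ?thesis unfolding u(2) .
  qed
  ultimately show ?thesis by (simp add: elementary_submodel_def)
qed

text \<open>There are few types over \<open>A\<close> of tuples indexed by \<open>A\<close>.\<close>

lemma small_double_cosets: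
  assumes A: "small A" "A \<subseteq> D"
  obtains R where "R \<subseteq> G" "small R"
    "\<forall>g\<in>G. \<exists>r\<in>R. \<exists>h\<in>Stab A. \<exists>h'\<in>Stab A. g = h \<otimes>\<^bsub>BG\<^esub> r \<otimes>\<^bsub>BG\<^esub> h'"
proof -
  obtain m0 where m0: "m0 \<in> D" using D_nonempty by blast
  define V :: "('m + 'm) set" where "V = Inl ` A \<union> Inr ` A"
  \<comment> \<open>A formula about \<open>A\<close> and its image is coded by the formula and a
    list naming its free variables; \<open>Inl m0\<close> fills the positions of the other
    variables. The type of the pair is then a subset of \<open>Z\<close>.\<close>
  define Z where "Z = {\<phi>. wf_fm L \<phi>} \<times> lists (insert (Inl m0) V)"
  define tp where "tp g = {(\<phi>, ws) \<in> Z. sat M (\<lambda>i. case_sum id g (ws ! i)) \<phi>}" for g :: "'m \<Rightarrow> 'm"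
  have V: "small V" unfolding V_def by (rule small_Un[OF small_image[OF A(1)] small_image[OF A(1)]])
  have "small (insert (Inl m0) V)"
    using small_Un[OF small_finite[of "{Inl m0}"] V] by simp
  then have "small Z"
    unfolding Z_def by (rule small_Times[OF small_formulas_L small_lists])
  then have "small (Pow Z)" by (rule strong_limit_small_Pow[OF strong_limit])
  moreover have "tp ` G \<subseteq> Pow Z" by (auto simp: tp_def)
  ultimately have tps: "small (tp ` G)" by (rule small_subset[rotated])
  define rep where "rep p = (SOME g. g \<in> G \<and> tp g = p)" for p
  have rep: "rep p \<in> G" "tp (rep p) = p" if "p \<in> tp ` G" for p
  proof -
    have "\<exists>g. g \<in> G \<and> tp g = p" using that by blast
    then have "rep p \<in> G \<and> tp (rep p) = p" unfolding rep_def by (rule someI_ex)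
    then show "rep p \<in> G" "tp (rep p) = p" by auto
  qed
  show thesis
  proof (rule that)
    show "rep ` tp ` G \<subseteq> G" using rep(1) by blast
    show "small (rep ` tp ` G)" by (rule small_image[OF tps])
    show "\<forall>g\<in>G. \<exists>r\<in>rep ` tp ` G. \<exists>h\<in>Stab A. \<exists>h'\<in>Stab A. g = h \<otimes>\<^bsub>BG\<^esub> r \<otimes>\<^bsub>BG\<^esub> h'"
    proof
      fix g assume g: "g \<in> G"
      define r where "r = rep (tp g)"
      have r: "r \<in> G" "tp r = tp g" unfolding r_def using rep[OF imageI[OF g]] by auto
      have x: "case_sum id r ` V \<subseteq> D" and y: "case_sum id g ` V \<subseteq> D"
        using A(2) aut_in[OF r(1)] aut_in[OF g] by (auto simp: V_def)
      have "P (case_sum id r) \<longrightarrow> P (case_sum id g)" if P: "P \<in> definable L M V" for P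
      proof -
        obtain \<phi> w where \<phi>: "wf_fm L \<phi>" "w ` fv \<phi> \<subseteq> V" "\<And>f. P f \<longleftrightarrow> sat M (f \<circ> w) \<phi>"
          using P by (elim definableE) blast
        define k where "k = Suc (Max (insert 0 (fv \<phi>)))"
        have k: "i < k" if "i \<in> fv \<phi>" for i
          using that by (simp add: k_def less_Suc_eq_le)
        define ws where "ws = map (\<lambda>i. if i \<in> fv \<phi> then w i else Inl m0) [0..<k]"
        have ws: "ws ! i = w i" if "i \<in> fv \<phi>" for i
          using k[OF that] that by (simp add: ws_def)
        have "w i \<in> V" if "i \<in> fv \<phi>" for i using \<phi>(2) that by blast
        then have "(\<phi>, ws) \<in> Z" using \<phi>(1) by (auto simp: Z_def ws_def)
        moreover have "sat M (\<lambda>i. f (ws ! i)) \<phi> \<longleftrightarrow> P f" for f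
          unfolding \<phi>(3) by (rule sat_cong) (simp add: ws)
        ultimately have "(\<phi>, ws) \<in> tp f \<longleftrightarrow> P (case_sum id f)" for f by (simp add: tp_def)
        then show ?thesis using r(2) by blast
      qed
      then have "\<forall>P\<in>definable L M V. P (case_sum id r) \<longrightarrow> P (case_sum id g)" by (rule ballI)
      then obtain \<tau> where \<tau>: "\<tau> \<in> G" "\<forall>v\<in>V. \<tau> (case_sum id r v) = case_sum id g v"
        by (rule homogeneity[OF V x y])
      have \<tau>_A: "\<tau> a = a" "\<tau> (r a) = g a" if "a \<in> A" for a
        using bspec[OF \<tau>(2), of "Inl a"] bspec[OF \<tau>(2), of "Inr a"] that by (simp_all add: V_def)
      let ?tr = "\<tau> \<otimes>\<^bsub>BG\<^esub> r"
      have tr: "?tr \<in> G" by (rule aut_mult[OF \<tau>(1) r(1)])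
      \<comment> \<open>Equality of types gives \<open>\<tau>\<close> fixing \<open>A\<close> such
        that \<open>\<tau>\<close> after \<open>r\<close> agrees with \<open>g\<close> on
        \<open>A\<close>; the remaining discrepancy is therefore a right factor in
        \<open>Stab A\<close>.\<close>
      define h' where "h' = inv\<^bsub>BG\<^esub> ?tr \<otimes>\<^bsub>BG\<^esub> g"
      have "h' a = a" if "a \<in> A" for a
      proof -
        have a: "a \<in> D" using that A(2) by blast
        have "h' a = (inv\<^bsub>BG\<^esub> ?tr) (g a)" unfolding h'_def by (rule mult_apply[OF aut_inv[OF tr] g a])
        also have "g a = ?tr a" using mult_apply[OF \<tau>(1) r(1) a] \<tau>_A(2)[OF that] by simp
        also have "(inv\<^bsub>BG\<^esub> ?tr) (?tr a) = a" by (rule inv_apply[OF tr a])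
        finally show ?thesis .
      qed
      then have "h' \<in> Stab A" unfolding Stab_def using aut_mult[OF aut_inv[OF tr] g] by (simp add: h'_def)
      moreover have "\<tau> \<in> Stab A" using \<tau>(1) \<tau>_A(1) by (simp add: Stab_def)
      moreover have "g = ?tr \<otimes>\<^bsub>BG\<^esub> h'"
        unfolding h'_def Bij.m_assoc[OF aut_Bij[OF tr] aut_Bij[OF aut_inv[OF tr]] aut_Bij[OF g], symmetric]
          Bij.r_inv[OF aut_Bij[OF tr]] by (rule Bij.l_one[OF aut_Bij[OF g], symmetric])
      moreover have "r \<in> rep ` tp ` G" unfolding r_def using g by blast
      ultimately show "\<exists>r\<in>rep ` tp ` G. \<exists>h\<in>Stab A. \<exists>h'\<in>Stab A. g = h \<otimes>\<^bsub>BG\<^esub> r \<otimes>\<^bsub>BG\<^esub> h'"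
        by blast
    qed
  qed
qed

section \<open>Boundedness\<close>

abbreviation fixing :: "('k \<rightharpoonup> 'm) set set \<Rightarrow> ('m \<Rightarrow> 'm) set" where
  "fixing B \<equiv> fixing_auts L M B"

abbreviation bdd :: "('k \<rightharpoonup> 'm) set set \<Rightarrow> ('k \<rightharpoonup> 'm) set set" where
  "bdd B \<equiv> bddu L \<kappa> M B"

lemma fixing_G: "\<sigma> \<in> fixing B \<Longrightarrow> \<sigma> \<in> G"
  by (simp add: fixing_auts_def)

lemma fixing_act: "\<sigma> \<in> fixing B \<Longrightarrow> e \<in> B \<Longrightarrow> act \<sigma> e = e"
  by (simp add: fixing_auts_def)

lemma fixing_one: "B \<subseteq> sets_of_tuples \<Longrightarrow> \<one>\<^bsub>BG\<^esub> \<in> fixing B"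
  using aut_one act_one by (auto simp: fixing_auts_def)

lemma fixing_inv:
  assumes "B \<subseteq> sets_of_tuples" "\<sigma> \<in> fixing B" shows "inv\<^bsub>BG\<^esub> \<sigma> \<in> fixing B"
proof -
  have "act (inv\<^bsub>BG\<^esub> \<sigma>) e = e" if e: "e \<in> B" for e
  proof -
    have "e \<in> sets_of_tuples" using assms(1) e by blast
    from act_inv_act[OF fixing_G[OF assms(2)] this] show ?thesis
      unfolding fixing_act[OF assms(2) e] .
  qed
  then show ?thesis using aut_inv[OF fixing_G[OF assms(2)]] by (simp add: fixing_auts_def)
qed

lemma bdd_ultra: "e \<in> bdd B \<Longrightarrow> e \<in> ultra"
  by (simp add: bddu_def)

lemma bdd_sets: "bdd B \<subseteq> sets_of_tuples"
  using bdd_ultra ultra_sets_of_tuples by blast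

lemma bdd_orbit: "e \<in> bdd B \<Longrightarrow> small ((\<lambda>\<sigma>. act \<sigma> e) ` fixing B)"
  by (simp add: bddu_def bounded_over_def)

lemma bddI: "e \<in> ultra \<Longrightarrow> small ((\<lambda>\<sigma>. act \<sigma> e) ` fixing B) \<Longrightarrow> e \<in> bdd B"
  by (simp add: bddu_def bounded_over_def)

lemma bdd_mono: "A \<subseteq> B \<Longrightarrow> e \<in> bdd A \<Longrightarrow> e \<in> bdd B"
proof (rule bddI[OF bdd_ultra])
  assume "A \<subseteq> B" "e \<in> bdd A"
  moreover have "fixing B \<subseteq> fixing A" using \<open>A \<subseteq> B\<close> by (auto simp: fixing_auts_def)
  ultimately show "small ((\<lambda>\<sigma>. act \<sigma> e) ` fixing B)" by (intro small_subset[OF image_mono bdd_orbit])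
qed

lemma bdd_self: "a \<in> ultra \<Longrightarrow> a \<in> bdd {a}"
proof (rule bddI)
  have "(\<lambda>\<sigma>. act \<sigma> a) ` fixing {a} \<subseteq> {a}" by (auto simp: fixing_auts_def)
  then show "small ((\<lambda>\<sigma>. act \<sigma> a) ` fixing {a})" by (rule small_subset[OF _ small_finite]) simp
qed

section \<open>Boundedness under conjugation\<close>

lemma act_conj:
  assumes "\<sigma> \<in> G" "g \<in> G" "e \<in> sets_of_tuples"
  shows "act \<sigma> (act g e) = act g (act (inv\<^bsub>BG\<^esub> g \<otimes>\<^bsub>BG\<^esub> \<sigma> \<otimes>\<^bsub>BG\<^esub> g) e)"
proof -
  have ge: "act g e \<in> sets_of_tuples" by (rule act_sets_of_tuples[OF assms(2,3)])
  have "act (inv\<^bsub>BG\<^esub> g \<otimes>\<^bsub>BG\<^esub> \<sigma> \<otimes>\<^bsub>BG\<^esub> g) e = act (inv\<^bsub>BG\<^esub> g) (act \<sigma> (act g e))"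
    unfolding act_mult[OF aut_mult[OF aut_inv[OF assms(2)] assms(1)] assms(2,3)]
    by (rule act_mult[OF aut_inv[OF assms(2)] assms(1) ge])
  then show ?thesis
    using act_act_inv[OF assms(2) act_sets_of_tuples[OF assms(1) ge]] by simp
qed

lemma fixing_conj:
  assumes "b \<in> ultra" "g \<in> G" "\<sigma> \<in> fixing {act g b}"
  shows "inv\<^bsub>BG\<^esub> g \<otimes>\<^bsub>BG\<^esub> \<sigma> \<otimes>\<^bsub>BG\<^esub> g \<in> fixing {b}"
proof -
  have \<sigma>: "\<sigma> \<in> G" "act \<sigma> (act g b) = act g b" using assms(3) by (auto simp: fixing_auts_def)
  let ?c = "inv\<^bsub>BG\<^esub> g \<otimes>\<^bsub>BG\<^esub> \<sigma> \<otimes>\<^bsub>BG\<^esub> g"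
  have c: "?c \<in> G" by (rule aut_mult[OF aut_mult[OF aut_inv[OF assms(2)] \<sigma>(1)] assms(2)])
  have b: "b \<in> sets_of_tuples" by (rule ultra_sets_of_tuples[OF assms(1)])
  have "act g (act ?c b) = act g b" using act_conj[OF \<sigma>(1) assms(2) b] \<sigma>(2) by simp
  then have "act ?c b = b"
    by (rule act_inject[OF assms(2) act_sets_of_tuples[OF c b] b])
  then show ?thesis using c by (simp add: fixing_auts_def)
qed

lemma bdd_act:
  assumes "b \<in> ultra" "g \<in> G" "e \<in> bdd {b}" shows "act g e \<in> bdd {act g b}"
proof (rule bddI)
  have e: "e \<in> ultra" by (rule bdd_ultra[OF assms(3)])
  show "act g e \<in> ultra" by (rule act_ultra[OF assms(2) e])
  have "(\<lambda>\<sigma>. act \<sigma> (act g e)) ` fixing {act g b} \<subseteq> act g ` (\<lambda>\<sigma>. act \<sigma> e) ` fixing {b}"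
  proof (rule image_subsetI)
    fix \<sigma> assume \<sigma>: "\<sigma> \<in> fixing {act g b}"
    show "act \<sigma> (act g e) \<in> act g ` (\<lambda>\<sigma>. act \<sigma> e) ` fixing {b}"
      unfolding act_conj[OF fixing_G[OF \<sigma>] assms(2) ultra_sets_of_tuples[OF e]]
      by (rule imageI[OF imageI[OF fixing_conj[OF assms(1,2) \<sigma>]]])
  qed
  then show "small ((\<lambda>\<sigma>. act \<sigma> (act g e)) ` fixing {act g b})"
    by (rule small_subset[OF _ small_image[OF bdd_orbit[OF assms(3)]]])
qed

lemma bdd_act_inv:
  assumes "b \<in> ultra" "g \<in> G" "e \<in> bdd {act g b}" shows "act (inv\<^bsub>BG\<^esub> g) e \<in> bdd {b}"
  using bdd_act[OF act_ultra[OF assms(2,1)] aut_inv[OF assms(2)] assms(3)]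
  unfolding act_inv_act[OF assms(2) ultra_sets_of_tuples[OF assms(1)]] .

lemma fixing_bdd_act:
  assumes "b \<in> ultra" "g \<in> G" "\<sigma> \<in> fixing (bdd {b})"
  shows "g \<otimes>\<^bsub>BG\<^esub> \<sigma> \<otimes>\<^bsub>BG\<^esub> inv\<^bsub>BG\<^esub> g \<in> fixing (bdd {act g b})"
proof -
  have \<sigma>: "\<sigma> \<in> G" by (rule fixing_G[OF assms(3)])
  have "act (g \<otimes>\<^bsub>BG\<^esub> \<sigma> \<otimes>\<^bsub>BG\<^esub> inv\<^bsub>BG\<^esub> g) e = e" if e: "e \<in> bdd {act g b}" for e
  proof -
    have es: "e \<in> sets_of_tuples" using bdd_sets e by blast
    have "act (g \<otimes>\<^bsub>BG\<^esub> \<sigma> \<otimes>\<^bsub>BG\<^esub> inv\<^bsub>BG\<^esub> g) e = act (g \<otimes>\<^bsub>BG\<^esub> \<sigma>) (act (inv\<^bsub>BG\<^esub> g) e)"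
      by (rule act_mult[OF aut_mult[OF assms(2) \<sigma>] aut_inv[OF assms(2)] es])
    also have "\<dots> = act g (act \<sigma> (act (inv\<^bsub>BG\<^esub> g) e))"
      by (rule act_mult[OF assms(2) \<sigma> act_sets_of_tuples[OF aut_inv[OF assms(2)] es]])
    also have "\<dots> = act g (act (inv\<^bsub>BG\<^esub> g) e)"
      unfolding fixing_act[OF assms(3) bdd_act_inv[OF assms(1,2) e]] ..
    also have "\<dots> = e" by (rule act_act_inv[OF assms(2) es])
    finally show ?thesis .
  qed
  then show ?thesis using aut_mult[OF aut_mult[OF assms(2) \<sigma>] aut_inv[OF assms(2)]]
    by (simp add: fixing_auts_def)
qed

text \<open>After one automorphism is chosen for each conjugate of \<open>a\<close> over
  \<open>B\<close>, any other automorphism over \<open>B\<close> is a chosen one times one fixing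
  \<open>a\<close>. The orbit of \<open>e\<close> is thus an image of the product of two small
  orbits.\<close>

lemma bounded_over_trans:
  assumes B: "B \<subseteq> sets_of_tuples" and a: "a \<in> ultra"
    and a_B: "bounded_over L \<kappa> M B a" and e: "e \<in> bdd {a}"
  shows "bounded_over L \<kappa> M B e"
proof -
  define Q where "Q = (\<lambda>\<sigma>. act \<sigma> a) ` fixing B"
  define s where "s q = (SOME \<tau>. \<tau> \<in> fixing B \<and> act \<tau> a = q)" for q
  have s: "s q \<in> fixing B" "act (s q) a = q" if "q \<in> Q" for q
  proof -
    have "\<exists>\<tau>. \<tau> \<in> fixing B \<and> act \<tau> a = q" using that by (auto simp: Q_def)
    then have "s q \<in> fixing B \<and> act (s q) a = q" unfolding s_def by (rule someI_ex)
    then show "s q \<in> fixing B" "act (s q) a = q" by auto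
  qed
  let ?O = "(\<lambda>\<sigma>. act \<sigma> e) ` fixing {a}"
  have es: "e \<in> sets_of_tuples" using bdd_sets e by blast
  have "(\<lambda>\<sigma>. act \<sigma> e) ` fixing B \<subseteq> (\<lambda>(q, p). act (s q) p) ` (Q \<times> ?O)"
  proof (rule image_subsetI)
    fix \<sigma> assume \<sigma>: "\<sigma> \<in> fixing B"
    define q where "q = act \<sigma> a"
    have q: "q \<in> Q" using \<sigma> by (simp add: Q_def q_def)
    let ?t = "inv\<^bsub>BG\<^esub> (s q) \<otimes>\<^bsub>BG\<^esub> \<sigma>"
    have sG: "s q \<in> G" "inv\<^bsub>BG\<^esub> (s q) \<in> G" "\<sigma> \<in> G"
      using fixing_G[OF s(1)[OF q]] aut_inv fixing_G[OF \<sigma>] by auto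
    have t: "act ?t x = act (inv\<^bsub>BG\<^esub> (s q)) (act \<sigma> x)" if "x \<in> sets_of_tuples" for x
      by (rule act_mult[OF sG(2,3) that])
    have "act \<sigma> a = act (s q) a" using s(2)[OF q] by (simp only: q_def)
    with t[OF ultra_sets_of_tuples[OF a]] act_inv_act[OF sG(1) ultra_sets_of_tuples[OF a]]
    have "act ?t a = a" by (simp only:)
    then have "?t \<in> fixing {a}" using aut_mult[OF sG(2,3)] by (simp add: fixing_auts_def)
    then have "act ?t e \<in> ?O" by (rule imageI)
    moreover have "act \<sigma> e = act (s q) (act ?t e)"
      unfolding t[OF es] by (rule act_act_inv[OF sG(1) act_sets_of_tuples[OF sG(3) es], symmetric])
    ultimately show "act \<sigma> e \<in> (\<lambda>(q, p). act (s q) p) ` (Q \<times> ?O)"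
      using q by (intro image_eqI[of _ _ "(q, act ?t e)"]) auto
  qed
  moreover have "small Q" using a_B by (simp add: bounded_over_def Q_def)
  ultimately show ?thesis unfolding bounded_over_def
    by (rule small_subset[OF _ small_image[OF small_Times[OF _ bdd_orbit[OF e]]]])
qed

lemma small_ran: "small I \<Longrightarrow> c \<in> tuples M I \<Longrightarrow> small (ran c)"
proof -
  assume "small I" "c \<in> tuples M I"
  moreover from this have "ran c \<subseteq> (\<lambda>i. the (c i)) ` I"
    by (force simp: ran_def tuples_def dom_def)
  ultimately show ?thesis by (blast intro: small_subset[OF _ small_image])
qed

text \<open>A representative of \<open>b\<close> inside \<open>N\<close> places
  \<open>Stab N\<close> in the stabiliser of \<open>b\<close>, so everything bounded over
  \<open>b\<close> has a small orbit under \<open>Stab N\<close>; \<open>bounded_orbit_fixed\<close>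
  then makes this orbit trivial.\<close>

lemma Stab_model_fixing_bdd:
  assumes b: "b \<in> ultra"
  obtains A where "small A" "A \<subseteq> D" "\<And>N. elementary_submodel L M N \<Longrightarrow> small N \<Longrightarrow> A \<subseteq> N \<Longrightarrow>
    Stab N \<subseteq> fixing {b} \<inter> fixing (bdd {b})"
proof -
  obtain I E c where I: "small I" and E: "invariant_equiv L M I E" and c: "c \<in> tuples M I"
    and b_c: "b = E `` {c}" by (rule ultraE[OF b])
  show thesis
  proof (rule that[of "ran c"])
    show "small (ran c)" by (rule small_ran[OF I c])
    show "ran c \<subseteq> D" using c by (simp add: tuples_def)
    fix N assume N: "elementary_submodel L M N" "small N" "ran c \<subseteq> N"
    have 1: "Stab N \<subseteq> fixing {b}"
    proof
      fix \<sigma> assume \<sigma>: "\<sigma> \<in> Stab N"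
      then have "\<sigma> \<in> Stab (ran c)" using N(3) by (auto simp: Stab_def)
      then have "act \<sigma> b = b" unfolding b_c by (rule act_fixing_class[OF _ E c])
      then show "\<sigma> \<in> fixing {b}" using \<sigma> by (simp add: fixing_auts_def Stab_def)
    qed
    have "act \<sigma> e = e" if "\<sigma> \<in> Stab N" "e \<in> bdd {b}" for \<sigma> e
      by (rule bounded_orbit_fixed[OF N(1,2) bdd_ultra[OF that(2)] _ that(1)])
        (rule small_subset[OF image_mono[OF 1] bdd_orbit[OF that(2)]])
    then have "Stab N \<subseteq> fixing (bdd {b})" by (auto simp: fixing_auts_def Stab_def)
    with 1 show "Stab N \<subseteq> fixing {b} \<inter> fixing (bdd {b})" by blast
  qed
qed

text \<open>Write g fixing \<open>b\<close> as h r h' with h and h' in \<open>Stab N\<close>. Since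
  h and h' fix \<open>b\<close>, so does r, whence the conjugate of h by the inverse of r again
  fixes all of \<open>bdd {b}\<close> and therefore \<open>e\<close>. So h fixes the image of
  \<open>e\<close> under r, h' fixes \<open>e\<close>, and g acts on \<open>e\<close> as r
  does.\<close>

lemma bdd_if_fixed:
  assumes b: "b \<in> ultra" and e: "e \<in> ultra" and fixed: "\<And>\<sigma>. \<sigma> \<in> fixing (bdd {b}) \<Longrightarrow> act \<sigma> e = e"
  shows "e \<in> bdd {b}"
proof (rule bddI[OF e])
  obtain A where A: "small A" "A \<subseteq> D" "\<And>N. elementary_submodel L M N \<Longrightarrow> small N \<Longrightarrow> A \<subseteq> N \<Longrightarrow>
    Stab N \<subseteq> fixing {b} \<inter> fixing (bdd {b})" using Stab_model_fixing_bdd[OF b] by metis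
  obtain N where N: "elementary_submodel L M N" "small N" "A \<subseteq> N"
    by (rule small_elementary_submodel[OF A(1,2)])
  have Stab: "Stab N \<subseteq> fixing {b} \<inter> fixing (bdd {b})" by (rule A(3)[OF N])
  have N_D: "N \<subseteq> D" using elementary_submodel_Dom[OF N(1)] by blast
  obtain R where R: "R \<subseteq> G" "small R"
    "\<forall>g\<in>G. \<exists>r\<in>R. \<exists>h\<in>Stab N. \<exists>h'\<in>Stab N. g = h \<otimes>\<^bsub>BG\<^esub> r \<otimes>\<^bsub>BG\<^esub> h'"
    by (rule small_double_cosets[OF N(2) N_D])
  have bs: "b \<in> sets_of_tuples" and es: "e \<in> sets_of_tuples"
    using ultra_sets_of_tuples b e by blast+
  have "(\<lambda>\<sigma>. act \<sigma> e) ` fixing {b} \<subseteq> (\<lambda>r. act r e) ` R"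
  proof (rule image_subsetI)
    fix g assume g: "g \<in> fixing {b}"
    obtain r h h' where r: "r \<in> R" and h: "h \<in> Stab N" "h' \<in> Stab N"
      and eq: "g = h \<otimes>\<^bsub>BG\<^esub> r \<otimes>\<^bsub>BG\<^esub> h'"
      using bspec[OF R(3) fixing_G[OF g]] by (elim bexE)
    have hG: "h \<in> G" "h' \<in> G" "r \<in> G" using h r R(1) by (auto simp: Stab_def)
    have act_g: "act g x = act h (act r (act h' x))" if "x \<in> sets_of_tuples" for x
      unfolding eq act_mult[OF aut_mult[OF hG(1,3)] hG(2) that]
      by (rule act_mult[OF hG(1,3) act_sets_of_tuples[OF hG(2) that]])
    have hb: "act h b = b" "act h' b = b" using h Stab by (auto simp: fixing_auts_def)
    have rbs: "act r b \<in> sets_of_tuples" by (rule act_sets_of_tuples[OF hG(3) bs])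
    have "act h (act r b) = act h b"
      using act_g[OF bs] g hb by (simp add: fixing_auts_def)
    then have rb: "act r b = b" by (rule act_inject[OF hG(1) rbs bs])
    have "act (inv\<^bsub>BG\<^esub> r) b = b" using act_inv_act[OF hG(3) bs] unfolding rb .
    then have "inv\<^bsub>BG\<^esub> r \<otimes>\<^bsub>BG\<^esub> h \<otimes>\<^bsub>BG\<^esub> inv\<^bsub>BG\<^esub> (inv\<^bsub>BG\<^esub> r) \<in> fixing (bdd {b})"
      using fixing_bdd_act[OF b aut_inv[OF hG(3)], of h] h(1) Stab by auto
    then have "act (inv\<^bsub>BG\<^esub> r \<otimes>\<^bsub>BG\<^esub> h \<otimes>\<^bsub>BG\<^esub> r) e = e"
      unfolding aut_inv_inv[OF hG(3)] by (rule fixed)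
    then have "act h (act r e) = act r e"
      using act_conj[OF hG(1,3) es] by simp
    moreover have "act h' e = e" by (rule fixed) (use h(2) Stab in blast)
    ultimately have "act g e = act r e" using act_g[OF es] by simp
    then show "act g e \<in> (\<lambda>r. act r e) ` R" using r by blast
  qed
  then show "small ((\<lambda>\<sigma>. act \<sigma> e) ` fixing {b})" by (rule small_subset[OF _ small_image[OF R(2)]])
qed

lemma inv_mult_Stab:
  assumes t: "x \<in> tuples M I" and g: "g \<in> G" "g' \<in> G" and eq: "act_tuple g x = act_tuple g' x"
  shows "inv\<^bsub>BG\<^esub> g \<otimes>\<^bsub>BG\<^esub> g' \<in> Stab (ran x)"
proof -
  have "(inv\<^bsub>BG\<^esub> g \<otimes>\<^bsub>BG\<^esub> g') m = m" if m_ran: "m \<in> ran x" for m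
  proof -
    have m: "m \<in> D" using t m_ran by (auto simp: tuples_def)
    obtain i where "x i = Some m" using m_ran by (auto simp: ran_def)
    then have "g' m = g m" using fun_cong[OF eq, of i] by (simp add: act_tuple_def)
    then have "(inv\<^bsub>BG\<^esub> g \<otimes>\<^bsub>BG\<^esub> g') m = (inv\<^bsub>BG\<^esub> g) (g m)"
      using mult_apply[OF aut_inv[OF g(1)] g(2) m] by (simp only:)
    then show ?thesis using inv_apply[OF g(1) m] by (rule trans)
  qed
  then show ?thesis using aut_mult[OF aut_inv[OF g(1)] g(2)] by (simp only: Stab_def mem_Collect_eq) blast
qed

text \<open>With \<open>t\<close> enumerating \<open>N\<close>, the images of \<open>t\<close> under
  g and g' are related if the quotient of g' by g, with the inverse of g on the left, lies in
  \<open>K\<close>. Left translation does not change this quotient, so the relation is invariant;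
  the class of \<open>t\<close> is then stabilised by \<open>K\<close> alone.\<close>

lemma ultraimaginary_with_stabilizer:
  assumes K: "subgroup K BG" "K \<subseteq> G" and N: "small N" "N \<subseteq> D" "Stab N \<subseteq> K"
  obtains e where "e \<in> ultra" "\<And>g. g \<in> G \<Longrightarrow> act g e = e \<longleftrightarrow> g \<in> K"
proof -
  let ?inv = "\<lambda>g. inv\<^bsub>BG\<^esub> g"
  \<comment> \<open>Indices of tuples come from the type of \<kappa>, hence the detour through an
    injection of \<open>N\<close>.\<close>
  obtain f :: "'m \<Rightarrow> 'k" where f: "inj_on f N" using small_inj_into_Field[OF N(1)] by blast
  define J where "J = f ` N"
  define t where "t i = (if i \<in> J then Some (inv_into N f i) else None)" for i
  have J: "small J" unfolding J_def by (rule small_image[OF N(1)])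
  have ran_t: "ran t = N"
  proof
    show "ran t \<subseteq> N" by (auto simp: ran_def t_def J_def f)
    show "N \<subseteq> ran t"
    proof
      fix m assume "m \<in> N"
      then have "t (f m) = Some m" by (simp add: t_def J_def f)
      then show "m \<in> ran t" by (rule ranI)
    qed
  qed
  have t: "t \<in> tuples M J" using ran_t N(2) by (auto simp: tuples_def t_def dom_def)
  have ran_t_D: "ran t \<subseteq> D" using ran_t N(2) by simp
  define rel where "rel x y \<longleftrightarrow> (\<exists>g\<in>G. \<exists>g'\<in>G. x = act_tuple g t \<and> y = act_tuple g' t \<and> ?inv g \<otimes>\<^bsub>BG\<^esub> g' \<in> K)" for x y
  have relI: "rel (act_tuple g t) (act_tuple g' t)" if "g \<in> G" "g' \<in> G" "?inv g \<otimes>\<^bsub>BG\<^esub> g' \<in> K" for g g'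
    unfolding rel_def using that by (intro bexI[of _ g] bexI[of _ g'] conjI refl)
  \<comment> \<open>Independence of the chosen automorphisms: two with the same value at
    \<open>t\<close> differ by an element of \<open>Stab N\<close> on the right, which
    \<open>K\<close> absorbs.\<close>
  have relE: "?inv g \<otimes>\<^bsub>BG\<^esub> g' \<in> K" if gg: "g \<in> G" "g' \<in> G" and r: "rel (act_tuple g t) (act_tuple g' t)" for g g'
  proof -
    obtain h h' where h: "h \<in> G" "h' \<in> G" "act_tuple g t = act_tuple h t" "act_tuple h' t = act_tuple g' t"
      "?inv h \<otimes>\<^bsub>BG\<^esub> h' \<in> K" using r unfolding rel_def by metis
    have 1: "?inv g \<otimes>\<^bsub>BG\<^esub> h \<in> K" "?inv h' \<otimes>\<^bsub>BG\<^esub> g' \<in> K"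
      using inv_mult_Stab[OF t gg(1) h(1,3)] inv_mult_Stab[OF t h(2) gg(2) h(4)] N(3)
      unfolding ran_t by blast+
    have "(?inv g \<otimes>\<^bsub>BG\<^esub> h) \<otimes>\<^bsub>BG\<^esub> (?inv h \<otimes>\<^bsub>BG\<^esub> h') \<in> K"
      by (rule subgroup.m_closed[OF K(1) 1(1) h(5)])
    then have "?inv g \<otimes>\<^bsub>BG\<^esub> h' \<in> K"
      unfolding Bij.inv_mult_cancel[OF aut_Bij[OF gg(1)] aut_Bij[OF h(1)] aut_Bij[OF h(2)]] .
    then have "(?inv g \<otimes>\<^bsub>BG\<^esub> h') \<otimes>\<^bsub>BG\<^esub> (?inv h' \<otimes>\<^bsub>BG\<^esub> g') \<in> K"
      by (rule subgroup.m_closed[OF K(1) _ 1(2)])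
    then show ?thesis
      unfolding Bij.inv_mult_cancel[OF aut_Bij[OF gg(1)] aut_Bij[OF h(2)] aut_Bij[OF gg(2)]] .
  qed
  have rel_sym: "rel y x" if r: "rel x y" for x y
  proof -
    obtain g g' where g: "g \<in> G" "g' \<in> G" "x = act_tuple g t" "y = act_tuple g' t" "?inv g \<otimes>\<^bsub>BG\<^esub> g' \<in> K"
      using r unfolding rel_def by metis
    have "?inv (?inv g \<otimes>\<^bsub>BG\<^esub> g') \<in> K" by (rule subgroup.m_inv_closed[OF K(1) g(5)])
    then have "?inv g' \<otimes>\<^bsub>BG\<^esub> g \<in> K"
      unfolding Bij.inv_inv_mult[OF aut_Bij[OF g(1)] aut_Bij[OF g(2)]] .
    then show ?thesis unfolding g(3,4) by (rule relI[OF g(2,1)])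
  qed
  have rel_trans: "rel x z" if r: "rel x y" "rel y z" for x y z
  proof -
    obtain g g' where g: "g \<in> G" "g' \<in> G" "x = act_tuple g t" "y = act_tuple g' t" "?inv g \<otimes>\<^bsub>BG\<^esub> g' \<in> K"
      using r(1) unfolding rel_def by metis
    obtain h where h: "h \<in> G" "z = act_tuple h t" using r(2) unfolding rel_def by metis
    have "?inv g' \<otimes>\<^bsub>BG\<^esub> h \<in> K" by (rule relE[OF g(2) h(1)]) (use r(2) g(4) h(2) in simp)
    with g(5) have "(?inv g \<otimes>\<^bsub>BG\<^esub> g') \<otimes>\<^bsub>BG\<^esub> (?inv g' \<otimes>\<^bsub>BG\<^esub> h) \<in> K" by (rule subgroup.m_closed[OF K(1)])
    then have "?inv g \<otimes>\<^bsub>BG\<^esub> h \<in> K"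
      unfolding Bij.inv_mult_cancel[OF aut_Bij[OF g(1)] aut_Bij[OF g(2)] aut_Bij[OF h(1)]] .
    then show ?thesis unfolding g(3) h(2) by (rule relI[OF g(1) h(1)])
  qed
  have rel_act: "rel (act_tuple \<sigma> x) (act_tuple \<sigma> y)" if s: "\<sigma> \<in> G" and r: "rel x y" for \<sigma> x y
  proof -
    obtain g g' where g: "g \<in> G" "g' \<in> G" "x = act_tuple g t" "y = act_tuple g' t" "?inv g \<otimes>\<^bsub>BG\<^esub> g' \<in> K"
      using r unfolding rel_def by metis
    have "?inv (\<sigma> \<otimes>\<^bsub>BG\<^esub> g) \<otimes>\<^bsub>BG\<^esub> (\<sigma> \<otimes>\<^bsub>BG\<^esub> g') \<in> K"
      unfolding Bij.inv_mult_translate[OF aut_Bij[OF s] aut_Bij[OF g(1)] aut_Bij[OF g(2)]] by (rule g(5))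
    from relI[OF aut_mult[OF s g(1)] aut_mult[OF s g(2)] this] show ?thesis
      unfolding g(3,4) act_tuple_mult[OF s g(1) ran_t_D] act_tuple_mult[OF s g(2) ran_t_D] .
  qed
  \<comment> \<open>Equality is added because \<open>rel\<close> relates only images of
    \<open>t\<close>, while an equivalence on all tuples of this sort is required.\<close>
  define E where "E = {(x, y). x \<in> tuples M J \<and> y \<in> tuples M J \<and> (x = y \<or> rel x y)}"
  have "equiv (tuples M J) E"
  proof (rule equivI)
    show "E \<subseteq> tuples M J \<times> tuples M J" by (auto simp: E_def)
    show "refl_on (tuples M J) E" by (auto simp: refl_on_def E_def)
    show "sym E" using rel_sym by (auto simp: sym_def E_def)
    show "trans E" using rel_trans by (auto simp: trans_def E_def)
  qed
  moreover have "\<forall>\<sigma>\<in>G. \<forall>(x, y)\<in>E. (act_tuple \<sigma> x, act_tuple \<sigma> y) \<in> E"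
    using rel_act act_tuple_in by (auto simp: E_def)
  ultimately have E: "invariant_equiv L M J E" unfolding invariant_equiv_def by (rule conjI)
  have one: "act_tuple \<one>\<^bsub>BG\<^esub> t = t"
    by (rule act_tuple_id, rule one_apply) (use ran_t_D in blast)
  have one_K: "?inv \<one>\<^bsub>BG\<^esub> \<otimes>\<^bsub>BG\<^esub> g = g" if g: "g \<in> G" for g
    using Bij.l_one[OF aut_Bij[OF g]] unfolding Bij.inv_one .
  have "act g (E `` {t}) = E `` {t} \<longleftrightarrow> g \<in> K" if g: "g \<in> G" for g
  proof -
    have "act g (E `` {t}) = E `` {t} \<longleftrightarrow> (act_tuple g t, t) \<in> E"
      unfolding act_class[OF E g t]
      by (rule eq_equiv_class_iff[OF \<open>equiv (tuples M J) E\<close> act_tuple_in[OF g t] t])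
    also have "\<dots> \<longleftrightarrow> rel (act_tuple \<one>\<^bsub>BG\<^esub> t) (act_tuple g t)"
    proof
      assume "(act_tuple g t, t) \<in> E"
      then have "act_tuple g t = t \<or> rel (act_tuple g t) t" by (simp add: E_def)
      then show "rel (act_tuple \<one>\<^bsub>BG\<^esub> t) (act_tuple g t)"
      proof
        assume "act_tuple g t = t"
        then have "act_tuple \<one>\<^bsub>BG\<^esub> t = act_tuple g t" unfolding one by (rule sym)
        from inv_mult_Stab[OF t aut_one g this] have "?inv \<one>\<^bsub>BG\<^esub> \<otimes>\<^bsub>BG\<^esub> g \<in> K"
          using N(3) unfolding ran_t by (rule set_rev_mp)
        then show ?thesis by (rule relI[OF aut_one g])
      next
        assume "rel (act_tuple g t) t"
        then show ?thesis unfolding one by (rule rel_sym)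
      qed
    next
      assume "rel (act_tuple \<one>\<^bsub>BG\<^esub> t) (act_tuple g t)"
      then have "rel (act_tuple g t) t" unfolding one by (rule rel_sym)
      then show "(act_tuple g t, t) \<in> E" using t act_tuple_in[OF g t] by (simp add: E_def)
    qed
    also have "\<dots> \<longleftrightarrow> ?inv \<one>\<^bsub>BG\<^esub> \<otimes>\<^bsub>BG\<^esub> g \<in> K"
      using relI[OF aut_one g] relE[OF aut_one g] by (rule iffI[rotated])
    also have "\<dots> \<longleftrightarrow> g \<in> K" unfolding one_K[OF g] ..
    finally show ?thesis .
  qed
  moreover have "E `` {t} \<in> ultra"
    unfolding ultraimaginaries_def
    by (intro CollectI exI[of _ J] exI[of _ E] conjI J E quotientI t)
  ultimately show thesis using that by blast
qed

section \<open>The Lascar group\<close>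

abbreviation Lascar :: "('m \<Rightarrow> 'm) set" where "Lascar \<equiv> lascar_auts L \<kappa> M"

lemma subgroup_G: "subgroup G BG"
  by (rule Bij.subgroupI) (use aut_Bij aut_one aut_inv aut_mult in auto)

lemma Stab_Lascar: "elementary_submodel L M N \<Longrightarrow> small N \<Longrightarrow> Stab N \<subseteq> Lascar"
  unfolding lascar_auts_def by (rule subsetI, rule generate.incl) (auto simp: Stab_def)

lemma Lascar_subset:
  assumes "subgroup K BG" "\<And>N. elementary_submodel L M N \<Longrightarrow> small N \<Longrightarrow> Stab N \<subseteq> K"
  shows "Lascar \<subseteq> K"
  unfolding lascar_auts_def
  by (rule Bij.generate_subgroup_incl[OF _ assms(1)]) (use assms(2) in \<open>auto simp: Stab_def\<close>)

lemma Lascar_G: "Lascar \<subseteq> G"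
  by (rule Lascar_subset[OF subgroup_G]) (auto simp: Stab_def)

lemma subgroup_Lascar: "subgroup Lascar BG"
  unfolding lascar_auts_def by (rule Bij.generate_is_subgroup) (use aut_Bij in auto)

lemma fixing_empty: "fixing {} = G"
  by (simp add: fixing_auts_def)

lemma bdd_empty_Lascar:
  assumes "e \<in> bdd {}" "elementary_submodel L M N" "small N" "\<sigma> \<in> Stab N" shows "act \<sigma> e = e"
proof (rule bounded_orbit_fixed[OF assms(2,3) bdd_ultra[OF assms(1)] _ assms(4)])
  have "Stab N \<subseteq> fixing {}" by (auto simp: fixing_empty Stab_def)
  then show "small ((\<lambda>\<sigma>. act \<sigma> e) ` Stab N)"
    by (rule small_subset[OF image_mono bdd_orbit[OF assms(1)]])
qed

lemma Stab_conj:
  assumes N: "N \<subseteq> D" and r: "r \<in> G" and h: "h \<in> Stab N"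
  shows "inv\<^bsub>BG\<^esub> r \<otimes>\<^bsub>BG\<^esub> h \<otimes>\<^bsub>BG\<^esub> r \<in> Stab ((inv\<^bsub>BG\<^esub> r) ` N)"
proof -
  have hG: "h \<in> G" using h by (simp add: Stab_def)
  let ?c = "inv\<^bsub>BG\<^esub> r \<otimes>\<^bsub>BG\<^esub> h \<otimes>\<^bsub>BG\<^esub> r"
  have "?c ((inv\<^bsub>BG\<^esub> r) m) = (inv\<^bsub>BG\<^esub> r) m" if "m \<in> N" for m
  proof -
    have m: "m \<in> D" using N that by blast
    have "?c ((inv\<^bsub>BG\<^esub> r) m) = (inv\<^bsub>BG\<^esub> r \<otimes>\<^bsub>BG\<^esub> h) (r ((inv\<^bsub>BG\<^esub> r) m))"
      by (rule mult_apply[OF aut_mult[OF aut_inv[OF r] hG] r inv_in[OF r m]])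
    also have "\<dots> = (inv\<^bsub>BG\<^esub> r \<otimes>\<^bsub>BG\<^esub> h) m" unfolding apply_inv[OF r m] ..
    also have "\<dots> = (inv\<^bsub>BG\<^esub> r) (h m)" by (rule mult_apply[OF aut_inv[OF r] hG m])
    also have "h m = m" using h that by (simp add: Stab_def)
    finally show ?thesis .
  qed
  then show ?thesis unfolding Stab_def
    using aut_mult[OF aut_mult[OF aut_inv[OF r] hG] r] by blast
qed

text \<open>The Lascar group has small index: in g = h r h' the factor h moves past r to a conjugate
  fixing the image of \<open>N\<close> under the inverse of r, which is a small model again. So g is
  r times a Lascar strong automorphism.\<close>

lemma bdd_empty_if_small_Lascar_orbit:
  assumes e: "e \<in> ultra" and orbit: "small ((\<lambda>\<sigma>. act \<sigma> e) ` Lascar)"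
  shows "e \<in> bdd {}"
proof (rule bddI[OF e])
  obtain N where N: "elementary_submodel L M N" "small N"
    by (rule small_elementary_submodel[OF small_finite[OF finite.emptyI] empty_subsetI])
  have N_D: "N \<subseteq> D" using elementary_submodel_Dom[OF N(1)] by blast
  obtain R where R: "R \<subseteq> G" "small R"
    "\<forall>g\<in>G. \<exists>r\<in>R. \<exists>h\<in>Stab N. \<exists>h'\<in>Stab N. g = h \<otimes>\<^bsub>BG\<^esub> r \<otimes>\<^bsub>BG\<^esub> h'"
    by (rule small_double_cosets[OF N(2) N_D])
  have es: "e \<in> sets_of_tuples" by (rule ultra_sets_of_tuples[OF e])
  let ?O = "(\<lambda>\<sigma>. act \<sigma> e) ` Lascar"
  have "(\<lambda>\<sigma>. act \<sigma> e) ` fixing {} \<subseteq> (\<lambda>(r, p). act r p) ` (R \<times> ?O)"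
    unfolding fixing_empty
  proof (rule image_subsetI)
    fix g assume g: "g \<in> G"
    obtain r h h' where r: "r \<in> R" and h: "h \<in> Stab N" "h' \<in> Stab N"
      and eq: "g = h \<otimes>\<^bsub>BG\<^esub> r \<otimes>\<^bsub>BG\<^esub> h'"
      using bspec[OF R(3) g] by (elim bexE)
    have hG: "h \<in> G" "h' \<in> G" "r \<in> G" using h r R(1) by (auto simp: Stab_def)
    have h'e: "act h' e \<in> sets_of_tuples" by (rule act_sets_of_tuples[OF hG(2) es])
    let ?c = "inv\<^bsub>BG\<^esub> r \<otimes>\<^bsub>BG\<^esub> h \<otimes>\<^bsub>BG\<^esub> r"
    have "?c \<in> Stab ((inv\<^bsub>BG\<^esub> r) ` N)" by (rule Stab_conj[OF N_D hG(3) h(1)])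
    then have c: "?c \<in> Lascar"
      using Stab_Lascar[OF elementary_submodel_aut_image[OF aut_inv[OF hG(3)] N(1)] small_image[OF N(2)]]
      by (rule set_rev_mp)
    have h': "h' \<in> Lascar" using Stab_Lascar[OF N] h(2) by blast
    have cG: "?c \<in> G" using c Lascar_G by blast
    have "act g e = act h (act r (act h' e))"
      unfolding eq act_mult[OF aut_mult[OF hG(1,3)] hG(2) es] by (rule act_mult[OF hG(1,3) h'e])
    also have "\<dots> = act r (act ?c (act h' e))" by (rule act_conj[OF hG(1,3) h'e])
    also have "act ?c (act h' e) = act (?c \<otimes>\<^bsub>BG\<^esub> h') e" by (rule act_mult[OF cG hG(2) es, symmetric])
    finally have "act g e = act r (act (?c \<otimes>\<^bsub>BG\<^esub> h') e)" .
    moreover have "act (?c \<otimes>\<^bsub>BG\<^esub> h') e \<in> ?O"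
      by (rule imageI, rule subgroup.m_closed[OF subgroup_Lascar c h'])
    ultimately show "act g e \<in> (\<lambda>(r, p). act r p) ` (R \<times> ?O)"
      using r by (intro image_eqI[of _ _ "(r, act (?c \<otimes>\<^bsub>BG\<^esub> h') e)"]) (simp_all only: case_prod_conv mem_Sigma_iff)
  qed
  then show "small ((\<lambda>\<sigma>. act \<sigma> e) ` fixing {})"
    by (rule small_subset[OF _ small_image[OF small_Times[OF R(2) orbit]]])
qed

section \<open>Chains of conjugates\<close>

text \<open>The group \<open>K\<close> of the overview; \<open>fixing (bdd {c})\<close> is
  \<open>H c\<close>.\<close>

definition joint :: "('k \<rightharpoonup> 'm) set \<Rightarrow> ('k \<rightharpoonup> 'm) set \<Rightarrow> ('m \<Rightarrow> 'm) set" where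
  "joint a b = generate BG (fixing (bdd {a}) \<union> fixing (bdd {b}))"

lemma subgroup_joint: "subgroup (joint a b) BG"
  unfolding joint_def
  by (rule Bij.generate_is_subgroup) (auto intro: aut_Bij fixing_G)

lemma joint_G: "joint a b \<subseteq> G"
  unfolding joint_def
  by (rule Bij.generate_subgroup_incl[OF _ subgroup_G]) (auto intro: fixing_G)

lemma fixing_joint: "\<sigma> \<in> fixing (bdd {a}) \<Longrightarrow> \<sigma> \<in> joint a b" "\<sigma> \<in> fixing (bdd {b}) \<Longrightarrow> \<sigma> \<in> joint a b"
  unfolding joint_def by (rule generate.incl, simp)+

lemma Lascar_subset_joint:
  assumes a: "a \<in> ultra" and b: "b \<in> ultra" and bdd: "bdd {a} \<inter> bdd {b} = bdd {}"
  shows "Lascar \<subseteq> joint a b"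
proof -
  obtain A where A: "small A" "A \<subseteq> D" "\<And>N. elementary_submodel L M N \<Longrightarrow> small N \<Longrightarrow> A \<subseteq> N \<Longrightarrow>
    Stab N \<subseteq> fixing {a} \<inter> fixing (bdd {a})" using Stab_model_fixing_bdd[OF a] by metis
  obtain N where N: "elementary_submodel L M N" "small N" "A \<subseteq> N"
    by (rule small_elementary_submodel[OF A(1,2)])
  have "Stab N \<subseteq> joint a b" using A(3)[OF N] fixing_joint(1) by blast
  moreover have "N \<subseteq> D" using elementary_submodel_Dom[OF N(1)] by blast
  ultimately obtain e where e: "e \<in> ultra" and stab: "\<And>g. g \<in> G \<Longrightarrow> act g e = e \<longleftrightarrow> g \<in> joint a b"
    using ultraimaginary_with_stabilizer[OF subgroup_joint joint_G N(2)] by metis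
  have "e \<in> bdd {a}" by (rule bdd_if_fixed[OF a e]) (use stab fixing_G fixing_joint(1) in blast)
  moreover have "e \<in> bdd {b}" by (rule bdd_if_fixed[OF b e]) (use stab fixing_G fixing_joint(2) in blast)
  ultimately have "e \<in> bdd {}" using bdd by blast
  show ?thesis
  proof (rule Lascar_subset[OF subgroup_joint], rule subsetI)
    fix N' \<sigma> assume "elementary_submodel L M N'" "small N'" and \<sigma>: "\<sigma> \<in> Stab N'"
    then have "act \<sigma> e = e" by (rule bdd_empty_Lascar[OF \<open>e \<in> bdd {}\<close>])
    moreover have "\<sigma> \<in> G" using \<sigma> by (simp add: Stab_def)
    ultimately show "\<sigma> \<in> joint a b" using stab by blast
  qed
qed

lemma same_type_over_refl: "B \<subseteq> sets_of_tuples \<Longrightarrow> c \<in> ultra \<Longrightarrow> same_type_over L M B c c"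
  unfolding same_type_over_def using fixing_one act_one[OF ultra_sets_of_tuples] by blast

text \<open>The conjugate by \<open>g\<close> of the inverse of \<open>s\<close> undoes the change
  from \<open>act g x\<close> to \<open>act g (act s x)\<close>, and it fixes everything bounded
  over \<open>act g c\<close>. Multiplying \<open>g\<close> by \<open>s\<close> on the right is thus
  an admissible move of a chain.\<close>

lemma same_type_over_act:
  assumes c: "c \<in> ultra" and x: "x \<in> ultra" and g: "g \<in> G" and s: "s \<in> fixing (bdd {c})"
  shows "same_type_over L M (bdd {act g c}) (act g (act s x)) (act g x)"
proof -
  let ?i = "inv\<^bsub>BG\<^esub> s"
  have i: "?i \<in> fixing (bdd {c})" by (rule fixing_inv[OF bdd_sets s])
  have sG: "s \<in> G" "?i \<in> G" using s i by (auto intro: fixing_G)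
  have xs: "x \<in> sets_of_tuples" by (rule ultra_sets_of_tuples[OF x])
  have y: "act s x \<in> sets_of_tuples" by (rule act_sets_of_tuples[OF sG(1) xs])
  have gy: "act g (act s x) \<in> sets_of_tuples" by (rule act_sets_of_tuples[OF g y])
  have "act (g \<otimes>\<^bsub>BG\<^esub> ?i \<otimes>\<^bsub>BG\<^esub> inv\<^bsub>BG\<^esub> g) (act g (act s x)) =
      act (g \<otimes>\<^bsub>BG\<^esub> ?i) (act (inv\<^bsub>BG\<^esub> g) (act g (act s x)))"
    by (rule act_mult[OF aut_mult[OF g sG(2)] aut_inv[OF g] gy])
  also have "\<dots> = act (g \<otimes>\<^bsub>BG\<^esub> ?i) (act s x)" unfolding act_inv_act[OF g y] ..
  also have "\<dots> = act g (act ?i (act s x))" by (rule act_mult[OF g sG(2) y])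
  also have "\<dots> = act g x" unfolding act_inv_act[OF sG(1) xs] ..
  finally show ?thesis
    unfolding same_type_over_def using fixing_bdd_act[OF c g i] by blast
qed

definition chain ::
  "('k \<rightharpoonup> 'm) set \<Rightarrow> ('k \<rightharpoonup> 'm) set \<Rightarrow> nat \<Rightarrow> (nat \<Rightarrow> ('k \<rightharpoonup> 'm) set) \<Rightarrow> (nat \<Rightarrow> ('k \<rightharpoonup> 'm) set) \<Rightarrow> bool" where
  "chain a b n as bs \<longleftrightarrow> (\<forall>i\<le>n. as i \<in> ultra \<and> bs i \<in> ultra) \<and> as 0 = a \<and> bs 0 = b \<and>
     (\<forall>i<n. same_type_over L M (bdd {as i}) (bs (Suc i)) (bs i) \<and>
            same_type_over L M (bdd {bs (Suc i)}) (as (Suc i)) (as i))"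

lemma chain_Suc:
  assumes ch: "chain a b n as bs" and ultra: "a' \<in> ultra" "b' \<in> ultra"
    and tp: "same_type_over L M (bdd {as n}) b' (bs n)" "same_type_over L M (bdd {b'}) a' (as n)"
  shows "chain a b (Suc n) (as(Suc n := a')) (bs(Suc n := b'))"
proof -
  have "same_type_over L M (bdd {(as(Suc n := a')) i}) ((bs(Suc n := b')) (Suc i)) ((bs(Suc n := b')) i) \<and>
      same_type_over L M (bdd {(bs(Suc n := b')) (Suc i)}) ((as(Suc n := a')) (Suc i)) ((as(Suc n := a')) i)"
    if "i < Suc n" for i
    using that tp ch by (cases "i = n") (auto simp: chain_def)
  moreover have "(as(Suc n := a')) i \<in> ultra \<and> (bs(Suc n := b')) i \<in> ultra" if "i \<le> Suc n" for i
    using that ultra ch by (cases "i = Suc n") (auto simp: chain_def)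
  ultimately show ?thesis using ch by (simp add: chain_def)
qed

text \<open>One automorphism accounts for both ends of the chain, because the next link changes each
  end over the other.\<close>

definition reachable :: "('k \<rightharpoonup> 'm) set \<Rightarrow> ('k \<rightharpoonup> 'm) set \<Rightarrow> ('m \<Rightarrow> 'm) \<Rightarrow> bool" where
  "reachable a b g \<longleftrightarrow> g \<in> G \<and> (\<exists>n as bs. chain a b n as bs \<and> as n = act g a \<and> bs n = act g b)"

lemma reachable_one:
  assumes "a \<in> ultra" "b \<in> ultra" shows "reachable a b \<one>\<^bsub>BG\<^esub>"
proof -
  have "chain a b 0 (\<lambda>_. a) (\<lambda>_. b)" using assms by (simp add: chain_def)
  moreover have "act \<one>\<^bsub>BG\<^esub> a = a" "act \<one>\<^bsub>BG\<^esub> b = b" using assms act_one ultra_sets_of_tuples by blast+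
  ultimately show ?thesis unfolding reachable_def
    by (intro conjI exI[of _ 0] exI[of _ "\<lambda>_. a"] exI[of _ "\<lambda>_. b"] aut_one) simp_all
qed

text \<open>An \<open>s\<close> from the first group fixes \<open>a\<close>, so only the second
  coordinate moves, and conversely. The other half of the new link is then trivial.\<close>

lemma reachable_step:
  assumes a: "a \<in> ultra" and b: "b \<in> ultra" and g: "reachable a b g"
    and s: "s \<in> fixing (bdd {a}) \<union> fixing (bdd {b})"
  shows "reachable a b (g \<otimes>\<^bsub>BG\<^esub> s)"
proof -
  obtain n as bs where gG: "g \<in> G" and ch: "chain a b n as bs" and n: "as n = act g a" "bs n = act g b"
    using g unfolding reachable_def by blast
  have sG: "s \<in> G" using s fixing_G by blast
  let ?a = "act g (act s a)" and ?b = "act g (act s b)"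
  have gs: "act (g \<otimes>\<^bsub>BG\<^esub> s) a = ?a" "act (g \<otimes>\<^bsub>BG\<^esub> s) b = ?b"
    by (rule act_mult[OF gG sG ultra_sets_of_tuples[OF a]], rule act_mult[OF gG sG ultra_sets_of_tuples[OF b]])
  have ultra: "?a \<in> ultra" "?b \<in> ultra"
    by (rule act_ultra[OF gG act_ultra[OF sG a]], rule act_ultra[OF gG act_ultra[OF sG b]])
  have "same_type_over L M (bdd {as n}) ?b (bs n) \<and> same_type_over L M (bdd {?b}) ?a (as n)"
    using s
  proof
    assume s: "s \<in> fixing (bdd {a})"
    have "?a = as n" unfolding n fixing_act[OF s bdd_self[OF a]] ..
    then show ?thesis using same_type_over_act[OF a b gG s] same_type_over_refl[OF bdd_sets ultra(1)]
      unfolding n by metis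
  next
    assume s: "s \<in> fixing (bdd {b})"
    have "?b = bs n" unfolding n fixing_act[OF s bdd_self[OF b]] ..
    then show ?thesis using same_type_over_act[OF b a gG s] same_type_over_refl[OF bdd_sets ultra(2)]
      unfolding n by metis
  qed
  then have "chain a b (Suc n) (as(Suc n := ?a)) (bs(Suc n := ?b))"
    using chain_Suc[OF ch ultra] by blast
  then show ?thesis unfolding reachable_def gs
    by (intro conjI aut_mult[OF gG sG] exI[of _ "Suc n"] exI[of _ "as(Suc n := ?a)"] exI[of _ "bs(Suc n := ?b)"])
      simp_all
qed

lemma reachable_joint:
  assumes a: "a \<in> ultra" and b: "b \<in> ultra" and k: "k \<in> joint a b" shows "reachable a b k"
proof -
  \<comment> \<open>Moves multiply on the right, so the induction over generated elements needs an
    arbitrary reachable left factor.\<close>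
  have "reachable a b (g \<otimes>\<^bsub>BG\<^esub> k)" if "reachable a b g" for g
    using k that unfolding joint_def
  proof (induction k arbitrary: g)
    case one
    then have "g \<in> carrier BG" using aut_Bij by (simp add: reachable_def)
    then show ?case using one by (simp only: Bij.r_one)
  next
    case (incl h)
    then show ?case by (intro reachable_step[OF a b])
  next
    case (inv h)
    then have "inv\<^bsub>BG\<^esub> h \<in> fixing (bdd {a}) \<union> fixing (bdd {b})"
      using fixing_inv[OF bdd_sets] by blast
    then show ?case by (rule reachable_step[OF a b inv.prems])
  next
    case (eng h1 h2)
    have "h1 \<in> carrier BG" "h2 \<in> carrier BG"
      using eng.hyps joint_G[of a b] aut_Bij unfolding joint_def by blast+
    moreover have "g \<in> carrier BG" using eng.prems aut_Bij by (simp add: reachable_def)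
    ultimately have "g \<otimes>\<^bsub>BG\<^esub> (h1 \<otimes>\<^bsub>BG\<^esub> h2) = g \<otimes>\<^bsub>BG\<^esub> h1 \<otimes>\<^bsub>BG\<^esub> h2"
      by (intro Bij.m_assoc[symmetric])
    then show ?case using eng.IH(2)[OF eng.IH(1)[OF eng.prems]] by (simp only:)
  qed
  from this[OF reachable_one[OF a b]] show ?thesis
    using Bij.l_one[of k] k joint_G aut_Bij by (metis subsetD)
qed

text \<open>As long as \<open>g\<close> fixes \<open>e\<close>, this \<open>e\<close> is bounded
  over \<open>act g a\<close> and \<open>act g b\<close> as well. The automorphisms realising the
  next link therefore fix \<open>e\<close>, and composing them with \<open>g\<close> preserves the
  invariant.\<close>

lemma chain_conjugate:
  assumes a: "a \<in> ultra" and b: "b \<in> ultra" and ch: "chain a b n as bs"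
    and e: "e \<in> bdd {a} \<inter> bdd {b}"
  shows "i \<le> n \<Longrightarrow> \<exists>g\<in>G. act g a = as i \<and> act g b = bs i \<and> act g e = e"
proof (induction i)
  case 0
  have "act \<one>\<^bsub>BG\<^esub> a = a" "act \<one>\<^bsub>BG\<^esub> b = b" "act \<one>\<^bsub>BG\<^esub> e = e"
    using act_one ultra_sets_of_tuples a b bdd_ultra e by blast+
  then show ?case using ch aut_one by (auto simp: chain_def)
next
  case (Suc i)
  then obtain g where g: "g \<in> G" "act g a = as i" "act g b = bs i" "act g e = e" by auto
  have i: "i < n" using Suc.prems by simp
  obtain \<tau> where \<tau>: "\<tau> \<in> fixing (bdd {as i})" "act \<tau> (bs (Suc i)) = bs i"
    using ch i unfolding chain_def same_type_over_def by blast
  obtain \<rho> where \<rho>: "\<rho> \<in> fixing (bdd {bs (Suc i)})" "act \<rho> (as (Suc i)) = as i"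
    using ch i unfolding chain_def same_type_over_def by blast
  have ultra: "as i \<in> ultra" "bs i \<in> ultra" "as (Suc i) \<in> ultra" "bs (Suc i) \<in> ultra"
    using ch Suc.prems unfolding chain_def by auto
  have es: "e \<in> sets_of_tuples" using bdd_sets e by blast
  let ?t = "inv\<^bsub>BG\<^esub> \<tau>" and ?r = "inv\<^bsub>BG\<^esub> \<rho>"
  have t: "?t \<in> fixing (bdd {as i})" by (rule fixing_inv[OF bdd_sets \<tau>(1)])
  have r: "?r \<in> fixing (bdd {bs (Suc i)})" by (rule fixing_inv[OF bdd_sets \<rho>(1)])
  have t_b: "act ?t (bs i) = bs (Suc i)"
    using act_inv_act[OF fixing_G[OF \<tau>(1)] ultra_sets_of_tuples[OF ultra(4)]] unfolding \<tau>(2) .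
  have r_a: "act ?r (as i) = as (Suc i)"
    using act_inv_act[OF fixing_G[OF \<rho>(1)] ultra_sets_of_tuples[OF ultra(3)]] unfolding \<rho>(2) .
  have "e \<in> bdd {as i}" using bdd_act[OF a g(1), of e] e unfolding g by blast
  then have t_e: "act ?t e = e" by (rule fixing_act[OF t])
  have t_a: "act ?t (as i) = as i" by (rule fixing_act[OF t bdd_self[OF ultra(1)]])
  define g' where "g' = ?t \<otimes>\<^bsub>BG\<^esub> g"
  have g'G: "g' \<in> G" unfolding g'_def by (rule aut_mult[OF fixing_G[OF t] g(1)])
  have act_g': "act g' x = act ?t (act g x)" if "x \<in> sets_of_tuples" for x
    unfolding g'_def by (rule act_mult[OF fixing_G[OF t] g(1) that])
  have g': "act g' a = as i" "act g' b = bs (Suc i)" "act g' e = e"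
    using act_g'[OF ultra_sets_of_tuples[OF a]] act_g'[OF ultra_sets_of_tuples[OF b]] act_g'[OF es]
    unfolding g t_a t_b t_e by auto
  have "e \<in> bdd {bs (Suc i)}" using bdd_act[OF b g'G, of e] e unfolding g' by blast
  then have r_e: "act ?r e = e" by (rule fixing_act[OF r])
  have r_b: "act ?r (bs (Suc i)) = bs (Suc i)" by (rule fixing_act[OF r bdd_self[OF ultra(4)]])
  have act_g'': "act (?r \<otimes>\<^bsub>BG\<^esub> g') x = act ?r (act g' x)" if "x \<in> sets_of_tuples" for x
    by (rule act_mult[OF fixing_G[OF r] g'G that])
  have "act (?r \<otimes>\<^bsub>BG\<^esub> g') a = as (Suc i)" "act (?r \<otimes>\<^bsub>BG\<^esub> g') b = bs (Suc i)" "act (?r \<otimes>\<^bsub>BG\<^esub> g') e = e"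
    using act_g''[OF ultra_sets_of_tuples[OF a]] act_g''[OF ultra_sets_of_tuples[OF b]] act_g''[OF es]
    unfolding g' r_a r_b r_e by auto
  then show ?case using aut_mult[OF fixing_G[OF r] g'G] by blast
qed

section \<open>The two implications and the quasi-finitary case\<close>

definition connected :: "('k \<rightharpoonup> 'm) set \<Rightarrow> ('k \<rightharpoonup> 'm) set \<Rightarrow> bool" where
  "connected a b \<longleftrightarrow> (\<forall>a'. a' \<in> ultra \<and> same_lstp L \<kappa> M a' a \<longrightarrow>
     (\<exists>n as bs. chain a b n as bs \<and> as n = a'))"

lemma bdd_Int_imp_connected:
  assumes a: "a \<in> ultra" and b: "b \<in> ultra" and bdd: "bdd {a} \<inter> bdd {b} = bdd {}"
  shows "connected a b"
  unfolding connected_def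
proof (intro allI impI, elim conjE)
  fix a' assume a': "a' \<in> ultra" and "same_lstp L \<kappa> M a' a"
  then obtain \<sigma> where \<sigma>: "\<sigma> \<in> Lascar" "act \<sigma> a' = a" unfolding same_lstp_def by blast
  have \<sigma>G: "\<sigma> \<in> G" using \<sigma>(1) Lascar_G by blast
  have "inv\<^bsub>BG\<^esub> \<sigma> \<in> Lascar" by (rule subgroup.m_inv_closed[OF subgroup_Lascar \<sigma>(1)])
  then have "reachable a b (inv\<^bsub>BG\<^esub> \<sigma>)"
    using Lascar_subset_joint[OF a b bdd] reachable_joint[OF a b] by blast
  moreover have "act (inv\<^bsub>BG\<^esub> \<sigma>) a = a'"
    using act_inv_act[OF \<sigma>G ultra_sets_of_tuples[OF a']] unfolding \<sigma>(2) .
  ultimately show "\<exists>n as bs. chain a b n as bs \<and> as n = a'" unfolding reachable_def by blast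
qed

lemma connected_imp_bdd_Int:
  assumes a: "a \<in> ultra" and b: "b \<in> ultra" and con: "connected a b"
  shows "bdd {a} \<inter> bdd {b} = bdd {}"
proof
  show "bdd {} \<subseteq> bdd {a} \<inter> bdd {b}" using bdd_mono[OF empty_subsetI] by blast
  show "bdd {a} \<inter> bdd {b} \<subseteq> bdd {}"
  proof
    fix e assume e: "e \<in> bdd {a} \<inter> bdd {b}"
    then have ea: "e \<in> bdd {a}" by blast
    have es: "e \<in> sets_of_tuples" using bdd_sets ea by blast
    have as: "a \<in> sets_of_tuples" by (rule ultra_sets_of_tuples[OF a])
    have "act \<sigma> e \<in> (\<lambda>\<sigma>. act \<sigma> e) ` fixing {a}" if \<sigma>: "\<sigma> \<in> Lascar" for \<sigma>
    proof -
      have \<sigma>G: "\<sigma> \<in> G" using \<sigma> Lascar_G by blast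
      \<comment> \<open>The inverse is used so that \<sigma> brings the end of the chain back to
        \<open>a\<close>: \<sigma> times the automorphism of the chain fixes \<open>a\<close> and
        acts on \<open>e\<close> as \<sigma> does.\<close>
      let ?a = "act (inv\<^bsub>BG\<^esub> \<sigma>) a"
      have \<sigma>_a: "act \<sigma> ?a = a" by (rule act_act_inv[OF \<sigma>G as])
      have "?a \<in> ultra" by (rule act_ultra[OF aut_inv[OF \<sigma>G] a])
      moreover have "same_lstp L \<kappa> M ?a a" unfolding same_lstp_def using \<sigma> \<sigma>_a by blast
      ultimately obtain n as bs where ch: "chain a b n as bs" "as n = ?a"
        using con unfolding connected_def by blast
      obtain g where g: "g \<in> G" "act g a = ?a" "act g e = e"
        using chain_conjugate[OF a b ch(1) e, of n] ch(2) by auto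
      have "act (\<sigma> \<otimes>\<^bsub>BG\<^esub> g) a = a"
        using act_mult[OF \<sigma>G g(1) as] unfolding g(2) \<sigma>_a .
      then have "\<sigma> \<otimes>\<^bsub>BG\<^esub> g \<in> fixing {a}" using aut_mult[OF \<sigma>G g(1)] by (simp add: fixing_auts_def)
      moreover have "act (\<sigma> \<otimes>\<^bsub>BG\<^esub> g) e = act \<sigma> e"
        using act_mult[OF \<sigma>G g(1) es] unfolding g(3) .
      ultimately show ?thesis by (metis imageI)
    qed
    then have "(\<lambda>\<sigma>. act \<sigma> e) ` Lascar \<subseteq> (\<lambda>\<sigma>. act \<sigma> e) ` fixing {a}" by (rule image_subsetI)
    then have "small ((\<lambda>\<sigma>. act \<sigma> e) ` Lascar)" by (rule small_subset[OF _ bdd_orbit[OF ea]])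
    then show "e \<in> bdd {}" by (rule bdd_empty_if_small_Lascar_orbit[OF bdd_ultra[OF ea]])
  qed
qed

lemma quasi_finitary_trans:
  assumes "a \<in> ultra" "quasi_finitary L \<kappa> M a" "e \<in> bdd {a}" shows "quasi_finitary L \<kappa> M e"
proof -
  obtain I t where t: "finite I" "t \<in> tuples M I" "bounded_over L \<kappa> M {{t}} a"
    using assms(2) unfolding quasi_finitary_def by blast
  have "{{t}} \<subseteq> sets_of_tuples" using t(2) by (auto simp: tuples_def)
  then have "bounded_over L \<kappa> M {{t}} e" by (rule bounded_over_trans[OF _ assms(1) t(3) assms(3)])
  then show ?thesis using t(1,2) unfolding quasi_finitary_def by blast
qed

text \<open>Everything in the intersection, and with it everything in \<open>bdd {}\<close>, is
  already quasi-finitary, so both sides speak of the same sets.\<close>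

lemma bddqfu_Int_iff:
  assumes a: "a \<in> ultra" and b: "b \<in> ultra" and qf: "quasi_finitary L \<kappa> M a \<or> quasi_finitary L \<kappa> M b"
  shows "bdd {a} \<inter> bdd {b} = bdd {} \<longleftrightarrow>
    bddqfu L \<kappa> M {a} \<inter> bddqfu L \<kappa> M {b} = bddqfu L \<kappa> M {}"
proof -
  have "bdd {} \<subseteq> bdd {a} \<inter> bdd {b}" using bdd_mono[OF empty_subsetI] by blast
  moreover have "quasi_finitary L \<kappa> M e" if "e \<in> bdd {a} \<inter> bdd {b}" for e
    using qf quasi_finitary_trans[OF a] quasi_finitary_trans[OF b] that by blast
  ultimately show ?thesis unfolding bddqfu_def by blast
qed

end

theorem proposition2p12:
  fixes L :: "('f, 'r) lang" and T :: "('f, 'r) fm set"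
    and \<kappa> :: "'k rel" and M :: "('f, 'r, 'm) struct"
    and a b :: "('k \<rightharpoonup> 'm) set"
  assumes "complete_theory L T"
    and "monster_model L T \<kappa> M"
    and "a \<in> ultraimaginaries L \<kappa> M"
    and "b \<in> ultraimaginaries L \<kappa> M"
  shows "(bddu L \<kappa> M {a} \<inter> bddu L \<kappa> M {b} = bddu L \<kappa> M {}
          \<longleftrightarrow>
          (\<forall>a'. a' \<in> ultraimaginaries L \<kappa> M \<and> same_lstp L \<kappa> M a' a \<longrightarrow>
             (\<exists>(n::nat) (as :: nat \<Rightarrow> ('k \<rightharpoonup> 'm) set) (bs :: nat \<Rightarrow> ('k \<rightharpoonup> 'm) set).
                (\<forall>i\<le>n. as i \<in> ultraimaginaries L \<kappa> M \<and> bs i \<in> ultraimaginaries L \<kappa> M) \<and>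
                as 0 = a \<and> bs 0 = b \<and> as n = a' \<and>
                (\<forall>i<n. same_type_over L M (bddu L \<kappa> M {as i}) (bs (Suc i)) (bs i) \<and>
                       same_type_over L M (bddu L \<kappa> M {bs (Suc i)}) (as (Suc i)) (as i)))))
         \<and>
         (quasi_finitary L \<kappa> M a \<or> quasi_finitary L \<kappa> M b \<longrightarrow>
          (bddu L \<kappa> M {a} \<inter> bddu L \<kappa> M {b} = bddu L \<kappa> M {}
           \<longleftrightarrow>
           bddqfu L \<kappa> M {a} \<inter> bddqfu L \<kappa> M {b} = bddqfu L \<kappa> M {}))"
proof -
  interpret monster L T \<kappa> M by (rule monster.intro[OF assms(2)])
  have "bdd {a} \<inter> bdd {b} = bdd {} \<longleftrightarrow> connected a b"
    using bdd_Int_imp_connected[OF assms(3,4)] connected_imp_bdd_Int[OF assms(3,4)] by blast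
  also have "\<dots> \<longleftrightarrow>
      (\<forall>a'. a' \<in> ultra \<and> same_lstp L \<kappa> M a' a \<longrightarrow>
         (\<exists>n as bs. (\<forall>i\<le>n. as i \<in> ultra \<and> bs i \<in> ultra) \<and> as 0 = a \<and> bs 0 = b \<and> as n = a' \<and>
            (\<forall>i<n. same_type_over L M (bdd {as i}) (bs (Suc i)) (bs i) \<and>
                   same_type_over L M (bdd {bs (Suc i)}) (as (Suc i)) (as i))))"
    unfolding connected_def chain_def by (simp only: conj_ac)
  finally show ?thesis by (intro conjI impI bddqfu_Int_iff[OF assms(3,4)])
qed

end
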